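(* Let $\lambda=(\lambda_n)$ be a frequency and $1\le p\le\infty$. For every bounded sequence $\big(\sum a_n^{(N)}e^{-\lambda_n s}\big)_N$ in $\mathcal{H}_p(\lambda)$ there exist a subsequence $(N_k)_k$ and a $\lambda$-Dirichlet series $\sum a_n e^{-\lambda_n s}\in\mathcal{H}_p(\lambda)$ such that \[ \lim_{k\to\infty}\sum a_n^{(N_k)}e^{-\lambda_n\sigma}e^{-\lambda_n s}=\sum a_n e^{-\lambda_n\sigma}e^{-\lambda_n s} \] in $\mathcal{H}_p(\lambda)$ for every $\sigma>0$.
   Context: A frequency is a strictly increasing unbounded sequence $\lambda=(\lambda_n)_{n\ge 1}$ of non-negative real numbers. A $\lambda$-Dirichlet series is a formal series $\sum a_n e^{-\lambda_n s}$, $a_n\in\mathbb{C}$. A $\lambda$-Dirichlet group is a pair $(G,\beta)$ with $G$ a compact abelian group and $\beta:(\mathbb{R},+)\to G$ a continuous homomorphism with dense range such that for each $n$ there is a (unique) character $h_{\lambda_n}\in\widehat G$ with $h_{\lambda_n}(\beta(t))=e^{-i\lambda_n t}$ for all $t\in\mathbb{R}$; such groups always exist (e.g. the Bohr compactification of $\mathbb{R}$). For $1\le p\le\infty$, $H_p^\lambda(G)$ is the closed subspace of $L_p(G)$ (Haar measure) of all $f$ whose Fourier coefficients vanish at all characters outside $\{h_{\lambda_n}:n\in\mathbb{N}\}$. $\mathcal{H}_p(\lambda)$ is the Banach space of all $\lambda$-Dirichlet series $\sum a_n e^{-\lambda_n s}$ for which there is a (unique) $f\in H_p^\lambda(G)$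 with $a_n=\widehat f(h_{\lambda_n})$ for all $n$, with norm $\|f\|_{L_p(G)}$; this does not depend on the choice of the $\lambda$-Dirichlet group. *)

theory Defs
  imports "HOL-Analysis.Analysis" "HOL-Probability.Essential_Supremum"
begin

text \<open>Sequences are indexed from 0, so \<open>lam n\<close> is the \<open>(n+1)\<close>-st term of the frequency.\<close>

definition frequency :: "(nat \<Rightarrow> real) \<Rightarrow> bool" where
  "frequency lam \<longleftrightarrow> strict_mono lam \<and> (\<forall>n. 0 \<le> lam n) \<and> \<not> bdd_above (range lam)"

text \<open>Compact groups are Hausdorff and written additively: a compact abelian group is a type of
  sort \<open>{t2_space, topological_ab_group_add}\<close> whose universe is compact.\<close>

definition characters :: "('g::{t2_space,topological_ab_group_add} \<Rightarrow> complex) set" where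
  "characters = {h. continuous_on UNIV h \<and> (\<forall>x. norm (h x) = 1) \<and>
                    (\<forall>x y. h (x + y) = h x * h y)}"

definition dirichlet_group ::
  "(nat \<Rightarrow> real) \<Rightarrow> (real \<Rightarrow> 'g::{t2_space,topological_ab_group_add}) \<Rightarrow> bool" where
  "dirichlet_group lam \<beta> \<longleftrightarrow>
     compact (UNIV :: 'g set) \<and>
     continuous_on UNIV \<beta> \<and> (\<forall>s t. \<beta> (s + t) = \<beta> s + \<beta> t) \<and>
     closure (range \<beta>) = UNIV \<and>
     (\<forall>n. \<exists>h\<in>characters. \<forall>t. h (\<beta> t) = exp (- \<i> * of_real (lam n * t)))"

text \<open>The character \<open>h\<^sub>x\<close> of \<open>G\<close> extending \<open>e\<^sup>-\<^sup>i\<^sup>x\<^sup>t\<close>; it is unique when it exists since \<open>\<beta>\<close> has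
  dense range.\<close>

definition char_of ::
  "(real \<Rightarrow> 'g::{t2_space,topological_ab_group_add}) \<Rightarrow> real \<Rightarrow> 'g \<Rightarrow> complex" where
  "char_of \<beta> x = (THE h. h \<in> characters \<and> (\<forall>t. h (\<beta> t) = exp (- \<i> * of_real (x * t))))"

lemma char_of_unique:
  assumes "dirichlet_group lam \<beta>"
  shows "\<exists>!h. h \<in> characters \<and> (\<forall>t. h (\<beta> t) = exp (- \<i> * of_real (lam n * t)))"
proof (rule ex_ex1I)
  show "\<exists>h. h \<in> characters \<and> (\<forall>t. h (\<beta> t) = exp (- \<i> * of_real (lam n * t)))"
    using assms unfolding dirichlet_group_def by blast
next
  fix h g
  assume c: "h \<in> characters \<and> (\<forall>t. h (\<beta> t) = exp (- \<i> * of_real (lam n * t)))"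
     and p: "g \<in> characters \<and> (\<forall>t. g (\<beta> t) = exp (- \<i> * of_real (lam n * t)))"
  have "closed {x. h x = g x}"
    using c p by (intro closed_Collect_eq) (auto simp: characters_def)
  then have "closure (range \<beta>) \<subseteq> {x. h x = g x}"
    using c p by (intro closure_minimal) auto
  then show "h = g"
    using assms unfolding dirichlet_group_def by auto
qed

lemma
  assumes "dirichlet_group lam \<beta>"
  shows char_of_in_characters: "char_of \<beta> (lam n) \<in> characters"
    and char_of_apply: "char_of \<beta> (lam n) (\<beta> t) = exp (- \<i> * of_real (lam n * t))"
  using theI'[OF char_of_unique[OF assms, of n]] unfolding char_of_def by auto

text \<open>Normalised Haar measure: the regular translation-invariant Borel probability measure.
  Regularity is not automatic, as \<open>G\<close> need not be second countable.\<close>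

definition haar_measure :: "'g::{t2_space,topological_ab_group_add} measure \<Rightarrow> bool" where
  "haar_measure \<mu> \<longleftrightarrow>
     sets \<mu> = sets borel \<and> emeasure \<mu> (space \<mu>) = 1 \<and>
     (\<forall>x. \<forall>A\<in>sets borel. emeasure \<mu> ((\<lambda>y. x + y) ` A) = emeasure \<mu> A) \<and>
     (\<forall>A\<in>sets borel. emeasure \<mu> A = (SUP K\<in>{K. K \<subseteq> A \<and> compact K}. emeasure \<mu> K)) \<and>
     (\<forall>A\<in>sets borel. emeasure \<mu> A = (INF U\<in>{U. A \<subseteq> U \<and> open U}. emeasure \<mu> U))"

text \<open>\<open>L\<^sub>p\<close> for \<open>1 \<le> p \<le> \<infinity>\<close> is represented by functions rather than by classes of a.e. equal ones.\<close>

definition Lp :: "ennreal \<Rightarrow> 'x measure \<Rightarrow> ('x \<Rightarrow> complex) set" where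
  "Lp p \<mu> = {f \<in> borel_measurable \<mu>.
     if p = \<infinity> then esssup \<mu> (\<lambda>x. ereal (norm (f x))) < \<infinity>
     else integrable \<mu> (\<lambda>x. norm (f x) powr enn2real p)}"

definition Lp_norm :: "ennreal \<Rightarrow> 'x measure \<Rightarrow> ('x \<Rightarrow> complex) \<Rightarrow> real" where
  "Lp_norm p \<mu> f =
     (if p = \<infinity> then real_of_ereal (esssup \<mu> (\<lambda>x. ereal (norm (f x))))
      else (\<integral>x. norm (f x) powr enn2real p \<partial>\<mu>) powr (1 / enn2real p))"

definition fourier_coeff :: "'g measure \<Rightarrow> ('g \<Rightarrow> complex) \<Rightarrow> ('g \<Rightarrow> complex) \<Rightarrow> complex" where
  "fourier_coeff \<mu> f h = (\<integral>x. f x * cnj (h x) \<partial>\<mu>)"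

definition Hp_group :: "ennreal \<Rightarrow> (nat \<Rightarrow> real) \<Rightarrow>
    (real \<Rightarrow> 'g::{t2_space,topological_ab_group_add}) \<Rightarrow> 'g measure \<Rightarrow> ('g \<Rightarrow> complex) set" where
  "Hp_group p lam \<beta> \<mu> =
     {f \<in> Lp p \<mu>. \<forall>h\<in>characters. h \<notin> range (\<lambda>n. char_of \<beta> (lam n)) \<longrightarrow> fourier_coeff \<mu> f h = 0}"

text \<open>A formal Dirichlet series \<open>\<Sum> a\<^sub>n e\<^sup>-\<^sup>\<lambda>\<^sup>n\<^sup>s\<close> is identified with its coefficient sequence \<open>a\<close>.\<close>

type_synonym dirichlet_series = "nat \<Rightarrow> complex"

definition represents :: "ennreal \<Rightarrow> (nat \<Rightarrow> real) \<Rightarrow>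
    (real \<Rightarrow> 'g::{t2_space,topological_ab_group_add}) \<Rightarrow> 'g measure \<Rightarrow>
    ('g \<Rightarrow> complex) \<Rightarrow> dirichlet_series \<Rightarrow> bool" where
  "represents p lam \<beta> \<mu> f a \<longleftrightarrow>
     f \<in> Hp_group p lam \<beta> \<mu> \<and> (\<forall>n. a n = fourier_coeff \<mu> f (char_of \<beta> (lam n)))"

definition Hp :: "ennreal \<Rightarrow> (nat \<Rightarrow> real) \<Rightarrow>
    (real \<Rightarrow> 'g::{t2_space,topological_ab_group_add}) \<Rightarrow> 'g measure \<Rightarrow> dirichlet_series set" where
  "Hp p lam \<beta> \<mu> = {a. \<exists>f. represents p lam \<beta> \<mu> f a}"

text \<open>The representing function is unique up to null sets, so the choice does not affect the norm.\<close>

definition Hp_norm :: "ennreal \<Rightarrow> (nat \<Rightarrow> real) \<Rightarrow>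
    (real \<Rightarrow> 'g::{t2_space,topological_ab_group_add}) \<Rightarrow> 'g measure \<Rightarrow> dirichlet_series \<Rightarrow> real" where
  "Hp_norm p lam \<beta> \<mu> a = Lp_norm p \<mu> (SOME f. represents p lam \<beta> \<mu> f a)"

definition translate :: "(nat \<Rightarrow> real) \<Rightarrow> real \<Rightarrow> dirichlet_series \<Rightarrow> dirichlet_series" where
  "translate lam \<sigma> a = (\<lambda>n. a n * of_real (exp (- lam n * \<sigma>)))"

definition Hp_tendsto :: "ennreal \<Rightarrow> (nat \<Rightarrow> real) \<Rightarrow>
    (real \<Rightarrow> 'g::{t2_space,topological_ab_group_add}) \<Rightarrow> 'g measure \<Rightarrow>
    (nat \<Rightarrow> dirichlet_series) \<Rightarrow> dirichlet_series \<Rightarrow> bool" where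
  "Hp_tendsto p lam \<beta> \<mu> A a \<longleftrightarrow>
     (\<forall>k. A k \<in> Hp p lam \<beta> \<mu>) \<and> a \<in> Hp p lam \<beta> \<mu> \<and>
     (\<lambda>k. Hp_norm p lam \<beta> \<mu> (\<lambda>n. A k n - a n)) \<longlonglongrightarrow> 0"

end

theory Submission
  imports Defs "HOL-Probability.Probability" "HOL-Complex_Analysis.Complex_Analysis"
    "HOL-Computational_Algebra.Fundamental_Theorem_Algebra"
begin

text \<open>
Everything happens along the flow \<open>y \<mapsto> y + \<beta> t\<close>. For \<open>k \<in> L\<^sub>1(\<real>)\<close> the flow convolution
\<open>\<integral> f(y + \<beta> t) k(t) dt\<close> is bounded on every \<open>L\<^sub>p(G)\<close> by \<open>\<parallel>k\<parallel>\<^sub>1\<close> and multiplies the coefficient at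
\<open>\<lambda>\<^sub>n\<close> by the Fourier transform of \<open>k\<close> at \<open>\<lambda>\<^sub>n\<close>. Two kernels matter. The Poisson kernel \<open>P\<^sub>\<sigma>\<close> has
transform \<open>e\<^sup>-\<^sup>\<sigma>\<^sup>x\<close> on \<open>x \<ge> 0\<close>, so it realises the translation by \<open>\<sigma>\<close>. The rescaled Fejer kernel
\<open>K\<^sub>R\<close> has the transform \<open>max 0 (1 - \<bar>x\<bar>/R)\<close>, so it turns a representing function into a polynomial in the
finitely many characters with \<open>\<lambda>\<^sub>n < R\<close>.

Coefficients of a bounded sequence are bounded, hence a diagonal subsequence converges coefficientwise
to some \<open>a\<close>. If \<open>a\<close> belongs to \<open>H\<^sub>p(\<lambda>)\<close>, convergence of the translates is a soft matter: the \<open>L\<^sub>1\<close>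
norm of \<open>P\<^sub>\<sigma> - P\<^sub>\<sigma> * K\<^sub>R\<close> tends to \<open>0\<close> as \<open>R\<close> grows, and what is left after removing this kernel only
involves the finitely many coefficients with \<open>\<lambda>\<^sub>n < R\<close> (\<open>translate_norm_le\<close>, \<open>translate_norm_tendsto\<close>).

The substance is that \<open>a\<close> belongs to \<open>H\<^sub>p(\<lambda>)\<close>; for \<open>p = 1\<close> this is a theorem of F. and M. Riesz type,
since a weak limit might only be a measure. The Fejer polynomials \<open>q\<^sub>j\<close> of \<open>a\<close> are bounded in \<open>L\<^sub>p\<close>, and
it suffices that they are Cauchy in \<open>L\<^sub>1\<close>: an a.e. limit then has coefficients \<open>a\<close>, and Fatou's lemma
gives the \<open>L\<^sub>p\<close> bound (\<open>Lp_bounded_smoothed_represents\<close>). The source of compactness is that all frequencies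
are nonnegative: \<open>t \<mapsto> q(y + \<beta> t)\<close> extends to a bounded holomorphic function \<open>w\<close> on the half-plane, for
which not only \<open>\<bar>w\<bar>\<close> but also \<open>\<bar>w\<bar>\<^sup>1\<^sup>/\<^sup>2\<close> is dominated by its Poisson integral (\<open>half_plane_poisson\<close>).
Consequently, if passing from \<open>q\<close> to its Poisson mean loses only little \<open>L\<^sub>1\<close> norm, then \<open>q\<close> is almost
invariant, in \<open>L\<^sub>1\<close>, under short flow times (\<open>poisson_stability\<close>, \<open>poisson_modulus\<close>). The
supremum of the norms \<open>\<parallel>q\<^sub>j\<parallel>\<^sub>1\<close> is almost attained by a single \<open>q\<^sub>i\<close>, which only sees finitely many
coefficients, so for all large \<open>j\<close> the loss is small with one common flow time
(\<open>smoothed_equicontinuous\<close>). Equicontinuity along the flow makes \<open>q\<^sub>j\<close> uniformly close to \<open>q\<^sub>j * K\<^sub>R\<close>, which converges as \<open>j \<rightarrow> \<infinity>\<close> (\<open>smoothed_Cauchy\<close>).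

The norm of a Dirichlet series is defined through a choice of the representing function, which has to be unique up
to null sets (\<open>fourier_uniqueness\<close>). This needs that characters separate points. For a group with a
dense flow there is a direct argument: Gaussian averages of \<open>e\<^sup>-\<^sup>i\<^sup>\<xi>\<^sup>t f(y + \<beta> t)\<close> over longer and longer
time scales, with \<open>\<xi>\<close> chosen such that they do not die out, accumulate at a nonzero multiple of
a character (\<open>continuous_nonzero_fourier_coeff\<close>); the choice of \<open>\<xi>\<close> is possible because the
autocorrelation of \<open>f\<close> is positive definite and recurrent along the flow.
\<close>

section \<open>The square root of the modulus on circles\<close>

text \<open>The open interval keeps the tangent substitution to the real line free of endpoints.\<close>

definition circle_measure :: "real measure" where "circle_measure = uniform_measure lborel {-pi<..<pi}"

lemma prob_space_circle_measure: "prob_space circle_measure"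
  unfolding circle_measure_def by (rule prob_space_uniform_measure) auto

lemma sets_circle_measure [measurable_cong]: "sets circle_measure = sets borel"
  by (simp add: circle_measure_def)

lemma AE_circle_measure: "(\<And>x. - pi < x \<Longrightarrow> x < pi \<Longrightarrow> P x) \<Longrightarrow> AE x in circle_measure. P x"
  unfolding circle_measure_def by (rule AE_uniform_measureI) auto

lemma integral_circle_measure:
  fixes F :: "real \<Rightarrow> 'a::{banach,second_countable_topology}"
  assumes [measurable]: "F \<in> borel_measurable borel"
  shows "(\<integral>x. F x \<partial>circle_measure) = (LBINT x:{-pi<..<pi}. F x) /\<^sub>R (2 * pi)"
proof -
  have eq: "circle_measure = density lborel (\<lambda>x. ennreal (indicator {-pi<..<pi} x / (2 * pi)))"
    unfolding circle_measure_def uniform_measure_def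
    by (intro density_cong AE_I2) (auto simp: divide_ennreal[symmetric] ennreal_indicator)
  have "(\<integral>x. F x \<partial>circle_measure) = (\<integral>x. (indicator {-pi<..<pi} x / (2 * pi)) *\<^sub>R F x \<partial>lborel)"
    unfolding eq
  proof (rule integral_density)
    show "F \<in> borel_measurable lborel" by measurable
    show "(\<lambda>x. indicat_real {-pi<..<pi} x / (2 * pi)) \<in> borel_measurable lborel" by measurable
    show "AE x in lborel. 0 \<le> indicat_real {-pi<..<pi} x / (2 * pi)"
      by (rule AE_I2, rule divide_nonneg_pos, rule indicator_pos_le, rule mult_pos_pos[OF zero_less_numeral pi_gt_zero])
  qed
  also have "\<dots> = (\<integral>x. (inverse (2*pi)) *\<^sub>R (indicator {-pi<..<pi} x *\<^sub>R F x) \<partial>lborel)"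
    by (rule Bochner_Integration.integral_cong[OF refl]) (simp only: scaleR_scaleR divide_inverse mult.commute)
  also have "\<dots> = (LBINT x:{-pi<..<pi}. F x) /\<^sub>R (2 * pi)"
    unfolding set_lebesgue_integral_def by (rule integral_scaleR_right)
  finally show ?thesis .
qed

text \<open>Cauchy's formula is applied to \<open>z \<mapsto> f (- z)\<close>: its circle path runs over \<open>[0, 2\<pi>]\<close>, and the
reflection shifts this to \<open>[- \<pi>, \<pi>]\<close>.\<close>

lemma circle_mean:
  assumes hol: "f holomorphic_on ball 0 R" and r: "0 < r" "r < R"
  shows "(\<integral>x. f (of_real r * cis x) \<partial>circle_measure) = f 0"
proof -
  define g where "g = (\<lambda>z. f (- z))"
  have img: "uminus ` cball (0::complex) r \<subseteq> ball 0 R" using r by auto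
  have ghol: "g holomorphic_on cball 0 r"
    unfolding g_def
    using holomorphic_on_compose_gen[OF holomorphic_on_minus[OF holomorphic_on_ident] hol img]
    by (simp add: o_def)
  have "((\<lambda>u. g u / (u - 0)) has_contour_integral 2 * of_real pi * \<i> * g 0) (circlepath 0 r)"
    by (rule Cauchy_integral_circlepath_simple) (use r ghol in auto)
  then have "((\<lambda>t. g (r * cis t) / (r * cis t) * r * \<i> * cis t) has_integral 2 * of_real pi * \<i> * g 0) {0..2*pi}"
    unfolding circlepath_def by (subst (asm) has_contour_integral_part_circlepath_iff) auto
  also have "?this \<longleftrightarrow> ((\<lambda>t. \<i> * g (r * cis t)) has_integral \<i> * (2 * of_real pi * g 0)) {0..2*pi}"
    using r by (intro has_integral_cong arg_cong2[where f="\<lambda>a b. (a has_integral b) _"]) (auto simp: field_simps)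
  finally have "((\<lambda>t. (- \<i>) * (\<i> * g (r * cis t))) has_integral (- \<i>) * (\<i> * (2 * of_real pi * g 0))) {0..2*pi}"
    by (rule has_integral_mult_right)
  then have "((\<lambda>t. g (r * cis t)) has_integral (2 * of_real pi * g 0)) (cbox 0 (2*pi))"
    by (simp flip: mult.assoc)
  from has_integral_affinity'[OF this, of 1 pi]
  have "((\<lambda>t. g (r * cis (t + pi))) has_integral (2 * of_real pi * g 0)) {-pi..pi}"
    by simp
  moreover have "cis (t + pi) = - cis t" for t by (simp add: cis.ctr complex_eq_iff)
  ultimately have I: "((\<lambda>t. f (r * cis t)) has_integral (2 * of_real pi * f 0)) {-pi..pi}"
    by (simp add: g_def)
  have cont: "continuous_on UNIV (\<lambda>t. f (r * cis t))"
    by (rule continuous_on_compose2[OF holomorphic_on_imp_continuous_on[OF hol]])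
       (use r in \<open>auto intro!: continuous_intros simp: norm_mult\<close>)
  then have meas: "(\<lambda>t. f (r * cis t)) \<in> borel_measurable borel"
    by (rule borel_measurable_continuous_onI)
  have int: "set_integrable lborel {-pi..pi} (\<lambda>t. f (r * cis t))"
    by (rule borel_integrable_atLeastAtMost') (use cont continuous_on_subset in blast)
  have "(LBINT x:{-pi<..<pi}. f (r * cis x)) = (LBINT x:{-pi..pi}. f (r * cis x))"
    using interval_integral_Icc[of "-pi" pi "\<lambda>x. f (r * cis x)"]
       interval_integral_Ioo[of "-pi" pi "\<lambda>x. f (r * cis x)"] by simp
  also have "\<dots> = 2 * of_real pi * f 0"
    using set_borel_integral_eq_integral(2)[OF int] I by (simp add: integral_unique)
  finally show ?thesis
    by (simp add: integral_circle_measure[OF meas] scaleR_conv_of_real)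
qed

lemma circle_measure_integrable_bounded:
  fixes F :: "real \<Rightarrow> 'a::{banach,second_countable_topology}"
  assumes "F \<in> borel_measurable borel" "\<And>x. norm (F x) \<le> B"
  shows "integrable circle_measure F"
proof -
  interpret prob_space circle_measure by (rule prob_space_circle_measure)
  show ?thesis
  proof (rule integrable_const_bound)
    show "AE x in circle_measure. norm (F x) \<le> B" by (rule AE_I2) (rule assms(2))
    show "F \<in> borel_measurable circle_measure"
      unfolding measurable_cong_sets[OF sets_circle_measure refl] by (rule assms(1))
  qed
qed

text \<open>A zero-free function has a holomorphic square root, and the mean value property of the root on
circles inside the disc passes to the boundary circle, where only continuity is available.\<close>

lemma circle_sqrt_mean_nonvanishing:
  assumes hol: "v holomorphic_on ball 0 r" and cont: "continuous_on (cball 0 r) v"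
    and nz: "\<And>z. z \<in> ball 0 r \<Longrightarrow> v z \<noteq> 0" and r: "0 < r"
  shows "sqrt (norm (v 0)) \<le> (\<integral>x. sqrt (norm (v (of_real r * cis x))) \<partial>circle_measure)"
proof -
  interpret prob_space circle_measure by (rule prob_space_circle_measure)
  obtain g where g: "g holomorphic_on ball 0 r" "\<And>z. z \<in> ball 0 r \<Longrightarrow> v z = (g z)\<^sup>2"
    using contractible_imp_holomorphic_sqrt[OF hol _ nz] by (metis convex_ball convex_imp_contractible)
  have ng: "norm (g z) = sqrt (norm (v z))" if "z \<in> ball 0 r" for z
    using g(2)[OF that] by (simp add: norm_power)
  have "compact (v ` cball 0 r)" by (intro compact_continuous_image cont) auto
  then obtain B where B: "\<And>z. z \<in> cball 0 r \<Longrightarrow> norm (v z) \<le> B"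
    using compact_imp_bounded bounded_iff by (metis image_eqI)
  define s where "s = (\<lambda>n. r * (1 - 1 / (real n + 2)))"
  have s: "0 < s n" "s n < r" for n using r by (auto simp: s_def field_simps add_pos_nonneg)
  have slim: "s \<longlonglongrightarrow> r" unfolding s_def by real_asymp
  have in_ball: "of_real (s n) * cis x \<in> ball 0 r" for n x using s[of n] by (simp add: norm_mult)
  have contn: "continuous_on UNIV (\<lambda>x. v (of_real a * cis x))" if "0 \<le> a" "a \<le> r" for a
    by (rule continuous_on_compose2[OF cont]) (use that in \<open>auto intro!: continuous_intros simp: norm_mult\<close>)

  have le: "sqrt (norm (v 0)) \<le> (\<integral>x. sqrt (norm (v (of_real (s n) * cis x))) \<partial>circle_measure)" for n
  proof -
    have "sqrt (norm (v 0)) = norm (g 0)" using ng[of 0] r by simp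
    also have "\<dots> = norm (\<integral>x. g (of_real (s n) * cis x) \<partial>circle_measure)"
      using circle_mean[OF g(1) s] by simp
    also have "\<dots> \<le> (\<integral>x. norm (g (of_real (s n) * cis x)) \<partial>circle_measure)"
      by (rule integral_norm_bound)
    also have "\<dots> = (\<integral>x. sqrt (norm (v (of_real (s n) * cis x))) \<partial>circle_measure)"
      using ng in_ball by simp
    finally show ?thesis .
  qed
  have "(\<lambda>n. \<integral>x. sqrt (norm (v (of_real (s n) * cis x))) \<partial>circle_measure) \<longlonglongrightarrow> (\<integral>x. sqrt (norm (v (of_real r * cis x))) \<partial>circle_measure)"
  proof (rule integral_dominated_convergence[where w="\<lambda>_. sqrt B"])
    have meas': "(\<lambda>x. sqrt (norm (v (of_real a * cis x)))) \<in> borel_measurable circle_measure"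
      if "0 \<le> a" "a \<le> r" for a
      unfolding measurable_cong_sets[OF sets_circle_measure refl]
      by (intro borel_measurable_continuous_onI continuous_intros contn that)
    show "(\<lambda>x. sqrt (norm (v (of_real r * cis x)))) \<in> borel_measurable circle_measure"
      using r by (intro meas') auto
    show "(\<lambda>x. sqrt (norm (v (of_real (s n) * cis x)))) \<in> borel_measurable circle_measure" for n
      using s[of n] by (intro meas') auto
    show "AE x in circle_measure. (\<lambda>n. sqrt (norm (v (of_real (s n) * cis x)))) \<longlonglongrightarrow> sqrt (norm (v (of_real r * cis x)))"
    proof (intro AE_I2 tendsto_intros)
      fix x
      have "(\<lambda>n. of_real (s n) * cis x) \<longlonglongrightarrow> of_real r * cis x"
        by (intro tendsto_intros slim)
      then show "(\<lambda>n. v (of_real (s n) * cis x)) \<longlonglongrightarrow> v (of_real r * cis x)"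
      proof (rule continuous_on_tendsto_compose[OF cont])
        show "\<forall>\<^sub>F n in sequentially. of_real (s n) * cis x \<in> cball 0 r"
          using in_ball[of _ x] ball_subset_cball by (intro always_eventually) blast
      qed (use r in \<open>simp add: norm_mult\<close>)
    qed
    show "AE x in circle_measure. norm (sqrt (norm (v (of_real (s n) * cis x)))) \<le> sqrt B" for n
    proof (rule AE_I2)
      fix x
      have "norm (v (of_real (s n) * cis x)) \<le> B"
        using in_ball[of n x] ball_subset_cball by (intro B) blast
      then show "norm (sqrt (norm (v (of_real (s n) * cis x)))) \<le> sqrt B" by simp
    qed
    show "integrable circle_measure (\<lambda>_. sqrt B)" by (rule integrable_const)
  qed
  then show ?thesis
    by (rule LIMSEQ_le_const) (use le in blast)
qed

text \<open>Zeros are removed one at a time and absorbed into the zero-free factor \<open>v\<close>.  A zero outside the open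
disc can be absorbed as it stands.  A zero \<open>a\<close> inside is replaced by its reflection in the circle,
the factor \<open>r - cnj a z / r\<close>: it has the same modulus as \<open>z - a\<close> on the circle, no zero in the
disc, and the larger modulus \<open>r\<close> at the centre.\<close>

lemma circle_sqrt_mean_poly:
  assumes "v holomorphic_on ball 0 r" "continuous_on (cball 0 r) v"
    and "\<And>z. z \<in> ball 0 r \<Longrightarrow> v z \<noteq> 0" and r: "0 < r"
  shows "sqrt (norm (poly p 0 * v 0)) \<le> (\<integral>x. sqrt (norm (poly p (of_real r * cis x) * v (of_real r * cis x))) \<partial>circle_measure)"
  using assms(1-3)
proof (induction "degree p" arbitrary: p v)
  case 0
  then obtain c where c: "p = [:c:]" by (metis degree_eq_zeroE)
  show ?case
  proof (cases "c = 0")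
    case False
    have "sqrt (norm (c * v 0)) \<le> (\<integral>x. sqrt (norm (c * v (of_real r * cis x))) \<partial>circle_measure)"
    proof (rule circle_sqrt_mean_nonvanishing[where v="\<lambda>z. c * v z"])
      show "(\<lambda>z. c * v z) holomorphic_on ball 0 r" by (intro holomorphic_intros 0(2))
      show "continuous_on (cball 0 r) (\<lambda>z. c * v z)" by (intro continuous_intros 0(3))
      show "c * v z \<noteq> 0" if "z \<in> ball 0 r" for z using 0(4)[OF that] False by simp
    qed (rule r)
    then show ?thesis by (simp add: c)
  qed (auto simp: c)
next
  case (Suc n)
  have "\<not> constant (poly p)" using Suc(2) by (simp add: constant_degree)
  then obtain a where "poly p a = 0"
    using Fundamental_Theorem_Algebra.fundamental_theorem_of_algebra by blast
  then obtain q where q: "p = [:-a, 1:] * q" by (metis poly_eq_0_iff_dvd dvdE)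
  have "q \<noteq> 0" using q Suc(2) by auto
  then have deg: "n = degree q"
    using Suc(2) unfolding q by (subst (asm) degree_mult_eq) auto
  show ?case
  proof (cases "norm a < r")
    case False
    define u where "u = (\<lambda>z. (z - a) * v z)"
    have "sqrt (norm (poly q 0 * u 0)) \<le> (\<integral>x. sqrt (norm (poly q (of_real r * cis x) * u (of_real r * cis x))) \<partial>circle_measure)"
    proof (rule Suc(1)[OF deg])
      show "u holomorphic_on ball 0 r" unfolding u_def by (intro holomorphic_intros Suc(3))
      show "continuous_on (cball 0 r) u" unfolding u_def by (intro continuous_intros Suc(4))
      show "u z \<noteq> 0" if "z \<in> ball 0 r" for z
        using that Suc(5)[OF that] False by (auto simp: u_def)
    qed
    then show ?thesis by (simp add: q u_def algebra_simps)
  next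
    case True
    define b where "b = (\<lambda>z. of_real r - cnj a * z / of_real r)"
    have bnz: "b z \<noteq> 0" if "z \<in> ball 0 r" for z
    proof
      assume "b z = 0"
      then have "of_real (r * r) = cnj a * z" using r by (simp add: b_def field_simps)
      then have "r * r = norm a * norm z" by (metis norm_mult complex_mod_cnj norm_of_real abs_of_nonneg r mult_nonneg_nonneg less_imp_le)
      moreover have "norm a * norm z \<le> norm a * r" using that by (intro mult_left_mono) auto
      moreover have "norm a * r < r * r" using True r by simp
      ultimately show False by simp
    qed
    have bcirc: "norm (b (of_real r * cis x)) = norm (of_real r * cis x - a)" for x
    proof -
      have "norm (of_real r * cis x - a) = norm (cnj (of_real r * cis x - a))" by (simp only: complex_mod_cnj)
      also have "\<dots> = norm (cis x * cnj (of_real r * cis x - a))" by (simp add: norm_mult)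
      also have "cis x * cnj (of_real r * cis x - a) = b (of_real r * cis x)"
        using r by (simp add: b_def algebra_simps cis_cnj cis_mult)
      finally show ?thesis ..
    qed
    define u where "u = (\<lambda>z. b z * v z)"
    have "sqrt (norm (poly p 0 * v 0)) \<le> sqrt (norm (poly q 0 * u 0))"
    proof (intro real_sqrt_le_mono)
      have "norm (poly p 0 * v 0) = norm a * norm (poly q 0 * v 0)" by (simp add: q norm_mult)
      also have "\<dots> \<le> r * norm (poly q 0 * v 0)" using True by (intro mult_right_mono) auto
      also have "\<dots> = norm (poly q 0 * u 0)" using r by (simp add: u_def b_def norm_mult)
      finally show "norm (poly p 0 * v 0) \<le> norm (poly q 0 * u 0)" .
    qed
    also have "\<dots> \<le> (\<integral>x. sqrt (norm (poly q (of_real r * cis x) * u (of_real r * cis x))) \<partial>circle_measure)"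
    proof (rule Suc(1)[OF deg])
      show "u holomorphic_on ball 0 r" unfolding u_def b_def
        using r by (intro holomorphic_intros Suc(3)) auto
      show "continuous_on (cball 0 r) u" unfolding u_def b_def
        using r by (intro continuous_intros Suc(4)) auto
      show "u z \<noteq> 0" if "z \<in> ball 0 r" for z
        using bnz[OF that] Suc(5)[OF that] by (simp add: u_def)
    qed
    also have "\<dots> = (\<integral>x. sqrt (norm (poly p (of_real r * cis x) * v (of_real r * cis x))) \<partial>circle_measure)"
    proof -
      have "norm (poly q (of_real r * cis x) * u (of_real r * cis x)) =
          norm (poly p (of_real r * cis x) * v (of_real r * cis x))" for x
      proof -
        have pq: "poly p z = (z - a) * poly q z" for z by (simp add: q algebra_simps)
        show ?thesis unfolding pq u_def norm_mult bcirc by (simp only: mult_ac)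
      qed
      then show ?thesis by simp
    qed
    finally show ?thesis .
  qed
qed

text \<open>The Taylor polynomials converge to \<open>w\<close>, dominated by their absolutely convergent majorant on the
circle.\<close>

lemma circle_sqrt_mean:
  assumes hol: "w holomorphic_on ball 0 R" and r: "0 < r" "r < R"
  shows "sqrt (norm (w 0)) \<le> (\<integral>x. sqrt (norm (w (of_real r * cis x))) \<partial>circle_measure)"
proof -
  interpret prob_space circle_measure by (rule prob_space_circle_measure)
  define c where "c = (\<lambda>n. (deriv ^^ n) w 0 / fact n)"
  have sums: "(\<lambda>n. c n * z ^ n) sums w z" if "norm z < R" for z
    using holomorphic_power_series[OF hol, of z] that by (simp add: c_def)
  have abs: "summable (\<lambda>n. norm (c n * of_real r ^ n))"
  proof (rule powser_insidea)
    have n: "norm (complex_of_real ((r+R)/2)) = (r + R) / 2" using r by (simp only: norm_of_real) simp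
    show "summable (\<lambda>n. c n * of_real ((r+R)/2) ^ n)"
      by (rule sums_summable[OF sums]) (unfold n, use r in simp)
    show "norm (complex_of_real r) < norm (complex_of_real ((r+R)/2))" unfolding n using r by simp
  qed
  define B where "B = (\<Sum>n. norm (c n * of_real r ^ n))"
  define p where "p = (\<lambda>N. \<Sum>n<N. monom (c n) n)"
  have p: "poly (p N) z = (\<Sum>n<N. c n * z ^ n)" for N z by (simp add: p_def poly_sum poly_monom)
  have le: "sqrt (norm (poly (p N) 0)) \<le> (\<integral>x. sqrt (norm (poly (p N) (of_real r * cis x))) \<partial>circle_measure)" for N
    using circle_sqrt_mean_poly[of "\<lambda>_. 1" r "p N"] r by auto
  have lim: "(\<lambda>N. poly (p N) z) \<longlonglongrightarrow> w z" if "norm z < R" for z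
    using sums[OF that] unfolding p sums_def .
  have 1: "(\<lambda>N. sqrt (norm (poly (p N) 0))) \<longlonglongrightarrow> sqrt (norm (w 0))"
    by (intro tendsto_intros lim) (use r in auto)
  have wm [measurable]: "(\<lambda>x. w (of_real r * cis x)) \<in> borel_measurable borel"
    by (intro borel_measurable_continuous_onI continuous_on_compose2[OF holomorphic_on_imp_continuous_on[OF hol]])
       (use r in \<open>auto intro!: continuous_intros simp: norm_mult\<close>)
  have pm [measurable]: "(\<lambda>x. poly (p N) (of_real r * cis x)) \<in> borel_measurable borel" for N
    by (intro borel_measurable_continuous_onI continuous_intros)
  have 2: "(\<lambda>N. \<integral>x. sqrt (norm (poly (p N) (of_real r * cis x))) \<partial>circle_measure) \<longlonglongrightarrow> (\<integral>x. sqrt (norm (w (of_real r * cis x))) \<partial>circle_measure)"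
  proof (rule integral_dominated_convergence[where w="\<lambda>_. sqrt B"])
    show "AE x in circle_measure. (\<lambda>n. sqrt (norm (poly (p n) (of_real r * cis x)))) \<longlonglongrightarrow> sqrt (norm (w (of_real r * cis x)))"
      by (intro AE_I2 tendsto_intros lim) (use r in \<open>auto simp: norm_mult\<close>)
    show "AE x in circle_measure. norm (sqrt (norm (poly (p n) (of_real r * cis x)))) \<le> sqrt B" for n
    proof (intro AE_I2)
      fix x
      have "norm (poly (p n) (of_real r * cis x)) \<le> (\<Sum>i<n. norm (c i * (of_real r * cis x) ^ i))"
        unfolding p by (rule norm_sum)
      also have "\<dots> = (\<Sum>i<n. norm (c i * of_real r ^ i))" by (simp add: norm_mult norm_power)
      also have "\<dots> \<le> B" unfolding B_def by (rule sum_le_suminf[OF abs]) auto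
      finally show "norm (sqrt (norm (poly (p n) (of_real r * cis x)))) \<le> sqrt B" by simp
    qed
    show "(\<lambda>x. sqrt (norm (poly (p N) (of_real r * cis x)))) \<in> borel_measurable circle_measure" for N
      by (simp add: measurable_cong_sets[OF sets_circle_measure refl])
  qed simp_all
  show ?thesis by (rule LIMSEQ_le[OF 1 2]) (use le in auto)
qed

section \<open>The Poisson kernel of the half-plane\<close>

definition poisson :: "real \<Rightarrow> real \<Rightarrow> real" where
  "poisson \<tau> t = \<tau> / (pi * (\<tau>\<^sup>2 + t\<^sup>2))"

lemma poisson_pos: "0 < \<tau> \<Longrightarrow> 0 < poisson \<tau> t"
  by (simp add: poisson_def add_pos_nonneg)

lemma continuous_on_poisson [continuous_intros]:
  assumes "0 < \<tau>" "continuous_on A f"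
  shows "continuous_on A (\<lambda>t. poisson \<tau> (f t))"
  unfolding poisson_def using assms
  by (intro continuous_intros) (auto simp: add_pos_nonneg intro!: less_imp_neq[symmetric])

lemma borel_measurable_poisson [measurable]: "poisson \<tau> \<in> borel_measurable borel"
  unfolding poisson_def by measurable

lemma poisson_minus [simp]: "poisson \<tau> (- t) = poisson \<tau> t"
  by (simp add: poisson_def)

lemma borel_measurable_tan_half: "(\<lambda>x::real. tan (x / 2)) \<in> borel_measurable borel"
  unfolding tan_def by measurable

lemma tan_half_lims:
  fixes \<tau> :: real
  assumes "0 < \<tau>"
  shows "filterlim (\<lambda>x. \<tau> * tan (x / 2)) at_top (at_left pi)"
    and "filterlim (\<lambda>x. \<tau> * tan (x / 2)) at_bot (at_right (- pi))"
proof -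
  have "filterlim (\<lambda>x::real. x / 2) (at_left (pi / 2)) (at_left pi)"
    unfolding filterlim_at by (auto intro!: tendsto_eq_intros simp: eventually_at_filter)
  from filterlim_compose[OF filterlim_tan_at_left this]
  show "filterlim (\<lambda>x. \<tau> * tan (x / 2)) at_top (at_left pi)"
    by (rule filterlim_tendsto_pos_mult_at_top[OF tendsto_const assms])
  have "filterlim (\<lambda>x::real. x / 2) (at_right (- (pi / 2))) (at_right (- pi))"
    unfolding filterlim_at by (auto intro!: tendsto_eq_intros simp: eventually_at_filter)
  from filterlim_compose[OF filterlim_tan_at_right this]
  show "filterlim (\<lambda>x. \<tau> * tan (x / 2)) at_bot (at_right (- pi))"
    by (rule filterlim_tendsto_pos_mult_at_bot[OF tendsto_const assms])
qed

text \<open>Under \<open>t = \<tau> tan (x / 2)\<close> the Poisson kernel becomes the uniform density of the circle: this is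
the boundary behaviour of the Cayley transform.\<close>

lemma poisson_substitution_nonneg:
  fixes f :: "real \<Rightarrow> real"
  assumes \<tau>: "0 < \<tau>" and cont: "continuous_on UNIV f" and f: "\<And>t. 0 \<le> f t" "\<And>t. f t \<le> B"
  shows "integrable lborel (\<lambda>t. f t * poisson \<tau> t)"
    and "(\<integral>t. f t * poisson \<tau> t \<partial>lborel) = (\<integral>x. f (\<tau> * tan (x / 2)) \<partial>circle_measure)"
proof -
  note [measurable] = borel_measurable_tan_half borel_measurable_continuous_onI[OF cont]
  define g where "g = (\<lambda>x. \<tau> * tan (x / 2))"
  (* The derivative of g in terms of tan, so that 1 + tan^2 cancels against the Poisson kernel. *)
  define g' where "g' = (\<lambda>x. \<tau> / 2 * (1 + (tan (x / 2))\<^sup>2))"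
  define h where "h = (\<lambda>t. f t * poisson \<tau> t)"
  have cosnz: "cos (x / 2) \<noteq> 0" if "- pi < x" "x < pi" for x
    using cos_gt_zero_pi[of "x / 2"] that by simp
  have deriv: "(g has_real_derivative g' x) (at x)" if "ereal (- pi) < ereal x" "ereal x < ereal pi" for x
    unfolding g_def g'_def using cosnz[of x] that
    by (auto intro!: derivative_eq_intros simp: tan_sec power_inverse)
  have hg: "h (g x) * g' x = f (\<tau> * tan (x / 2)) / (2 * pi)" for x
  proof -
    have p: "0 < 1 + (tan (x / 2))\<^sup>2" by (rule add_pos_nonneg) auto
    have "poisson \<tau> (g x) = 1 / (pi * \<tau> * (1 + (tan (x / 2))\<^sup>2))"
    proof -
      have "\<tau>\<^sup>2 + (g x)\<^sup>2 = \<tau> * (\<tau> * (1 + (tan (x / 2))\<^sup>2))"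
        by (simp add: g_def power2_eq_square algebra_simps)
      then show ?thesis using \<tau> p by (simp add: poisson_def)
    qed
    then show ?thesis
      using \<tau> p by (simp add: h_def g_def g'_def)
  qed
  have int: "set_integrable lborel (einterval (ereal (- pi)) (ereal pi)) (\<lambda>x. h (g x) * g' x)"
    unfolding hg set_integrable_def
  proof (rule integrableI_bounded_set_indicator[where B="B / (2 * pi)"])
    show "AE x\<in>einterval (ereal (- pi)) (ereal pi) in lborel. norm (f (\<tau> * tan (x / 2)) / (2 * pi)) \<le> B / (2 * pi)"
      using f by (intro AE_I2) (auto intro!: divide_right_mono)
  qed auto
  have lim: "((ereal \<circ> g \<circ> real_of_ereal) \<longlongrightarrow> - \<infinity>) (at_right (ereal (- pi)))"
    "((ereal \<circ> g \<circ> real_of_ereal) \<longlongrightarrow> \<infinity>) (at_left (ereal pi))"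
    using tan_half_lims[OF \<tau>] by (auto simp: ereal_tendsto_simps g_def)
  have conth: "isCont h (g x)" for x
    unfolding h_def using cont \<tau>
    by (intro continuous_on_interior[where S=UNIV]) (auto intro!: continuous_intros)
  have contg': "isCont g' x" if "ereal (- pi) < ereal x" "ereal x < ereal pi" for x
    unfolding g'_def using cosnz[of x] that by (auto intro!: continuous_intros)
  have nn: "0 \<le> h (g x)" "0 \<le> g' x" for x
    using \<tau> f(1) less_imp_le[OF poisson_pos[OF \<tau>]]
    by (auto simp: h_def g'_def intro!: mult_nonneg_nonneg add_nonneg_nonneg)
  have *: "ereal (- pi) < ereal pi" by simp
  have "set_integrable lborel (einterval (- \<infinity>) \<infinity>) h"
    by (rule interval_integral_substitution_nonneg(1)[OF * deriv conth contg' nn lim int])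
  then show "integrable lborel (\<lambda>t. f t * poisson \<tau> t)"
    by (simp add: set_integrable_def h_def)
  have "interval_lebesgue_integral lborel (- \<infinity>) \<infinity> h = (LBINT x=ereal (- pi)..ereal pi. h (g x) * g' x)"
    by (rule interval_integral_substitution_nonneg(2)[OF * deriv conth contg' nn lim int])
  also have "\<dots> = (LBINT x:{-pi<..<pi}. f (\<tau> * tan (x / 2)) / (2 * pi))"
    unfolding hg by (subst interval_integral_Ioo) auto
  also have "\<dots> = (\<integral>x. f (\<tau> * tan (x / 2)) \<partial>circle_measure)"
    by (subst integral_circle_measure) (auto simp: set_integral_divide_zero field_simps)
  also have "interval_lebesgue_integral lborel (- \<infinity>) \<infinity> h = (\<integral>t. f t * poisson \<tau> t \<partial>lborel)"
    by (simp add: interval_lebesgue_integral_def set_lebesgue_integral_def h_def)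
  finally show "(\<integral>t. f t * poisson \<tau> t \<partial>lborel) = (\<integral>x. f (\<tau> * tan (x / 2)) \<partial>circle_measure)" .
qed

lemma integrable_poisson [simp, intro]: "0 < \<tau> \<Longrightarrow> integrable lborel (poisson \<tau>)"
  and integral_poisson [simp]: "0 < \<tau> \<Longrightarrow> (\<integral>t. poisson \<tau> t \<partial>lborel) = 1"
proof -
  assume \<tau>: "0 < \<tau>"
  interpret prob_space circle_measure by (rule prob_space_circle_measure)
  show "integrable lborel (poisson \<tau>)" "(\<integral>t. poisson \<tau> t \<partial>lborel) = 1"
    using poisson_substitution_nonneg[OF \<tau>, of "\<lambda>_. 1" 1] prob_space by (auto simp: continuous_on_const)
qed

lemma poisson_substitution:
  fixes f :: "real \<Rightarrow> complex"
  assumes \<tau>: "0 < \<tau>" and cont: "continuous_on UNIV f" and f: "\<And>t. norm (f t) \<le> B"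
  shows "(\<integral>t. f t * poisson \<tau> t \<partial>lborel) = (\<integral>x. f (\<tau> * tan (x / 2)) \<partial>circle_measure)"
proof -
  interpret prob_space circle_measure by (rule prob_space_circle_measure)
  have real: "(\<integral>t. g t * poisson \<tau> t \<partial>lborel) = (\<integral>x. g (\<tau> * tan (x / 2)) \<partial>circle_measure)"
    and real_int: "integrable lborel (\<lambda>t. g t * poisson \<tau> t)"
    if g: "continuous_on UNIV g" "\<And>t. \<bar>g t\<bar> \<le> B" for g :: "real \<Rightarrow> real"
  proof -
    have b: "0 \<le> g t + B" "g t + B \<le> 2 * B" for t using g(2)[of t] by linarith+
    have c: "continuous_on UNIV (\<lambda>t. g t + B)" by (intro continuous_intros g)
    note A = poisson_substitution_nonneg[OF \<tau> c b]
    have i: "integrable lborel (\<lambda>t. B * poisson \<tau> t)" using \<tau> by auto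
    have "integrable lborel (\<lambda>t. (g t + B) * poisson \<tau> t - B * poisson \<tau> t)"
      by (rule Bochner_Integration.integrable_diff[OF A(1) i])
    then show I: "integrable lborel (\<lambda>t. g t * poisson \<tau> t)" by (simp add: algebra_simps)
    note [measurable] = borel_measurable_tan_half borel_measurable_continuous_onI[OF g(1)]
    have Ic: "integrable circle_measure (\<lambda>x. g (\<tau> * tan (x / 2)))"
      by (rule circle_measure_integrable_bounded[where B=B]) (use g(2) in auto)
    have "(\<integral>t. g t * poisson \<tau> t \<partial>lborel) + B = (\<integral>t. (g t + B) * poisson \<tau> t \<partial>lborel)"
      using I i \<tau> by (simp add: distrib_right)
    also have "\<dots> = (\<integral>x. g (\<tau> * tan (x / 2)) \<partial>circle_measure) + B"
      unfolding A(2) using Ic prob_space by simp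
    finally show "(\<integral>t. g t * poisson \<tau> t \<partial>lborel) = (\<integral>x. g (\<tau> * tan (x / 2)) \<partial>circle_measure)" by simp
  qed
  note [measurable] = borel_measurable_tan_half borel_measurable_continuous_onI[OF cont]
  have bnd: "\<bar>Re (f t)\<bar> \<le> B" "\<bar>Im (f t)\<bar> \<le> B" for t
    using f[of t] abs_Re_le_cmod[of "f t"] abs_Im_le_cmod[of "f t"] by linarith+
  have cr: "continuous_on UNIV (\<lambda>t. Re (f t))" "continuous_on UNIV (\<lambda>t. Im (f t))"
    by (intro continuous_intros cont)+
  have Ic: "integrable circle_measure (\<lambda>x. f (\<tau> * tan (x / 2)))"
    by (rule circle_measure_integrable_bounded[where B=B]) (use f in auto)
  have "integrable lborel (\<lambda>t. of_real (Re (f t) * poisson \<tau> t) + \<i> * of_real (Im (f t) * poisson \<tau> t) :: complex)"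
    using real_int[OF cr(1) bnd(1)] real_int[OF cr(2) bnd(2)]
    by (intro Bochner_Integration.integrable_add integrable_mult_right integrable_of_real)
  also have "(\<lambda>t. of_real (Re (f t) * poisson \<tau> t) + \<i> * of_real (Im (f t) * poisson \<tau> t) :: complex) = (\<lambda>t. f t * poisson \<tau> t)"
    by (auto simp: complex_eq_iff)
  finally have I: "integrable lborel (\<lambda>t. f t * poisson \<tau> t)" .
  show ?thesis
    using real[OF cr(1) bnd(1)] real[OF cr(2) bnd(2)] I Ic
    by (simp add: complex_eq_iff flip: integral_Re integral_Im)
qed

text \<open>The Cayley transform \<open>C z = \<tau> (1 - z) / (1 + z)\<close> takes \<open>0\<close> to \<open>\<tau>\<close> and the point \<open>cis x\<close> of the
unit circle to \<open>- \<i> \<tau> tan (x / 2)\<close>.  Since it has a pole at \<open>- 1\<close>, the circle estimates are used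
on radii increasing to \<open>1\<close>, and the boundedness of \<open>w\<close> allows the passage to the limit.\<close>

lemma half_plane_poisson:
  assumes hol: "w holomorphic_on {s. 0 < Re s}" and cont: "continuous_on {s. 0 \<le> Re s} w"
    and bd: "\<And>s. 0 \<le> Re s \<Longrightarrow> norm (w s) \<le> B" and \<tau>: "0 < \<tau>"
  shows "(\<integral>t. w (- \<i> * of_real t) * poisson \<tau> t \<partial>lborel) = w (of_real \<tau>)"
    and "sqrt (norm (w (of_real \<tau>))) \<le> (\<integral>t. sqrt (norm (w (- \<i> * of_real t))) * poisson \<tau> t \<partial>lborel)"
proof -
  interpret prob_space circle_measure by (rule prob_space_circle_measure)
  define C where "C = (\<lambda>z. of_real \<tau> * (1 - z) / (1 + z) :: complex)"
  have nz: "1 + z \<noteq> 0" if "norm z < 1" for z :: complex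
    using that by (metis add_eq_0_iff norm_minus_cancel norm_one order_less_irrefl)
  have ReC: "0 < Re (C z)" if "norm z < 1" for z
  proof -
    have "Re (C z) = \<tau> * (1 - (norm z)\<^sup>2) / (norm (1 + z))\<^sup>2"
      by (simp add: C_def Re_divide cmod_power2) (simp add: power2_eq_square algebra_simps)
    also have "\<dots> > 0"
      using that nz[OF that] \<tau> by (intro divide_pos_pos mult_pos_pos) (auto simp: abs_square_less_1)
    finally show ?thesis .
  qed
  have Ccis: "C (cis x) = - \<i> * of_real (\<tau> * tan (x / 2))" and ciscnz: "1 + cis x \<noteq> 0" if "- pi < x" "x < pi" for x
  proof -
    have c: "cos (x / 2) \<noteq> 0" using cos_gt_zero_pi[of "x / 2"] that by simp
    have h: "cis x = cis (x / 2) * cis (x / 2)" by (simp add: cis_mult)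
    have cc: "cis (x / 2) * cis (- (x / 2)) = 1" by (simp add: cis_mult)
    have p: "1 + cis x = cis (x / 2) * (2 * of_real (cos (x / 2)))"
    proof -
      have "2 * of_real (cos (x / 2)) = cis (x / 2) + cis (- (x / 2))" by (simp add: complex_eq_iff)
      then show ?thesis using cc by (simp add: h algebra_simps)
    qed
    have m: "1 - cis x = cis (x / 2) * (- \<i> * 2 * of_real (sin (x / 2)))"
    proof -
      have "- \<i> * 2 * of_real (sin (x / 2)) = cis (- (x / 2)) - cis (x / 2)" by (simp add: complex_eq_iff)
      then show ?thesis using cc by (simp add: h algebra_simps)
    qed
    show "1 + cis x \<noteq> 0" unfolding p using c by simp
    show "C (cis x) = - \<i> * of_real (\<tau> * tan (x / 2))"
      unfolding C_def p m using c by (simp add: tan_def)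
  qed
  define v where "v = (\<lambda>z. w (C z))"
  have Chol: "C holomorphic_on ball 0 1"
    unfolding C_def using nz by (intro holomorphic_intros) auto
  have vhol: "v holomorphic_on ball 0 1"
    unfolding v_def
    by (rule holomorphic_on_compose_gen[OF Chol hol, unfolded o_def]) (use ReC in auto)
  define s where "s = (\<lambda>n. 1 - 1 / (real n + 2))"
  have s: "0 < s n" "s n < 1" for n by (auto simp: s_def field_simps)
  have slim: "s \<longlonglongrightarrow> 1" unfolding s_def by real_asymp
  have in_ball: "norm (of_real (s n) * cis x) < 1" for n x using s[of n] by (simp add: norm_mult)
  have vm: "(\<lambda>x. v (of_real (s n) * cis x)) \<in> borel_measurable borel" for n
    by (intro borel_measurable_continuous_onI continuous_on_compose2[OF holomorphic_on_imp_continuous_on[OF vhol]] continuous_intros)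
       (use in_ball in auto)
  define W where "W = (\<lambda>t. w (- \<i> * of_real t))"
  have Wc: "continuous_on UNIV W"
    unfolding W_def by (intro continuous_on_compose2[OF cont] continuous_intros) auto
  have Wb: "norm (W t) \<le> B" for t unfolding W_def by (rule bd) simp
  have Wm: "(\<lambda>x. W (\<tau> * tan (x / 2))) \<in> borel_measurable borel"
    using borel_measurable_tan_half borel_measurable_continuous_onI[OF Wc] by measurable
  have lim: "(\<lambda>n. v (of_real (s n) * cis x)) \<longlonglongrightarrow> W (\<tau> * tan (x / 2))" if "- pi < x" "x < pi" for x
  proof -
    have "(\<lambda>n. of_real (s n) * cis x) \<longlonglongrightarrow> of_real 1 * cis x"
      by (intro tendsto_intros slim)
    then have "(\<lambda>n. C (of_real (s n) * cis x)) \<longlonglongrightarrow> C (cis x)"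
      unfolding C_def using ciscnz[OF that] by (intro tendsto_intros) auto
    then have "(\<lambda>n. w (C (of_real (s n) * cis x))) \<longlonglongrightarrow> w (C (cis x))"
    proof (rule continuous_on_tendsto_compose[OF cont])
      show "\<forall>\<^sub>F n in sequentially. C (of_real (s n) * cis x) \<in> {s. 0 \<le> Re s}"
        using ReC[OF in_ball] by (intro always_eventually) (auto intro: order_less_imp_le)
    qed (simp add: Ccis[OF that])
    then show ?thesis by (simp add: v_def W_def Ccis[OF that])
  qed
  have vb: "norm (v (of_real (s n) * cis x)) \<le> B" for n x
    unfolding v_def using ReC[OF in_ball[of n x]] by (intro bd) simp
  have v0: "v 0 = w (of_real \<tau>)" by (simp add: v_def C_def)
  have cm: "f \<in> borel_measurable borel \<Longrightarrow> f \<in> borel_measurable circle_measure" for f :: "real \<Rightarrow> 'b::topological_space"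
    unfolding measurable_cong_sets[OF sets_circle_measure refl] .
  have "(\<lambda>n. \<integral>x. v (of_real (s n) * cis x) \<partial>circle_measure) \<longlonglongrightarrow> (\<integral>x. W (\<tau> * tan (x / 2)) \<partial>circle_measure)"
    by (rule integral_dominated_convergence[where w="\<lambda>_. B"])
       (auto intro!: AE_circle_measure lim vb cm vm Wm)
  then have "v 0 = (\<integral>x. W (\<tau> * tan (x / 2)) \<partial>circle_measure)"
    using circle_mean[OF vhol s] by (simp add: LIMSEQ_const_iff)
  then show "(\<integral>t. w (- \<i> * of_real t) * poisson \<tau> t \<partial>lborel) = w (of_real \<tau>)"
    using poisson_substitution[OF \<tau> Wc Wb] by (simp add: W_def v0)
  have "(\<lambda>n. \<integral>x. sqrt (norm (v (of_real (s n) * cis x))) \<partial>circle_measure) \<longlonglongrightarrow> (\<integral>x. sqrt (norm (W (\<tau> * tan (x / 2)))) \<partial>circle_measure)"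
    using vm Wm
    by (intro integral_dominated_convergence[where w="\<lambda>_. sqrt B"])
       (auto intro!: AE_circle_measure tendsto_intros lim vb cm)
  then have "sqrt (norm (v 0)) \<le> (\<integral>x. sqrt (norm (W (\<tau> * tan (x / 2)))) \<partial>circle_measure)"
    by (rule LIMSEQ_le_const) (use circle_sqrt_mean[OF vhol s] in blast)
  also have "\<dots> = (\<integral>t. sqrt (norm (W t)) * poisson \<tau> t \<partial>lborel)"
    by (rule poisson_substitution_nonneg(2)[OF \<tau>, symmetric, where B="sqrt B"])
       (auto intro!: continuous_intros Wc Wb)
  finally show "sqrt (norm (w (of_real \<tau>))) \<le> (\<integral>t. sqrt (norm (w (- \<i> * of_real t))) * poisson \<tau> t \<partial>lborel)"
    by (simp add: W_def v0)
qed

section \<open>Fourier inversion on the real line\<close>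

lemma norm_exp_ii [simp]: "norm (exp (- \<i> * of_real y)) = 1" "norm (exp (\<i> * of_real y)) = 1"
  by (simp_all add: norm_exp_eq_Re)

lemma norm_exp_ii' [simp]: "norm (exp (- (\<i> * of_real y))) = 1"
  by (simp add: norm_exp_eq_Re)

definition fourier :: "(real \<Rightarrow> complex) \<Rightarrow> real \<Rightarrow> complex" where
  "fourier k x = (\<integral>t. k t * exp (- \<i> * of_real (x * t)) \<partial>lborel)"

lemma integrable_mult_bounded:
  fixes f g :: "'a \<Rightarrow> complex"
  assumes f: "integrable M f" and g: "g \<in> borel_measurable M" "\<And>x. norm (g x) \<le> B"
  shows "integrable M (\<lambda>x. f x * g x)"
proof (rule Bochner_Integration.integrable_bound)
  show "integrable M (\<lambda>x. norm (f x) * B)" using f by (intro integrable_mult_left integrable_norm)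
  show "(\<lambda>x. f x * g x) \<in> borel_measurable M" using f g(1) by measurable
  show "AE x in M. norm (f x * g x) \<le> norm (norm (f x) * B)"
    by (intro AE_I2) (metis abs_ge_self g(2) mult_left_mono norm_ge_zero norm_mult order_trans real_norm_def)
qed

lemma fourier_integrable:
  assumes "integrable lborel k"
  shows "integrable lborel (\<lambda>t. k t * exp (- \<i> * of_real (x * t)))"
  by (rule integrable_mult_bounded[OF assms, where B=1]) auto

lemma borel_measurable_fourier [measurable]:
  assumes [measurable]: "k \<in> borel_measurable borel"
  shows "fourier k \<in> borel_measurable borel"
  unfolding fourier_def by measurable

lemma integrable_pair_dominated:
  fixes F :: "'a \<times> 'b \<Rightarrow> complex"
  assumes "sigma_finite_measure M" "sigma_finite_measure N"
    and [measurable]: "F \<in> borel_measurable (M \<Otimes>\<^sub>M N)"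
    and u: "integrable M u" and v: "integrable N v"
    and le: "\<And>x y. norm (F (x, y)) \<le> u x * v y"
  shows "integrable (M \<Otimes>\<^sub>M N) F"
proof -
  interpret M: sigma_finite_measure M by fact
  interpret N: sigma_finite_measure N by fact
  interpret pair_sigma_finite M N ..
  have um [measurable]: "u \<in> borel_measurable M" and vm [measurable]: "v \<in> borel_measurable N"
    using u v by auto
  have "integrable (M \<Otimes>\<^sub>M N) (\<lambda>(x, y). u x * v y)"
  proof (rule Fubini_integrable)
    have "(\<lambda>x. \<integral>y. norm (case (x, y) of (x, y) \<Rightarrow> u x * v y) \<partial>N) = (\<lambda>x. norm (u x) * (\<integral>y. norm (v y) \<partial>N))"
      by (simp add: abs_mult)
    then show "integrable M (\<lambda>x. \<integral>y. norm (case (x, y) of (x, y) \<Rightarrow> u x * v y) \<partial>N)"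
      using u by simp
    show "AE x in M. integrable N (\<lambda>y. case (x, y) of (x, y) \<Rightarrow> u x * v y)"
      using v by simp
  qed measurable
  then show ?thesis
    by (rule Bochner_Integration.integrable_bound) (use le in \<open>auto intro!: AE_I2 intro: order_trans[OF _ abs_ge_self]\<close>)
qed

lemma fourier_gaussian:
  assumes "0 < \<epsilon>"
  shows "(\<integral>\<xi>. exp (\<i> * of_real (\<xi> * v)) * of_real (exp (- (\<epsilon> * \<xi>)\<^sup>2 / 2)) \<partial>lborel)
    = of_real (2 * pi / \<epsilon> * std_normal_density (v / \<epsilon>))"
proof -
  have "(\<integral>\<xi>. exp (\<i> * of_real (\<xi> * v)) * of_real (exp (- (\<epsilon> * \<xi>)\<^sup>2 / 2)) \<partial>lborel)
      = \<bar>1 / \<epsilon>\<bar> *\<^sub>R (\<integral>x. exp (\<i> * of_real ((0 + 1 / \<epsilon> * x) * v)) * of_real (exp (- (\<epsilon> * (0 + 1 / \<epsilon> * x))\<^sup>2 / 2)) \<partial>lborel)"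
    by (rule lborel_integral_real_affine) (use assms in auto)
  also have "(\<lambda>x. exp (\<i> * of_real ((0 + 1 / \<epsilon> * x) * v)) * of_real (exp (- (\<epsilon> * (0 + 1 / \<epsilon> * x))\<^sup>2 / 2)) :: complex)
      = (\<lambda>x. sqrt (2 * pi) * (std_normal_density x *\<^sub>R exp (\<i> * of_real (v / \<epsilon> * x))))"
    using assms by (auto simp: std_normal_density_def scaleR_conv_of_real mult_ac)
  also have "(\<integral>x. sqrt (2 * pi) * (std_normal_density x *\<^sub>R exp (\<i> * of_real (v / \<epsilon> * x))) \<partial>lborel)
      = sqrt (2 * pi) * char std_normal_distribution (v / \<epsilon>)"
  proof -
    have "char std_normal_distribution (v / \<epsilon>) = (\<integral>x. std_normal_density x *\<^sub>R exp (\<i> * of_real (v / \<epsilon> * x)) \<partial>lborel)"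
      unfolding char_def by (rule integral_density) (auto intro!: AE_I2 normal_density_nonneg)
    then show ?thesis by (simp only: integral_mult_right_zero)
  qed
  also have "\<bar>1 / \<epsilon>\<bar> *\<^sub>R (complex_of_real (sqrt (2 * pi)) * char std_normal_distribution (v / \<epsilon>))
      = of_real (2 * pi / \<epsilon> * std_normal_density (v / \<epsilon>))"
  proof -
    define S where "S = sqrt (2 * pi)"
    have S: "S * S = 2 * pi" "S > 0" by (auto simp: S_def)
    have "1 / \<epsilon> * (S * exp (- (v / \<epsilon>)\<^sup>2 / 2)) = 2 * pi / \<epsilon> * std_normal_density (v / \<epsilon>)"
      unfolding std_normal_density_def S_def[symmetric] S(1)[symmetric] using S(2) by simp
    then show ?thesis unfolding S_def
      using assms unfolding char_std_normal_distribution
      by (simp add: scaleR_conv_of_real flip: of_real_mult)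
  qed
  finally show ?thesis .
qed

lemma integrable_gaussian:
  assumes "0 < \<epsilon>"
  shows "integrable lborel (\<lambda>\<xi>::real. exp (- (\<epsilon> * \<xi>)\<^sup>2 / 2))"
proof -
  have "integrable lborel (\<lambda>\<xi>. sqrt (2 * pi) * std_normal_density (0 + \<epsilon> * \<xi>))"
    using assms by (intro integrable_mult_right lborel_integrable_real_affine) auto
  then show ?thesis by (simp add: std_normal_density_def)
qed

lemma gaussian_factor_tendsto: "(\<lambda>n. exp (- (1 / real (Suc n) * \<xi>)\<^sup>2 / 2)) \<longlonglongrightarrow> 1"
proof -
  have "(\<lambda>n. 1 / real (Suc n) * \<xi>) \<longlonglongrightarrow> 0" by real_asymp
  then have "(\<lambda>n. exp (- (1 / real (Suc n) * \<xi>)\<^sup>2 / 2)) \<longlonglongrightarrow> exp (- 0\<^sup>2 / 2)"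
    by (intro tendsto_intros) auto
  then show ?thesis by simp
qed

text \<open>The Gaussian factor makes the double integral absolutely convergent; integrating it out first
leaves a Gaussian average of \<open>u\<close> around \<open>x\<close> of width \<open>\<epsilon>\<close>.\<close>

lemma fourier_inversion_regularized:
  fixes u :: "real \<Rightarrow> complex"
  assumes u: "integrable lborel u" and [measurable]: "u \<in> borel_measurable borel" and \<epsilon>: "0 < \<epsilon>"
  shows "(\<integral>\<xi>. fourier u \<xi> * exp (\<i> * of_real (\<xi> * x)) * of_real (exp (- (\<epsilon> * \<xi>)\<^sup>2 / 2)) \<partial>lborel)
    = 2 * pi * (\<integral>v. u (x + \<epsilon> * v) * std_normal_density v \<partial>lborel)"
proof -
  define G where "G = (\<lambda>\<xi>. exp (- (\<epsilon> * \<xi>)\<^sup>2 / 2))"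
  define F where "F = (\<lambda>(t, \<xi>). u t * exp (- \<i> * of_real (\<xi> * t)) * exp (\<i> * of_real (\<xi> * x)) * of_real (G \<xi>))"
  have [measurable]: "G \<in> borel_measurable borel" unfolding G_def by measurable
  have Fint: "integrable (lborel \<Otimes>\<^sub>M lborel) F"
  proof (rule integrable_pair_dominated[OF _ _ _ integrable_norm[OF u] integrable_gaussian[OF \<epsilon>]])
    show "F \<in> borel_measurable (lborel \<Otimes>\<^sub>M lborel)" unfolding F_def by measurable
    show "norm (F (t, \<xi>)) \<le> norm (u t) * exp (- (\<epsilon> * \<xi>)\<^sup>2 / 2)" for t \<xi>
      by (simp add: F_def G_def norm_mult)
  qed (simp_all add: sigma_finite_lborel)
  have inner: "(\<integral>\<xi>. F (t, \<xi>) \<partial>lborel) = u t * of_real (2 * pi / \<epsilon> * std_normal_density ((x - t) / \<epsilon>))" for t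
  proof -
    have "F (t, \<xi>) = u t * (exp (\<i> * of_real (\<xi> * (x - t))) * of_real (G \<xi>))" for \<xi>
      by (simp add: F_def algebra_simps flip: exp_add)
    then show ?thesis
      using fourier_gaussian[OF \<epsilon>, of "x - t"] by (simp add: G_def)
  qed
  have "(\<integral>\<xi>. fourier u \<xi> * exp (\<i> * of_real (\<xi> * x)) * of_real (G \<xi>) \<partial>lborel) = (\<integral>\<xi>. (\<integral>t. F (t, \<xi>) \<partial>lborel) \<partial>lborel)"
    unfolding F_def fourier_def by (simp add: mult.assoc flip: integral_mult_left_zero)
  also have "\<dots> = (\<integral>t. (\<integral>\<xi>. F (t, \<xi>) \<partial>lborel) \<partial>lborel)"
    using Fint by (intro lborel_pair.Fubini_integral) (simp add: case_prod_beta')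
  also have "\<dots> = (\<integral>t. u t * of_real (2 * pi / \<epsilon> * std_normal_density ((x - t) / \<epsilon>)) \<partial>lborel)"
    by (simp only: inner)
  also have "(\<integral>t. u t * of_real (2 * pi / \<epsilon> * std_normal_density ((x - t) / \<epsilon>)) \<partial>lborel)
      = \<bar>\<epsilon>\<bar> *\<^sub>R (\<integral>v. u (x + \<epsilon> * v) * of_real (2 * pi / \<epsilon> * std_normal_density ((x - (x + \<epsilon> * v)) / \<epsilon>)) \<partial>lborel)"
    by (rule lborel_integral_real_affine) (use \<epsilon> in auto)
  also have "\<dots> = \<epsilon> * (\<integral>v. (2 * pi / \<epsilon>) * (u (x + \<epsilon> * v) * std_normal_density v) \<partial>lborel)"
    using \<epsilon> by (simp add: scaleR_conv_of_real std_normal_density_def mult_ac)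
  also have "\<dots> = 2 * pi * (\<integral>v. u (x + \<epsilon> * v) * std_normal_density v \<partial>lborel)"
    using \<epsilon> by (simp add: integral_mult_right_zero del: Bochner_Integration.integral_mult_right)
  finally show ?thesis by (simp add: G_def)
qed

lemma gaussian_average_tendsto:
  fixes u :: "real \<Rightarrow> complex"
  assumes cont: "continuous_on UNIV u" and bd: "\<And>t. norm (u t) \<le> B"
  shows "(\<lambda>n. \<integral>v. u (x + 1 / real (Suc n) * v) * std_normal_density v \<partial>lborel) \<longlonglongrightarrow> u x"
proof -
  have [measurable]: "u \<in> borel_measurable borel" using cont by (rule borel_measurable_continuous_onI)
  have "(\<lambda>n. \<integral>v. u (x + 1 / real (Suc n) * v) * std_normal_density v \<partial>lborel) \<longlonglongrightarrow> (\<integral>v. u x * std_normal_density v \<partial>lborel)"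
  proof (rule integral_dominated_convergence[where w="\<lambda>v. B * std_normal_density v"])
    show "AE v in lborel. (\<lambda>n. u (x + 1 / real (Suc n) * v) * std_normal_density v) \<longlonglongrightarrow> u x * std_normal_density v"
    proof (intro AE_I2 tendsto_mult tendsto_const)
      fix v
      have "(\<lambda>n. x + 1 / real (Suc n) * v) \<longlonglongrightarrow> x" by real_asymp
      then show "(\<lambda>n. u (x + 1 / real (Suc n) * v)) \<longlonglongrightarrow> u x"
        by (rule continuous_on_tendsto_compose[OF cont]) auto
    qed
    show "AE v in lborel. norm (u (x + 1 / real (Suc n) * v) * std_normal_density v) \<le> B * std_normal_density v" for n
      using bd normal_density_nonneg by (intro AE_I2) (auto simp: norm_mult intro!: mult_mono order_trans[OF norm_ge_zero bd])
  qed auto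
  then show ?thesis by simp
qed

lemma fourier_inversion:
  fixes u :: "real \<Rightarrow> complex"
  assumes cont: "continuous_on UNIV u" and bd: "\<And>t. norm (u t) \<le> B"
    and u: "integrable lborel u" and fu: "integrable lborel (fourier u)"
  shows "(\<integral>\<xi>. fourier u \<xi> * exp (\<i> * of_real (\<xi> * x)) \<partial>lborel) = 2 * pi * u x"
proof -
  have [measurable]: "u \<in> borel_measurable borel" using cont by (rule borel_measurable_continuous_onI)
  have "(\<lambda>n. \<integral>\<xi>. fourier u \<xi> * exp (\<i> * of_real (\<xi> * x)) * of_real (exp (- (1 / real (Suc n) * \<xi>)\<^sup>2 / 2)) \<partial>lborel)
     \<longlonglongrightarrow> (\<integral>\<xi>. fourier u \<xi> * exp (\<i> * of_real (\<xi> * x)) \<partial>lborel)"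
  proof (rule integral_dominated_convergence[where w="\<lambda>\<xi>. norm (fourier u \<xi>)"])
    show "AE \<xi> in lborel. (\<lambda>n. fourier u \<xi> * exp (\<i> * of_real (\<xi> * x)) * of_real (exp (- (1 / real (Suc n) * \<xi>)\<^sup>2 / 2)))
       \<longlonglongrightarrow> fourier u \<xi> * exp (\<i> * of_real (\<xi> * x))"
    proof (rule AE_I2)
      fix \<xi>
      have "(\<lambda>n. fourier u \<xi> * exp (\<i> * of_real (\<xi> * x)) * complex_of_real (exp (- (1 / real (Suc n) * \<xi>)\<^sup>2 / 2)))
          \<longlonglongrightarrow> fourier u \<xi> * exp (\<i> * of_real (\<xi> * x)) * of_real 1"
        by (intro tendsto_intros gaussian_factor_tendsto)
      then show "(\<lambda>n. fourier u \<xi> * exp (\<i> * of_real (\<xi> * x)) * of_real (exp (- (1 / real (Suc n) * \<xi>)\<^sup>2 / 2)))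
       \<longlonglongrightarrow> fourier u \<xi> * exp (\<i> * of_real (\<xi> * x))" by simp
    qed
    show "AE \<xi> in lborel. norm (fourier u \<xi> * exp (\<i> * of_real (\<xi> * x)) * of_real (exp (- (1 / real (Suc n) * \<xi>)\<^sup>2 / 2))) \<le> norm (fourier u \<xi>)" for n
      by (intro AE_I2) (auto simp: norm_mult intro!: mult_left_le)
  qed (use fu in auto)
  moreover have "(\<lambda>n. \<integral>\<xi>. fourier u \<xi> * exp (\<i> * of_real (\<xi> * x)) * of_real (exp (- (1 / real (Suc n) * \<xi>)\<^sup>2 / 2)) \<partial>lborel)
     \<longlonglongrightarrow> 2 * pi * u x"
    using tendsto_mult[OF tendsto_const gaussian_average_tendsto[OF cont bd], of "2 * pi" x]
    by (subst fourier_inversion_regularized[OF u]) auto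
  ultimately show ?thesis by (rule LIMSEQ_unique)
qed

text \<open>The regularised inversion formula at \<open>0\<close> bounds \<open>\<integral> N(\<xi>) exp (- (\<epsilon> \<xi>)\<^sup>2 / 2) d\<xi>\<close> by
\<open>2 \<pi> B\<close> for every \<open>\<epsilon>\<close>; the positivity of \<open>N\<close> permits Fatou's lemma as \<open>\<epsilon> \<rightarrow> 0\<close>.\<close>

lemma nonneg_fourier_integrable:
  fixes u :: "real \<Rightarrow> complex"
  assumes cont: "continuous_on UNIV u" and bd: "\<And>t. norm (u t) \<le> B" and u: "integrable lborel u"
    and pos: "\<And>\<xi>. fourier u \<xi> = of_real (N \<xi>)" "\<And>\<xi>. 0 \<le> N \<xi>"
  shows "integrable lborel (fourier u)"
proof -
  have um [measurable]: "u \<in> borel_measurable borel" using cont by (rule borel_measurable_continuous_onI)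
  have N: "N = (\<lambda>\<xi>. Re (fourier u \<xi>))" using pos(1) by auto
  have [measurable]: "N \<in> borel_measurable borel" unfolding N by measurable
  have fb: "norm (fourier u \<xi>) \<le> (\<integral>t. norm (u t) \<partial>lborel)" for \<xi>
    unfolding fourier_def by (rule order_trans[OF integral_norm_bound]) (simp add: norm_mult)
  define G where "G = (\<lambda>n \<xi>. exp (- (1 / real (Suc n) * \<xi>)\<^sup>2 / 2))"
  have Gm [measurable]: "G n \<in> borel_measurable borel" for n unfolding G_def by measurable
  have reg: "(\<integral>\<^sup>+\<xi>. ennreal (N \<xi> * G n \<xi>) \<partial>lborel) \<le> ennreal (2 * pi * B)" for n
  proof -
    have Gi: "integrable lborel (G n)" unfolding G_def by (rule integrable_gaussian) simp
    have i: "integrable lborel (\<lambda>\<xi>. N \<xi> * G n \<xi>)"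
    proof (rule Bochner_Integration.integrable_bound[OF integrable_mult_right[OF Gi, of "\<integral>t. norm (u t) \<partial>lborel"]])
      show "AE \<xi> in lborel. norm (N \<xi> * G n \<xi>) \<le> norm ((\<integral>t. norm (u t) \<partial>lborel) * G n \<xi>)"
      proof (rule AE_I2)
        fix \<xi>
        have "0 \<le> G n \<xi>" by (simp add: G_def)
        moreover have "N \<xi> \<le> (\<integral>t. norm (u t) \<partial>lborel)" using fb[of \<xi>] pos by simp
        ultimately have "N \<xi> * G n \<xi> \<le> (\<integral>t. norm (u t) \<partial>lborel) * G n \<xi>" by (intro mult_right_mono)
        moreover have "0 \<le> N \<xi> * G n \<xi>" using \<open>0 \<le> G n \<xi>\<close> pos(2) by simp
        ultimately show "norm (N \<xi> * G n \<xi>) \<le> norm ((\<integral>t. norm (u t) \<partial>lborel) * G n \<xi>)" by simp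
      qed
    qed measurable
    define J where "J = (\<integral>v. u (0 + 1 / real (Suc n) * v) * std_normal_density v \<partial>lborel)"
    have "norm J \<le> (\<integral>v. B * std_normal_density v \<partial>lborel)"
      unfolding J_def
    proof (rule Bochner_Integration.integral_norm_bound_integral)
      show "integrable lborel (\<lambda>v. u (0 + 1 / real (Suc n) * v) * of_real (std_normal_density v))"
        by (subst mult.commute, rule integrable_mult_bounded[where B=B]) (use bd in auto)
      show "norm (u (0 + 1 / real (Suc n) * v) * of_real (std_normal_density v)) \<le> B * std_normal_density v" for v
        by (simp only: norm_mult norm_of_real abs_of_nonneg[OF normal_density_nonneg])
           (intro mult_right_mono bd normal_density_nonneg)
    qed auto
    then have J: "norm J \<le> B" by simp
    have "fourier u \<xi> * exp (\<i> * of_real (\<xi> * 0)) * of_real (G n \<xi>) = of_real (N \<xi> * G n \<xi>)" for \<xi>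
      by (simp add: pos(1))
    then have "complex_of_real (\<integral>\<xi>. N \<xi> * G n \<xi> \<partial>lborel) = (\<integral>\<xi>. fourier u \<xi> * exp (\<i> * of_real (\<xi> * 0)) * of_real (G n \<xi>) \<partial>lborel)"
      by (simp only: integral_complex_of_real)
    also have "\<dots> = of_real (2 * pi) * J"
      unfolding G_def J_def by (rule fourier_inversion_regularized[OF u um]) simp
    finally have *: "complex_of_real (\<integral>\<xi>. N \<xi> * G n \<xi> \<partial>lborel) = of_real (2 * pi) * J" .
    have "\<bar>\<integral>\<xi>. N \<xi> * G n \<xi> \<partial>lborel\<bar> = \<bar>2 * pi\<bar> * norm J"
      using arg_cong[OF *, of norm] by (simp only: norm_mult norm_of_real)
    also have "\<dots> \<le> \<bar>2 * pi\<bar> * B" by (rule mult_left_mono[OF J abs_ge_zero])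
    also have "\<dots> = 2 * pi * B" by simp
    finally have "(\<integral>\<xi>. N \<xi> * G n \<xi> \<partial>lborel) \<le> 2 * pi * B" by linarith
    moreover have "(\<integral>\<^sup>+\<xi>. ennreal (N \<xi> * G n \<xi>) \<partial>lborel) = ennreal (\<integral>\<xi>. N \<xi> * G n \<xi> \<partial>lborel)"
      using pos(2) by (intro nn_integral_eq_integral[OF i] AE_I2 mult_nonneg_nonneg) (simp_all add: G_def)
    ultimately show ?thesis by (simp only: ennreal_leI)
  qed
  have "(\<integral>\<^sup>+\<xi>. ennreal (N \<xi>) \<partial>lborel) = (\<integral>\<^sup>+\<xi>. liminf (\<lambda>n. ennreal (N \<xi> * G n \<xi>)) \<partial>lborel)"
  proof (rule nn_integral_cong)
    fix \<xi>
    have "(\<lambda>n. G n \<xi>) \<longlonglongrightarrow> 1" unfolding G_def by (rule gaussian_factor_tendsto)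
    then have "(\<lambda>n. N \<xi> * G n \<xi>) \<longlonglongrightarrow> N \<xi> * 1" by (intro tendsto_intros)
    then have "(\<lambda>n. ennreal (N \<xi> * G n \<xi>)) \<longlonglongrightarrow> ennreal (N \<xi>)" by (intro tendsto_ennrealI) simp
    then show "ennreal (N \<xi>) = liminf (\<lambda>n. ennreal (N \<xi> * G n \<xi>))"
      by (simp add: lim_imp_Liminf)
  qed
  also have "\<dots> \<le> liminf (\<lambda>n. \<integral>\<^sup>+\<xi>. ennreal (N \<xi> * G n \<xi>) \<partial>lborel)"
    by (rule nn_integral_liminf) measurable
  also have "\<dots> \<le> liminf (\<lambda>n. ennreal (2 * pi * B))"
    by (intro Liminf_mono always_eventually allI reg)
  also have "\<dots> < \<infinity>" by (simp add: Liminf_const)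
  finally have "integrable lborel N"
    by (intro integrableI_nonneg) (use pos in auto)
  then have "integrable lborel (\<lambda>\<xi>. complex_of_real (N \<xi>))" by simp
  then show ?thesis by (simp add: pos(1)[abs_def, symmetric])
qed

text \<open>By Plancherel, \<open>2 \<pi> \<integral> \<bar>u\<bar>\<^sup>2 = \<integral> N\<^sup>2 \<le> m \<integral> N = 2 \<pi> m u(0)\<close>.  Read backwards, a function \<open>u\<close> with
much \<open>L\<^sub>2\<close> mass compared to \<open>\<bar>u(0)\<bar>\<close> has a frequency at which its transform is large.\<close>

lemma nonneg_fourier_L2_bound:
  fixes u :: "real \<Rightarrow> complex"
  assumes cont: "continuous_on UNIV u" and bd: "\<And>t. norm (u t) \<le> B" and u: "integrable lborel u"
    and pos: "\<And>\<xi>. fourier u \<xi> = of_real (N \<xi>)" "\<And>\<xi>. 0 \<le> N \<xi>" and m: "\<And>\<xi>. N \<xi> \<le> m"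
  shows "(\<integral>t. (norm (u t))\<^sup>2 \<partial>lborel) \<le> m * norm (u 0)"
proof -
  have [measurable]: "u \<in> borel_measurable borel" using cont by (rule borel_measurable_continuous_onI)
  have fi: "integrable lborel (fourier u)" by (rule nonneg_fourier_integrable[OF cont bd u pos])
  have fnm: "norm (fourier u \<xi>) = N \<xi>" for \<xi> using pos by simp
  have Ni: "integrable lborel N" using integrable_norm[OF fi] by (simp add: fnm)
  have [measurable]: "N \<in> borel_measurable borel" using Ni by auto
  have inv: "(\<integral>\<xi>. fourier u \<xi> * exp (\<i> * of_real (\<xi> * t)) \<partial>lborel) = 2 * pi * u t" for t
    by (rule fourier_inversion[OF cont bd u fi])
  have cinv: "(\<integral>\<xi>. N \<xi> * exp (- \<i> * of_real (\<xi> * t)) \<partial>lborel) = 2 * pi * cnj (u t)" for t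
  proof -
    have "(\<integral>\<xi>. N \<xi> * exp (- \<i> * of_real (\<xi> * t)) \<partial>lborel) = (\<integral>\<xi>. cnj (fourier u \<xi> * exp (\<i> * of_real (\<xi> * t))) \<partial>lborel)"
      by (simp add: pos(1) exp_cnj)
    also have "\<dots> = cnj (2 * pi * u t)" unfolding inv[symmetric] by (rule Bochner_Integration.integral_cnj)
    finally show ?thesis by simp
  qed
  define F where "F = (\<lambda>(t, \<xi>). u t * exp (- \<i> * of_real (\<xi> * t)) * of_real (N \<xi>))"
  have Fint: "integrable (lborel \<Otimes>\<^sub>M lborel) F"
  proof (rule integrable_pair_dominated[OF _ _ _ integrable_norm[OF u] Ni])
    show "F \<in> borel_measurable (lborel \<Otimes>\<^sub>M lborel)" unfolding F_def by measurable
    show "norm (F (t, \<xi>)) \<le> norm (u t) * N \<xi>" for t \<xi>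
      using pos by (simp add: F_def norm_mult)
  qed (simp_all add: sigma_finite_lborel)
  have sq: "u t * (2 * pi * cnj (u t)) = of_real (2 * pi * (norm (u t))\<^sup>2)" for t
    using complex_norm_square[of "u t"] by (simp add: mult_ac)
  have inner: "(\<integral>\<xi>. F (t, \<xi>) \<partial>lborel) = u t * (2 * pi * cnj (u t))" for t
  proof -
    have "(\<integral>\<xi>. F (t, \<xi>) \<partial>lborel) = (\<integral>\<xi>. u t * (N \<xi> * exp (- \<i> * of_real (\<xi> * t))) \<partial>lborel)"
      by (simp only: F_def prod.case mult_ac)
    also have "\<dots> = u t * (2 * pi * cnj (u t))"
      by (simp only: integral_mult_right_zero cinv)
    finally show ?thesis .
  qed
  have "complex_of_real (2 * pi * (\<integral>t. (norm (u t))\<^sup>2 \<partial>lborel)) = (\<integral>t. of_real (2 * pi * (norm (u t))\<^sup>2) \<partial>lborel)"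
    by (simp only: integral_complex_of_real integral_mult_right_zero)
  also have "\<dots> = (\<integral>t. (\<integral>\<xi>. F (t, \<xi>) \<partial>lborel) \<partial>lborel)"
    by (simp only: inner sq)
  also have "\<dots> = (\<integral>\<xi>. (\<integral>t. F (t, \<xi>) \<partial>lborel) \<partial>lborel)"
    using Fint by (intro lborel_pair.Fubini_integral[symmetric]) (simp add: case_prod_beta')
  also have "\<dots> = (\<integral>\<xi>. of_real (N \<xi> * N \<xi>) \<partial>lborel)"
  proof -
    have "(\<integral>t. F (t, \<xi>) \<partial>lborel) = of_real (N \<xi> * N \<xi>)" for \<xi>
    proof -
      have "(\<integral>t. F (t, \<xi>) \<partial>lborel) = fourier u \<xi> * of_real (N \<xi>)"
        unfolding F_def prod.case fourier_def by (rule integral_mult_left_zero)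
      then show ?thesis by (simp only: pos(1) of_real_mult)
    qed
    then show ?thesis by (simp only:)
  qed
  finally have eq: "2 * pi * (\<integral>t. (norm (u t))\<^sup>2 \<partial>lborel) = (\<integral>\<xi>. N \<xi> * N \<xi> \<partial>lborel)"
    unfolding integral_complex_of_real of_real_eq_iff .
  have NNi: "integrable lborel (\<lambda>\<xi>. N \<xi> * N \<xi>)"
  proof (rule Bochner_Integration.integrable_bound[OF integrable_mult_right[OF Ni, of m]])
    have "0 \<le> m" using pos(2)[of 0] m[of 0] by linarith
    then show "AE \<xi> in lborel. norm (N \<xi> * N \<xi>) \<le> norm (m * N \<xi>)"
      using mult_right_mono[OF m pos(2)] pos(2) by (intro AE_I2) (simp add: abs_mult)
  qed measurable
  have "(\<integral>\<xi>. N \<xi> * N \<xi> \<partial>lborel) \<le> (\<integral>\<xi>. m * N \<xi> \<partial>lborel)"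
    by (rule integral_mono[OF NNi integrable_mult_right[OF Ni]]) (intro mult_right_mono m pos(2))
  also have "\<dots> = m * (\<integral>\<xi>. N \<xi> \<partial>lborel)" by simp
  also have "(\<integral>\<xi>. N \<xi> \<partial>lborel) = 2 * pi * norm (u 0)"
  proof -
    have "complex_of_real (\<integral>\<xi>. N \<xi> \<partial>lborel) = 2 * pi * u 0" using inv[of 0] by (simp add: pos(1))
    then have "norm (complex_of_real (\<integral>\<xi>. N \<xi> \<partial>lborel)) = 2 * pi * norm (u 0)" by (simp add: norm_mult)
    moreover have "0 \<le> (\<integral>\<xi>. N \<xi> \<partial>lborel)" by (rule Bochner_Integration.integral_nonneg) (rule pos(2))
    ultimately show ?thesis by simp
  qed
  finally have "2 * pi * (\<integral>t. (norm (u t))\<^sup>2 \<partial>lborel) \<le> 2 * pi * (m * norm (u 0))"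
    unfolding eq by (simp only: mult_ac)
  then show ?thesis by (simp only: mult_le_cancel_left_pos[OF mult_pos_pos[OF zero_less_numeral pi_gt_zero]])
qed

section \<open>Exponential sums and the Fejer kernel\<close>

text \<open>Because all \<open>l n\<close> are nonnegative, the exponential sum is the boundary function of
\<open>\<Sum> c\<^sub>n e\<^sup>-\<^sup>l\<^sup>n\<^sup>s\<close>, which is bounded on the right half-plane.\<close>

lemma exp_sum_poisson:
  fixes l :: "'i \<Rightarrow> real" and c :: "'i \<Rightarrow> complex"
  assumes I: "finite I" "\<And>n. n \<in> I \<Longrightarrow> 0 \<le> l n" and \<tau>: "0 < \<tau>"
  shows "(\<integral>t. (\<Sum>n\<in>I. c n * exp (- \<i> * of_real (l n * t))) * poisson \<tau> t \<partial>lborel)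
       = (\<Sum>n\<in>I. c n * of_real (exp (- l n * \<tau>)))" (is ?A)
    and "sqrt (norm (\<Sum>n\<in>I. c n * of_real (exp (- l n * \<tau>))))
       \<le> (\<integral>t. sqrt (norm (\<Sum>n\<in>I. c n * exp (- \<i> * of_real (l n * t)))) * poisson \<tau> t \<partial>lborel)" (is ?B)
proof -
  define w where "w = (\<lambda>s. \<Sum>n\<in>I. c n * exp (- of_real (l n) * s))"
  have hol: "w holomorphic_on {s. 0 < Re s}" unfolding w_def by (intro holomorphic_intros)
  have cont: "continuous_on {s. 0 \<le> Re s} w" unfolding w_def by (intro continuous_intros)
  have bd: "norm (w s) \<le> (\<Sum>n\<in>I. norm (c n))" if "0 \<le> Re s" for s
    unfolding w_def using that I by (intro sum_norm_le) (auto simp: norm_mult norm_exp_eq_Re intro!: mult_left_le)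
  have e1: "w (- \<i> * of_real (0 + - 1 * t)) = (\<Sum>n\<in>I. c n * exp (- \<i> * of_real (l n * t)))" for t
    by (simp add: w_def mult_ac)
  have e2: "w (of_real \<tau>) = (\<Sum>n\<in>I. c n * of_real (exp (- l n * \<tau>)))"
    by (simp add: w_def exp_of_real[symmetric])
  have p: "poisson \<tau> (0 + - 1 * t) = poisson \<tau> t" for t by simp
  have "w (of_real \<tau>) = (\<integral>t. w (- \<i> * of_real t) * poisson \<tau> t \<partial>lborel)"
    by (rule half_plane_poisson(1)[OF hol cont bd \<tau>, symmetric])
  also have "\<dots> = \<bar>- 1\<bar> *\<^sub>R (\<integral>t. w (- \<i> * of_real (0 + - 1 * t)) * poisson \<tau> (0 + - 1 * t) \<partial>lborel)"
    by (rule lborel_integral_real_affine) simp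
  finally show ?A unfolding e1 e2 p by simp
  have "sqrt (norm (w (of_real \<tau>))) \<le> (\<integral>t. sqrt (norm (w (- \<i> * of_real t))) * poisson \<tau> t \<partial>lborel)"
    by (rule half_plane_poisson(2)[OF hol cont bd \<tau>])
  also have "\<dots> = \<bar>- 1\<bar> *\<^sub>R (\<integral>t. sqrt (norm (w (- \<i> * of_real (0 + - 1 * t)))) * poisson \<tau> (0 + - 1 * t) \<partial>lborel)"
    by (rule lborel_integral_real_affine) simp
  finally show ?B unfolding e1 e2 p by simp
qed

lemma fourier_poisson:
  assumes "0 < \<tau>" "0 \<le> x"
  shows "fourier (\<lambda>t. of_real (poisson \<tau> t)) x = of_real (exp (- x * \<tau>))"
  using exp_sum_poisson(1)[of "{()}" "\<lambda>_. x" \<tau> "\<lambda>_. 1"] assms by (simp add: fourier_def mult.commute)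

definition tent :: "real \<Rightarrow> real" where
  "tent x = max 0 (1 - \<bar>x\<bar>)"

text \<open>The value at \<open>0\<close> is the continuous extension.\<close>

definition fejer :: "real \<Rightarrow> real" where
  "fejer t = (if t = 0 then 1 / (2 * pi) else (1 - cos t) / (pi * t\<^sup>2))"

lemma fejer_nonneg: "0 \<le> fejer t"
  by (simp add: fejer_def)

lemma borel_measurable_fejer [measurable]: "fejer \<in> borel_measurable borel"
  unfolding fejer_def by measurable

lemma fejer_le_poisson: "fejer t \<le> 3 * poisson 1 t"
proof (cases "t = 0")
  case False
  have "\<bar>sin (t / 2)\<bar> \<le> \<bar>t / 2\<bar>" by (rule abs_sin_x_le_abs_x)
  then have "(sin (t / 2))\<^sup>2 \<le> (t / 2)\<^sup>2" by (simp only: abs_le_square_iff)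
  then have "1 - cos t \<le> t\<^sup>2 / 2" using cos_double_sin[of "t / 2"] by (simp add: power_divide)
  moreover have "(1 - cos t) * t\<^sup>2 \<le> 2 * t\<^sup>2" using cos_ge_minus_one[of t] by (intro mult_right_mono) (linarith, simp)
  ultimately have "(1 - cos t) * (1 + t\<^sup>2) \<le> 3 * t\<^sup>2"
    unfolding distrib_left mult_1_right using zero_le_power2[of t] by linarith
  moreover have "0 < 1 + t\<^sup>2" by (simp add: add_pos_nonneg)
  ultimately have "1 - cos t \<le> 3 * t\<^sup>2 / (1 + t\<^sup>2)" by (simp only: pos_le_divide_eq)
  then have "(1 - cos t) / (pi * t\<^sup>2) \<le> 3 * t\<^sup>2 / (1 + t\<^sup>2) / (pi * t\<^sup>2)"
    by (rule divide_right_mono) simp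
  then show ?thesis using False by (simp add: fejer_def poisson_def mult.commute)
qed (simp add: fejer_def poisson_def field_simps)

lemma integrable_fejer: "integrable lborel fejer"
  by (rule Bochner_Integration.integrable_bound[of _ "\<lambda>t. 3 * poisson 1 t"])
     (use fejer_le_poisson fejer_nonneg in \<open>auto intro!: AE_I2 integrable_mult_right order_trans[OF _ abs_ge_self]\<close>)

lemma continuous_tent: "continuous_on A tent"
  unfolding tent_def by (intro continuous_intros)

lemma fourier_tent:
  assumes "\<xi> \<noteq> 0"
  shows "fourier (\<lambda>x. of_real (tent x)) \<xi> = of_real (2 * (1 - cos \<xi>) / \<xi>\<^sup>2)"
proof -
  define f where "f = (\<lambda>x. of_real (tent x) * exp (- \<i> * of_real (\<xi> * x)) :: complex)"
  define E where "E = (\<lambda>x. exp (- \<i> * of_real (\<xi> * x)) :: complex)"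
  have dE: "(E has_vector_derivative - \<i> * of_real \<xi> * E x) (at x within S)" for x S
  proof -
    have "((\<lambda>z. exp (- \<i> * of_real \<xi> * z)) has_field_derivative (- \<i> * of_real \<xi> * exp (- \<i> * of_real \<xi> * of_real x))) (at (of_real x))"
      by (auto intro!: derivative_eq_intros)
    from has_vector_derivative_real_field[OF this]
    show ?thesis unfolding E_def by (simp add: mult_ac)
  qed
  have i1: "(1 - c) * (\<i> / \<xi>) * (- \<i> * of_real \<xi> * z) = (1 - c) * z" "(1 + c) * (\<i> / \<xi>) * (- \<i> * of_real \<xi> * z) = (1 + c) * z"
    for z c :: complex
    using assms by simp_all
  have i2: "(- \<i> * of_real \<xi> * z) / complex_of_real (\<xi>\<^sup>2) = - ((\<i> / \<xi>) * z)" for z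
    using assms by (simp add: power2_eq_square)
  (* Antiderivatives of f on the two halves of the support of the tent. *)
  define F1 where "F1 = (\<lambda>x. (1 - of_real x) * (\<i> / \<xi>) * E x - E x / \<xi>\<^sup>2)"
  define F2 where "F2 = (\<lambda>x. (1 + of_real x) * (\<i> / \<xi>) * E x + E x / \<xi>\<^sup>2)"
  have d1: "(F1 has_vector_derivative f x) (at x within {0..1})" if "0 \<le> x" "x \<le> 1" for x
  proof -
    have "(F1 has_vector_derivative (1 - of_real x) * (\<i> / \<xi>) * (- \<i> * of_real \<xi> * E x) + - 1 * (\<i> / \<xi>) * E x - (- \<i> * of_real \<xi> * E x) / \<xi>\<^sup>2) (at x within {0..1})"
      unfolding F1_def
      by (auto intro!: derivative_eq_intros dE simp: has_vector_derivative_of_real algebra_simps)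
         (simp add: assms power2_eq_square add_divide_distrib diff_divide_distrib)
    also have "(1 - of_real x) * (\<i> / \<xi>) * (- \<i> * of_real \<xi> * E x) + - 1 * (\<i> / \<xi>) * E x - (- \<i> * of_real \<xi> * E x) / \<xi>\<^sup>2
        = (1 - of_real x) * E x"
      unfolding i1 i2 by (simp add: algebra_simps)
    also have "(1 - of_real x) * E x = f x" using that by (simp add: f_def E_def tent_def)
    finally show ?thesis .
  qed
  have d2: "(F2 has_vector_derivative f x) (at x within {-1..0})" if "- 1 \<le> x" "x \<le> 0" for x
  proof -
    have "(F2 has_vector_derivative (1 + of_real x) * (\<i> / \<xi>) * (- \<i> * of_real \<xi> * E x) + 1 * (\<i> / \<xi>) * E x + (- \<i> * of_real \<xi> * E x) / \<xi>\<^sup>2) (at x within {-1..0})"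
      unfolding F2_def
      by (auto intro!: derivative_eq_intros dE simp: has_vector_derivative_of_real algebra_simps)
         (simp add: assms power2_eq_square add_divide_distrib diff_divide_distrib)
    also have "(1 + of_real x) * (\<i> / \<xi>) * (- \<i> * of_real \<xi> * E x) + 1 * (\<i> / \<xi>) * E x + (- \<i> * of_real \<xi> * E x) / \<xi>\<^sup>2
        = (1 + of_real x) * E x"
      unfolding i1 i2 by (simp add: algebra_simps)
    also have "(1 + of_real x) * E x = f x" using that by (simp add: f_def E_def tent_def)
    finally show ?thesis .
  qed
  have fc: "continuous_on A f" for A
    unfolding f_def using continuous_tent[of A] by (intro continuous_intros)
  have "(f has_integral F1 1 - F1 0) {0..1}"
    by (rule fundamental_theorem_of_calculus) (use d1 in auto)
  moreover have "(f has_integral F2 0 - F2 (- 1)) {-1..0}"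
    by (rule fundamental_theorem_of_calculus) (use d2 in auto)
  ultimately have "(f has_integral (F2 0 - F2 (- 1)) + (F1 1 - F1 0)) {-1..1}"
    by (intro has_integral_combine[of "-1" 0 1]) auto
  moreover have "set_integrable lborel {-1..1} f"
    by (rule borel_integrable_atLeastAtMost'[OF fc])
  ultimately have "(LINT x:{-1..1}|lborel. f x) = (F2 0 - F2 (- 1)) + (F1 1 - F1 0)"
    using set_borel_integral_eq_integral(2) integral_unique by metis
  also have "(LINT x:{-1..1}|lborel. f x) = (\<integral>x. f x \<partial>lborel)"
    unfolding set_lebesgue_integral_def
    by (rule Bochner_Integration.integral_cong) (auto simp: f_def tent_def indicator_def)
  also have "\<dots> = fourier (\<lambda>x. of_real (tent x)) \<xi>"
    by (simp add: fourier_def f_def)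
  also have "(F2 0 - F2 (- 1)) + (F1 1 - F1 0) = (2 - (E 1 + E (- 1))) / \<xi>\<^sup>2"
    by (simp add: F1_def F2_def E_def diff_divide_distrib add_divide_distrib)
  also have "E 1 + E (- 1) = 2 * of_real (cos \<xi>)"
    unfolding E_def by (simp add: cos_exp_eq cos_of_real[symmetric] add.commute)
  finally show ?thesis by (simp add: diff_divide_distrib right_diff_distrib)
qed

text \<open>The transform of the tent is \<open>2 \<pi>\<close> times the Fejer kernel, which is integrable and even, so Fourier
inversion exchanges the two.\<close>

lemma fourier_fejer: "fourier (\<lambda>t. of_real (fejer t)) x = of_real (tent x)"
proof -
  let ?T = "\<lambda>x. complex_of_real (tent x)"
  have c: "continuous_on UNIV ?T" by (intro continuous_intros continuous_tent)
  have int: "integrable lborel ?T"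
  proof -
    have "set_integrable lborel {-1..1} ?T"
      by (rule borel_integrable_atLeastAtMost') (use c continuous_on_subset in blast)
    also have "set_integrable lborel {-1..1} ?T \<longleftrightarrow> integrable lborel ?T"
      unfolding set_integrable_def by (rule Bochner_Integration.integrable_cong) (auto simp: tent_def indicator_def)
    finally show ?thesis .
  qed
  have ae: "AE \<xi> in lborel. fourier ?T \<xi> = 2 * pi * of_real (fejer \<xi>)"
    using AE_lborel_singleton[of 0] by eventually_elim (simp add: fourier_tent fejer_def)
  have Tm [measurable]: "?T \<in> borel_measurable borel" using c by (rule borel_measurable_continuous_onI)
  have fint: "integrable lborel (fourier ?T)"
  proof (rule integrable_cong_AE_imp)
    show "integrable lborel (\<lambda>\<xi>. 2 * pi * complex_of_real (fejer \<xi>))"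
      by (intro integrable_mult_right integrable_of_real integrable_fejer)
  qed (use ae in auto)
  have "(\<integral>\<xi>. fourier ?T \<xi> * exp (\<i> * of_real (\<xi> * - x)) \<partial>lborel) = 2 * pi * ?T (- x)"
    by (rule fourier_inversion[OF c _ int fint, where B=1]) (simp add: tent_def)
  moreover have "(\<integral>\<xi>. fourier ?T \<xi> * exp (\<i> * of_real (\<xi> * - x)) \<partial>lborel)
      = (\<integral>\<xi>. 2 * pi * (of_real (fejer \<xi>) * exp (- \<i> * of_real (x * \<xi>))) \<partial>lborel)"
    by (rule integral_cong_AE) (use ae in \<open>auto simp: mult_ac\<close>)
  ultimately show ?thesis
    by (simp only: integral_mult_right_zero fourier_def) (simp add: tent_def)
qed

lemma integral_fejer: "(\<integral>t. fejer t \<partial>lborel) = 1"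
  using fourier_fejer[of 0] by (simp add: fourier_def tent_def)

text \<open>The translates converge pointwise and all have the same norm, so Scheffe's lemma applies.\<close>

lemma translation_L1_tendsto:
  fixes k :: "real \<Rightarrow> real"
  assumes cont: "continuous_on UNIV k" and int: "integrable lborel k" and s: "s \<longlonglongrightarrow> 0"
  shows "(\<lambda>n. \<integral>t. \<bar>k (t + s n) - k t\<bar> \<partial>lborel) \<longlonglongrightarrow> 0"
proof -
  have km [measurable]: "k \<in> borel_measurable borel" using cont by (rule borel_measurable_continuous_onI)
  have ishift: "integrable lborel (\<lambda>t. k (t + c))" for c
    using lborel_integrable_real_affine[OF int, of 1 c] by (simp add: add.commute)
  have "(\<lambda>n. \<integral>\<^sup>+t. norm (k (t + s n) - k t) \<partial>lborel) \<longlonglongrightarrow> 0"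
  proof (rule Scheffe_lemma2[OF _ int])
    show "AE t in lborel. (\<lambda>n. k (t + s n)) \<longlonglongrightarrow> k t"
    proof (rule AE_I2)
      fix t
      have "(\<lambda>n. t + s n) \<longlonglongrightarrow> t + 0" by (intro tendsto_intros s)
      then have "(\<lambda>n. t + s n) \<longlonglongrightarrow> t" by simp
      then show "(\<lambda>n. k (t + s n)) \<longlonglongrightarrow> k t"
        by (rule continuous_on_tendsto_compose[OF cont]) auto
    qed
    show "(\<integral>\<^sup>+t. norm (k (t + s n)) \<partial>lborel) \<le> (\<integral>\<^sup>+t. norm (k t) \<partial>lborel)" for n
      using nn_integral_real_affine[of "\<lambda>t. ennreal (norm (k t))" 1 "s n"] by (simp add: add.commute)
  qed auto
  also have "(\<lambda>n. \<integral>\<^sup>+t. norm (k (t + s n) - k t) \<partial>lborel) = (\<lambda>n. ennreal (\<integral>t. \<bar>k (t + s n) - k t\<bar> \<partial>lborel))"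
  proof
    fix n
    have "integrable lborel (\<lambda>t. \<bar>k (t + s n) - k t\<bar>)"
      using int ishift by (intro integrable_abs Bochner_Integration.integrable_diff)
    then show "(\<integral>\<^sup>+t. norm (k (t + s n) - k t) \<partial>lborel) = ennreal (\<integral>t. \<bar>k (t + s n) - k t\<bar> \<partial>lborel)"
      by (simp add: nn_integral_eq_integral)
  qed
  finally show ?thesis
    by (subst (asm) ennreal_tendsto_0_iff) (auto intro!: Bochner_Integration.integral_nonneg)
qed

text \<open>This is \<open>P\<^sub>\<sigma> - P\<^sub>\<sigma> * K\<^sub>R\<close>, where \<open>K\<^sub>R(t) = R fejer (R t)\<close>, after rescaling the integration
variable of the convolution.\<close>

definition smoothing_error :: "real \<Rightarrow> real \<Rightarrow> real \<Rightarrow> real" where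
  "smoothing_error \<sigma> R t = poisson \<sigma> t - (\<integral>v. poisson \<sigma> (t - v / R) * fejer v \<partial>lborel)"

lemma poisson_le: "0 < \<sigma> \<Longrightarrow> poisson \<sigma> t \<le> 1 / (pi * \<sigma>)"
proof -
  assume "0 < \<sigma>"
  then have "\<sigma> / (pi * (\<sigma>\<^sup>2 + t\<^sup>2)) \<le> \<sigma> / (pi * \<sigma>\<^sup>2)"
    by (intro divide_left_mono mult_left_mono) (auto simp: add_pos_nonneg)
  then show ?thesis using \<open>0 < \<sigma>\<close> by (simp add: poisson_def power2_eq_square)
qed

lemma smoothing_error:
  assumes \<sigma>: "0 < \<sigma>" and R: "0 < R"
  shows "integrable lborel (smoothing_error \<sigma> R)"
    and "(\<integral>t. \<bar>smoothing_error \<sigma> R t\<bar> \<partial>lborel)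
       \<le> (\<integral>v. (\<integral>t. \<bar>poisson \<sigma> (t + - v / R) - poisson \<sigma> t\<bar> \<partial>lborel) * fejer v \<partial>lborel)"
    and "0 \<le> x \<Longrightarrow> fourier (\<lambda>t. of_real (smoothing_error \<sigma> R t)) x = of_real (exp (- x * \<sigma>) * (1 - tent (x / R)))"
proof -
  let ?P = "poisson \<sigma>"
  have Pi: "integrable lborel ?P" using \<sigma> by simp
  have Pshift: "integrable lborel (\<lambda>t. ?P (t - c))" for c
    using lborel_integrable_real_affine[OF Pi, of 1 "-c"] by simp
  have Pshift_int: "(\<integral>t. ?P (t - c) \<partial>lborel) = 1" for c
    using lborel_integral_real_affine[of 1 ?P "-c"] \<sigma> by simp
  have Pnn: "0 \<le> ?P t" for t using poisson_pos[OF \<sigma>, of t] by simp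
  define Q where "Q = (\<lambda>(v, t). ?P (t - v / R) * fejer v)"
  define Q0 where "Q0 = (\<lambda>(v, t). ?P t * fejer v)"
  have Qm [measurable]: "Q \<in> borel_measurable (lborel \<Otimes>\<^sub>M lborel)"
    "Q0 \<in> borel_measurable (lborel \<Otimes>\<^sub>M lborel)" unfolding Q_def Q0_def by measurable
  have Qi: "integrable (lborel \<Otimes>\<^sub>M lborel) Q"
  proof (rule lborel_pair.Fubini_integrable[OF Qm(1)])
    have "(\<lambda>v. \<integral>t. norm (Q (v, t)) \<partial>lborel) = fejer"
      using Pnn fejer_nonneg by (simp add: Q_def abs_mult Pshift_int)
    then show "integrable lborel (\<lambda>v. \<integral>t. norm (Q (v, t)) \<partial>lborel)" using integrable_fejer by simp
    show "AE v in lborel. integrable lborel (\<lambda>t. Q (v, t))"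
      by (auto simp: Q_def intro!: AE_I2 integrable_mult_left Pshift)
  qed
  have Q0i: "integrable (lborel \<Otimes>\<^sub>M lborel) Q0"
  proof (rule lborel_pair.Fubini_integrable[OF Qm(2)])
    have "(\<lambda>v. \<integral>t. norm (Q0 (v, t)) \<partial>lborel) = fejer"
      using Pnn fejer_nonneg \<sigma> by (simp add: Q0_def abs_mult)
    then show "integrable lborel (\<lambda>v. \<integral>t. norm (Q0 (v, t)) \<partial>lborel)" using integrable_fejer by simp
    show "AE v in lborel. integrable lborel (\<lambda>t. Q0 (v, t))"
      by (auto simp: Q0_def intro!: AE_I2 integrable_mult_left Pi)
  qed
  have Qv: "integrable lborel (\<lambda>v. Q (v, t))" for t
  proof (rule Bochner_Integration.integrable_bound[OF integrable_mult_right[OF integrable_fejer, of "1 / (pi * \<sigma>)"]])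
    show "AE v in lborel. norm (Q (v, t)) \<le> norm (1 / (pi * \<sigma>) * fejer v)"
    proof (rule AE_I2)
      fix v
      have "?P (t - v / R) * fejer v \<le> 1 / (pi * \<sigma>) * fejer v"
        by (rule mult_right_mono[OF poisson_le[OF \<sigma>] fejer_nonneg])
      moreover have "0 \<le> ?P (t - v / R) * fejer v" using Pnn fejer_nonneg by simp
      ultimately show "norm (Q (v, t)) \<le> norm (1 / (pi * \<sigma>) * fejer v)"         using fejer_nonneg[of v] \<sigma> by (simp add: Q_def abs_mult)
    qed
  qed measurable
  have err: "smoothing_error \<sigma> R t = (\<integral>v. Q0 (v, t) - Q (v, t) \<partial>lborel)" for t
  proof -
    have "(\<integral>v. Q0 (v, t) - Q (v, t) \<partial>lborel) = (\<integral>v. Q0 (v, t) \<partial>lborel) - (\<integral>v. Q (v, t) \<partial>lborel)"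
      by (rule Bochner_Integration.integral_diff[OF _ Qv])
         (auto simp: Q0_def intro!: integrable_mult_right integrable_fejer)
    then show ?thesis by (simp add: smoothing_error_def Q_def Q0_def integral_fejer)
  qed
  have Di: "integrable (lborel \<Otimes>\<^sub>M lborel) (\<lambda>(v, t). Q0 (v, t) - Q (v, t))"
    using Bochner_Integration.integrable_diff[OF Q0i Qi] by (simp add: case_prod_beta')
  show int: "integrable lborel (smoothing_error \<sigma> R)"
    using lborel_pair.integrable_snd[OF Di] unfolding err[abs_def] .
  have Dni: "integrable (lborel \<Otimes>\<^sub>M lborel) (\<lambda>(v, t). \<bar>Q0 (v, t) - Q (v, t)\<bar>)"
    using integrable_norm[OF Di] by (simp add: case_prod_beta')
  have "(\<integral>t. \<bar>smoothing_error \<sigma> R t\<bar> \<partial>lborel) \<le> (\<integral>t. (\<integral>v. \<bar>Q0 (v, t) - Q (v, t)\<bar> \<partial>lborel) \<partial>lborel)"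
  proof (rule integral_mono)
    show "integrable lborel (\<lambda>t. \<bar>smoothing_error \<sigma> R t\<bar>)" using int by simp
    show "integrable lborel (\<lambda>t. \<integral>v. \<bar>Q0 (v, t) - Q (v, t)\<bar> \<partial>lborel)"
      using lborel_pair.integrable_snd[OF Dni] by simp
    show "\<bar>smoothing_error \<sigma> R t\<bar> \<le> (\<integral>v. \<bar>Q0 (v, t) - Q (v, t)\<bar> \<partial>lborel)" for t
      unfolding err by (rule integral_abs_bound)
  qed
  also have "\<dots> = (\<integral>v. (\<integral>t. \<bar>Q0 (v, t) - Q (v, t)\<bar> \<partial>lborel) \<partial>lborel)"
    by (rule lborel_pair.Fubini_integral[OF Dni])
  also have "\<dots> = (\<integral>v. (\<integral>t. \<bar>?P (t + - v / R) - ?P t\<bar> \<partial>lborel) * fejer v \<partial>lborel)"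
  proof -
    have "\<bar>Q0 (v, t) - Q (v, t)\<bar> = \<bar>?P (t + - v / R) - ?P t\<bar> * fejer v" for v t
      using fejer_nonneg[of v] by (simp add: Q_def Q0_def abs_minus_commute abs_mult flip: left_diff_distrib)
    then show ?thesis by simp
  qed
  finally show "(\<integral>t. \<bar>smoothing_error \<sigma> R t\<bar> \<partial>lborel)
       \<le> (\<integral>v. (\<integral>t. \<bar>?P (t + - v / R) - ?P t\<bar> \<partial>lborel) * fejer v \<partial>lborel)" .
  assume x: "0 \<le> x"
  (* The transform of a translate of the Poisson kernel is a phase times its transform, and averaging
     the phase over the Fejer kernel gives the tent. *)
  define e where "e = (\<lambda>t. exp (- \<i> * of_real (x * t)) :: complex)"
  have [measurable]: "e \<in> borel_measurable borel" unfolding e_def by measurable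
  have ne: "norm (e t) = 1" for t unfolding e_def by simp
  have ei: "integrable lborel k \<Longrightarrow> integrable lborel (\<lambda>t. of_real (k t) * e t)" for k :: "real \<Rightarrow> real"
    by (rule integrable_mult_bounded[where B=1]) (auto simp: ne)
  have Qei: "integrable (lborel \<Otimes>\<^sub>M lborel) (\<lambda>(v, t). of_real (Q (v, t)) * e t)"
  proof -
    have "integrable (lborel \<Otimes>\<^sub>M lborel) (\<lambda>z. of_real (Q z) * e (snd z))"
      by (rule integrable_mult_bounded[where B=1]) (use Qi in \<open>auto simp: ne\<close>)
    then show ?thesis by (simp add: case_prod_beta')
  qed
  have shift: "(\<integral>t. of_real (?P (t - c)) * e t \<partial>lborel) = of_real (exp (- x * \<sigma>)) * e c" for c
  proof -
    have "(\<integral>t. of_real (?P (t - c)) * e t \<partial>lborel) = \<bar>1\<bar> *\<^sub>R (\<integral>t. of_real (?P ((c + 1 * t) - c)) * e (c + 1 * t) \<partial>lborel)"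
      by (rule lborel_integral_real_affine) simp
    also have "\<dots> = (\<integral>t. e c * (of_real (?P t) * e t) \<partial>lborel)"
      by (simp add: e_def ring_distribs exp_add mult_ac exp_minus)
    also have "\<dots> = e c * fourier (\<lambda>t. of_real (?P t)) x"
      unfolding fourier_def e_def by (rule integral_mult_right_zero)
    finally show ?thesis using fourier_poisson[OF \<sigma> x] by (simp add: mult.commute)
  qed
  have "(\<integral>t. (\<integral>v. of_real (Q (v, t)) * e t \<partial>lborel) \<partial>lborel) = (\<integral>v. (\<integral>t. of_real (Q (v, t)) * e t \<partial>lborel) \<partial>lborel)"
    by (rule lborel_pair.Fubini_integral[OF Qei])
  also have "\<dots> = (\<integral>v. of_real (exp (- x * \<sigma>)) * (of_real (fejer v) * e (v / R)) \<partial>lborel)"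
  proof -
    have "(\<integral>t. of_real (Q (v, t)) * e t \<partial>lborel) = of_real (exp (- x * \<sigma>)) * (of_real (fejer v) * e (v / R))" for v
    proof -
      have "(\<integral>t. of_real (Q (v, t)) * e t \<partial>lborel) = (\<integral>t. of_real (fejer v) * (of_real (?P (t - v / R)) * e t) \<partial>lborel)"
        by (simp add: Q_def mult_ac)
      also have "\<dots> = of_real (fejer v) * (of_real (exp (- x * \<sigma>)) * e (v / R))"
        unfolding shift[symmetric] by (rule integral_mult_right_zero)
      finally show ?thesis by (simp add: mult_ac)
    qed
    then show ?thesis by simp
  qed
  also have "\<dots> = of_real (exp (- x * \<sigma>)) * fourier (\<lambda>v. of_real (fejer v)) (x / R)"
    unfolding fourier_def e_def by (simp only: integral_mult_right_zero) simp
  finally have A: "(\<integral>t. (\<integral>v. of_real (Q (v, t)) * e t \<partial>lborel) \<partial>lborel) = of_real (exp (- x * \<sigma>)) * of_real (tent (x / R))"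
    by (simp add: fourier_fejer)
  have B: "of_real (smoothing_error \<sigma> R t) * e t = of_real (?P t) * e t - (\<integral>v. of_real (Q (v, t)) * e t \<partial>lborel)" for t
  proof -
    have "(\<integral>v. of_real (Q (v, t)) * e t \<partial>lborel) = of_real (\<integral>v. Q (v, t) \<partial>lborel) * e t"
      by (simp only: integral_mult_left_zero integral_complex_of_real)
    then show ?thesis by (simp only: smoothing_error_def Q_def left_diff_distrib prod.case of_real_diff)
  qed
  have "fourier (\<lambda>t. of_real (smoothing_error \<sigma> R t)) x = (\<integral>t. of_real (smoothing_error \<sigma> R t) * e t \<partial>lborel)"
    by (simp add: fourier_def e_def)
  also have "\<dots> = (\<integral>t. of_real (?P t) * e t \<partial>lborel) - (\<integral>t. (\<integral>v. of_real (Q (v, t)) * e t \<partial>lborel) \<partial>lborel)"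
    unfolding B by (rule Bochner_Integration.integral_diff[OF ei[OF Pi] lborel_pair.integrable_snd[OF Qei]])
  also have "(\<integral>t. of_real (?P t) * e t \<partial>lborel) = of_real (exp (- x * \<sigma>))"
    using fourier_poisson[OF \<sigma> x] by (simp add: fourier_def e_def)
  finally show "fourier (\<lambda>t. of_real (smoothing_error \<sigma> R t)) x = of_real (exp (- x * \<sigma>) * (1 - tent (x / R)))"
    unfolding A by (simp add: right_diff_distrib)
qed

text \<open>The \<open>L\<^sub>1\<close> norm is at most the Fejer average of the translation modulus of \<open>P\<^sub>\<sigma>\<close> at \<open>- v / R\<close>, and this
modulus tends to \<open>0\<close> pointwise and is bounded by \<open>2\<close>.\<close>

lemma smoothing_error_tendsto:
  assumes \<sigma>: "0 < \<sigma>"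
  shows "(\<lambda>n. \<integral>t. \<bar>smoothing_error \<sigma> (real (Suc n)) t\<bar> \<partial>lborel) \<longlonglongrightarrow> 0"
proof -
  let ?P = "poisson \<sigma>"
  have Pc: "continuous_on UNIV ?P" by (intro continuous_intros \<sigma>)
  have Pi: "integrable lborel ?P" using \<sigma> by simp
  have Pshift: "integrable lborel (\<lambda>t. ?P (t + c))" for c
    using lborel_integrable_real_affine[OF Pi, of 1 c] by (simp add: add.commute)
  have Pshift_int: "(\<integral>t. ?P (t + c) \<partial>lborel) = 1" for c
    using lborel_integral_real_affine[of 1 ?P c] \<sigma> by (simp add: add.commute)
  have Pnn: "0 \<le> ?P t" for t using poisson_pos[OF \<sigma>, of t] by simp
  define \<omega> where "\<omega> = (\<lambda>s. \<integral>t. \<bar>?P (t + s) - ?P t\<bar> \<partial>lborel)"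
  have [measurable]: "\<omega> \<in> borel_measurable borel" unfolding \<omega>_def by measurable
  have \<omega>nn: "0 \<le> \<omega> s" for s unfolding \<omega>_def by (rule Bochner_Integration.integral_nonneg) simp
  have \<omega>2: "\<omega> s \<le> 2" for s
  proof -
    have "\<omega> s \<le> (\<integral>t. ?P (t + s) + ?P t \<partial>lborel)"
      unfolding \<omega>_def
    proof (rule integral_mono)
      show "\<bar>?P (t + s) - ?P t\<bar> \<le> ?P (t + s) + ?P t" for t using Pnn[of t] Pnn[of "t+s"] by linarith
    qed (use Pi Pshift in \<open>auto intro!: integrable_abs Bochner_Integration.integrable_diff Bochner_Integration.integrable_add\<close>)
    also have "\<dots> = 2" using Pi Pshift[of s] \<sigma> by (simp add: Pshift_int)
    finally show ?thesis .
  qed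
  have up: "(\<lambda>n. \<integral>v. \<omega> (- v / real (Suc n)) * fejer v \<partial>lborel) \<longlonglongrightarrow> integral\<^sup>L lborel (\<lambda>v::real. 0)"
  proof (rule integral_dominated_convergence[where w="\<lambda>v. 2 * fejer v"])
    show "AE v in lborel. (\<lambda>n. \<omega> (- v / real (Suc n)) * fejer v) \<longlonglongrightarrow> 0"
    proof (rule AE_I2)
      fix v
      have "(\<lambda>n. - v / real (Suc n)) \<longlonglongrightarrow> 0" by real_asymp
      from translation_L1_tendsto[OF Pc Pi this]
      have "(\<lambda>n. \<omega> (- v / real (Suc n))) \<longlonglongrightarrow> 0" unfolding \<omega>_def .
      then show "(\<lambda>n. \<omega> (- v / real (Suc n)) * fejer v) \<longlonglongrightarrow> 0" by (rule tendsto_mult_left_zero)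
    qed
    show "AE v in lborel. norm (\<omega> (- v / real (Suc n)) * fejer v) \<le> 2 * fejer v" for n
      using \<omega>2 \<omega>nn fejer_nonneg by (intro AE_I2) (simp add: abs_mult mult_right_mono)
  qed (use integrable_fejer in auto)
  show ?thesis
  proof (rule tendsto_sandwich[OF always_eventually always_eventually tendsto_const])
    show "\<forall>n. 0 \<le> (\<integral>t. \<bar>smoothing_error \<sigma> (real (Suc n)) t\<bar> \<partial>lborel)"
      by (intro allI Bochner_Integration.integral_nonneg) simp
    show "\<forall>n. (\<integral>t. \<bar>smoothing_error \<sigma> (real (Suc n)) t\<bar> \<partial>lborel) \<le> (\<integral>v. \<omega> (- v / real (Suc n)) * fejer v \<partial>lborel)"
      using smoothing_error(2)[OF \<sigma>] unfolding \<omega>_def by simp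
    show "(\<lambda>n. \<integral>v. \<omega> (- v / real (Suc n)) * fejer v \<partial>lborel) \<longlonglongrightarrow> 0" using up by simp
  qed
qed

section \<open>Compact groups with a dense flow\<close>

text \<open>Only the dense one-parameter subgroup enters here, so that the frequency remains free until
Dirichlet series appear.\<close>

locale flow_group =
  fixes \<beta> :: "real \<Rightarrow> 'g::{t2_space,topological_ab_group_add}" and \<mu> :: "'g measure"
  assumes compact_G: "compact (UNIV :: 'g set)"
    and cont_\<beta>: "continuous_on UNIV \<beta>"
    and \<beta>_add: "\<beta> (s + t) = \<beta> s + \<beta> t"
    and dense_\<beta>: "closure (range \<beta>) = UNIV"
    and haar: "haar_measure \<mu>"
begin

lemma sets_\<mu> [measurable_cong]: "sets \<mu> = sets borel"
  using haar by (simp add: haar_measure_def)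

lemma space_\<mu> [simp]: "space \<mu> = UNIV"
  using sets_eq_imp_space_eq[OF sets_\<mu>] by simp

lemma prob_space_\<mu>: "prob_space \<mu>"
  using haar by (intro prob_spaceI) (simp add: haar_measure_def)

end

sublocale flow_group \<subseteq> prob_space \<mu>
  by (rule prob_space_\<mu>)

sublocale flow_group \<subseteq> TG: pair_sigma_finite lborel \<mu>
  by unfold_locales

context flow_group
begin

lemma \<beta>_0 [simp]: "\<beta> 0 = 0"
  using \<beta>_add[of 0 0] by simp

lemma \<beta>_minus: "\<beta> (- t) = - \<beta> t"
  using \<beta>_add[of "-t" t] by (simp add: eq_neg_iff_add_eq_0)

lemma \<beta>_diff: "\<beta> (s - t) = \<beta> s - \<beta> t"
  using \<beta>_add[of s "-t"] by (simp add: \<beta>_minus)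

lemma integrable_bounded:
  fixes F :: "'g \<Rightarrow> 'b::{banach,second_countable_topology}"
  assumes "F \<in> borel_measurable borel" "\<And>x. norm (F x) \<le> B"
  shows "integrable \<mu> F"
proof (rule integrable_const_bound)
  show "AE x in \<mu>. norm (F x) \<le> B" by (rule AE_I2) (rule assms(2))
  show "F \<in> borel_measurable \<mu>" using assms(1) by measurable
qed

lemma continuous_bounded:
  fixes f :: "'g \<Rightarrow> 'b::real_normed_vector"
  assumes "continuous_on UNIV f"
  obtains B where "0 < B" "\<And>x. norm (f x) \<le> B"
proof -
  have "compact (f ` UNIV)" by (rule compact_continuous_image[OF assms compact_G])
  then obtain B where "\<And>x. norm (f x) \<le> B" using compact_imp_bounded bounded_iff by (metis rangeI)
  then show ?thesis by (intro that[of "max B 1"]) (auto simp: le_max_iff_disj)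
qed

lemma measurable_shift [measurable]: "(\<lambda>y. y + x) \<in> borel_measurable (borel :: 'g measure)"
  by (intro borel_measurable_continuous_onI continuous_intros)

lemma measurable_shift_\<mu> [measurable]: "(\<lambda>y. y + x) \<in> measurable \<mu> \<mu>"
  using measurable_shift[of x] by (simp add: measurable_cong_sets[OF sets_\<mu> sets_\<mu>])

lemma distr_shift: "distr \<mu> \<mu> (\<lambda>y. y + x) = \<mu>"
proof (rule measure_eqI)
  fix A assume A: "A \<in> sets (distr \<mu> \<mu> (\<lambda>y. y + x))"
  then have A': "A \<in> sets borel" by (simp add: sets_\<mu>)
  have "emeasure (distr \<mu> \<mu> (\<lambda>y. y + x)) A = emeasure \<mu> ((\<lambda>y. y + x) -` A)"
    using A by (subst emeasure_distr) auto
  also have "(\<lambda>y. y + x) -` A = (\<lambda>y. - x + y) ` A"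
    by (auto simp: image_iff algebra_simps intro!: bexI[of _ "_ + x"])
  also have "emeasure \<mu> \<dots> = emeasure \<mu> A"
    using haar A' unfolding haar_measure_def by blast
  finally show "emeasure (distr \<mu> \<mu> (\<lambda>y. y + x)) A = emeasure \<mu> A" .
qed simp

lemma nn_integral_shift:
  assumes "F \<in> borel_measurable borel"
  shows "(\<integral>\<^sup>+y. F (y + x) \<partial>\<mu>) = (\<integral>\<^sup>+y. F y \<partial>\<mu>)"
proof -
  have "(\<integral>\<^sup>+y. F y \<partial>\<mu>) = (\<integral>\<^sup>+y. F y \<partial>distr \<mu> \<mu> (\<lambda>y. y + x))" by (simp add: distr_shift)
  also have "\<dots> = (\<integral>\<^sup>+y. F (y + x) \<partial>\<mu>)"
    by (rule nn_integral_distr) (use assms in measurable)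
  finally show ?thesis ..
qed

lemma integral_shift:
  fixes F :: "'g \<Rightarrow> 'b::{banach,second_countable_topology}"
  assumes "F \<in> borel_measurable borel"
  shows "(\<integral>y. F (y + x) \<partial>\<mu>) = (\<integral>y. F y \<partial>\<mu>)"
proof -
  have "(\<integral>y. F y \<partial>\<mu>) = (\<integral>y. F y \<partial>distr \<mu> \<mu> (\<lambda>y. y + x))" by (simp add: distr_shift)
  also have "\<dots> = (\<integral>y. F (y + x) \<partial>\<mu>)"
    by (rule integral_distr) (use assms in measurable)
  finally show ?thesis ..
qed

lemma integrable_shift:
  fixes F :: "'g \<Rightarrow> 'b::{banach,second_countable_topology}"
  assumes "integrable \<mu> F"
  shows "integrable \<mu> (\<lambda>y. F (y + x))"
  using assms by (intro integrable_distr[of "\<lambda>y. y + x" \<mu> \<mu> F]) (simp_all add: distr_shift)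

lemma AE_shift:
  assumes "AE y in \<mu>. P y"
  shows "AE y in \<mu>. P (y + x)"
proof (rule AE_distrD[of "\<lambda>y. y + x" \<mu> \<mu> P])
  show "AE y in distr \<mu> \<mu> (\<lambda>y. y + x). P y" unfolding distr_shift by (rule assms)
qed measurable

text \<open>The group need not be second countable, and then the product of two Borel \<open>\<sigma>\<close>-algebras may miss
open sets.  A countable base of \<open>\<real>\<close> alone is enough: \<open>W\<close> is the union over base
sets \<open>b\<close> of \<open>b\<close> times the largest open set \<open>V\<close> with \<open>b \<times> V \<subseteq> W\<close>.  This makes
\<open>(t, y) \<mapsto> f (y + \<beta> t)\<close> product measurable and so opens the way to Fubini's theorem.\<close>

lemma open_product_sets:
  fixes W :: "(real \<times> 'g) set"
  assumes "open W"
  shows "W \<in> sets (borel \<Otimes>\<^sub>M borel)"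
proof -
  obtain B :: "real set set" where B: "countable B" "topological_basis B"
    using ex_countable_basis by blast
  define U where "U = (\<lambda>b. \<Union>{V. open V \<and> b \<times> V \<subseteq> W})"
  have U: "open (U b)" "b \<times> U b \<subseteq> W" for b unfolding U_def by auto
  have Bo: "open b" if "b \<in> B" for b using B(2) that by (rule topological_basis_open)
  have "W = (\<Union>b\<in>B. b \<times> U b)"
  proof (intro equalityI subsetI)
    fix z assume z: "z \<in> W"
    then obtain S V where SV: "open S" "open V" "z \<in> S \<times> V" "S \<times> V \<subseteq> W"
      using assms by (metis open_prod_elim)
    then obtain b where "b \<in> B" "fst z \<in> b" "b \<subseteq> S"
      using B(2) by (metis topological_basisE mem_Times_iff)
    then have "z \<in> b \<times> U b" unfolding U_def using SV by (auto simp: mem_Times_iff)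
    then show "z \<in> (\<Union>b\<in>B. b \<times> U b)" using \<open>b \<in> B\<close> by blast
  qed (use U(2) in blast)
  also have "\<dots> \<in> sets (borel \<Otimes>\<^sub>M borel)"
    using Bo U(1) by (intro sets.countable_UN'[OF B(1)]) auto
  finally show ?thesis .
qed

lemma measurable_flow [measurable]: "(\<lambda>z. snd z + \<beta> (fst z)) \<in> borel_measurable (borel \<Otimes>\<^sub>M borel)"
proof (rule borel_measurableI)
  fix S :: "'g set" assume "open S"
  have "continuous_on UNIV (\<lambda>z :: real \<times> 'g. snd z + \<beta> (fst z))"
    by (intro continuous_intros continuous_on_compose2[OF cont_\<beta>]) auto
  then have "open ((\<lambda>z :: real \<times> 'g. snd z + \<beta> (fst z)) -` S)"
    using \<open>open S\<close> by (simp add: continuous_on_open_vimage)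
  then show "(\<lambda>z :: real \<times> 'g. snd z + \<beta> (fst z)) -` S \<inter> space (borel \<Otimes>\<^sub>M borel) \<in> sets (borel \<Otimes>\<^sub>M borel)"
    by (simp add: space_pair_measure open_product_sets)
qed

lemma measurable_flow_\<mu> [measurable]:
  assumes [measurable]: "f \<in> borel_measurable borel"
  shows "(\<lambda>z. f (snd z + \<beta> (fst z))) \<in> borel_measurable (lborel \<Otimes>\<^sub>M \<mu>)"
proof -
  have "(\<lambda>z. snd z + \<beta> (fst z)) \<in> measurable (lborel \<Otimes>\<^sub>M \<mu>) borel"
    using measurable_flow by (simp add: measurable_cong_sets[OF sets_pair_measure_cong[OF sets_lborel sets_\<mu>] refl])
  then show ?thesis by measurable
qed

lemma measurable_flow_t [measurable]:
  assumes [measurable]: "f \<in> borel_measurable borel"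
  shows "(\<lambda>t. f (y + \<beta> t)) \<in> borel_measurable borel"
proof -
  have "(\<lambda>t. y + \<beta> t) \<in> borel_measurable borel"
    by (intro borel_measurable_continuous_onI continuous_intros cont_\<beta>)
  then show ?thesis by measurable
qed

text \<open>The group need not be metrizable, so neighbourhoods of \<open>0\<close> take the place of a uniform
distance.\<close>

lemma uniform_modulus:
  fixes f :: "'g \<Rightarrow> complex"
  assumes f: "continuous_on UNIV f" and e: "0 < e"
  obtains U where "open U" "0 \<in> U" "\<And>y u. u \<in> U \<Longrightarrow> norm (f (y + u) - f y) \<le> e"
proof -
  have "continuous_on (UNIV \<times> UNIV) (\<lambda>z :: 'g \<times> 'g. f (snd z + fst z))"
    by (intro continuous_on_compose2[OF f] continuous_intros) auto
  from continuous_on_prod_compactE[OF this compact_G, of 0 e] e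
  obtain X0 where "0 \<in> X0" "open X0" "\<forall>x\<in>X0 \<inter> UNIV. \<forall>t\<in>UNIV. dist (f (t + x)) (f (t + 0)) \<le> e"
    by auto
  then show ?thesis by (intro that[of X0]) (auto simp: dist_norm)
qed

lemma continuous_from_modulus:
  fixes f :: "'g \<Rightarrow> complex"
  assumes "\<And>e. 0 < e \<Longrightarrow> \<exists>U. open U \<and> 0 \<in> U \<and> (\<forall>y. \<forall>u\<in>U. norm (f (y + u) - f y) \<le> e)"
  shows "continuous_on UNIV f"
  unfolding continuous_on_eq_continuous_at[OF open_UNIV]
proof
  fix x :: 'g
  show "isCont f x"
    unfolding isCont_def
  proof (rule tendstoI)
    fix e :: real assume "0 < e"
    then obtain U where U: "open U" "0 \<in> U" "\<And>y u. u \<in> U \<Longrightarrow> norm (f (y + u) - f y) \<le> e / 2"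
      using assms[of "e / 2"] by auto
    have "open ((\<lambda>z. z - x) -` U)"
      using U(1) by (intro open_vimage continuous_intros) auto
    moreover have "x \<in> (\<lambda>z. z - x) -` U" using U(2) by simp
    moreover have "dist (f z) (f x) < e" if "z \<in> (\<lambda>z. z - x) -` U" for z
      using U(3)[of "z - x" x] that \<open>0 < e\<close> by (simp add: dist_norm)
    ultimately show "\<forall>\<^sub>F z in at x. dist (f z) (f x) < e"
      unfolding eventually_at_topological by blast
  qed
qed

lemma flow_meets_open:
  assumes "open V" "V \<noteq> {}"
  obtains s where "\<beta> s \<in> V"
proof -
  have "V \<inter> closure (range \<beta>) \<noteq> {}" using assms(2) dense_\<beta> by simp
  then have "V \<inter> range \<beta> \<noteq> {}" using open_Int_closure_eq_empty[OF assms(1)] by blast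
  then show ?thesis using that by blast
qed

text \<open>The orbit is dense, so the translates of \<open>{\<Psi> > \<Psi> z / 2}\<close> by flow elements cover the group, and
compactness leaves finitely many of them.\<close>

lemma flow_translates_cover:
  fixes \<Psi> :: "'g \<Rightarrow> real"
  assumes cont: "continuous_on UNIV \<Psi>" and nn: "\<And>y. 0 \<le> \<Psi> y" and pos: "0 < \<Psi> z"
  obtains S c where "finite S" "0 < c" "\<And>y. c \<le> (\<Sum>s\<in>S. \<Psi> (y - \<beta> s))"
proof -
  define W where "W = (\<lambda>s. (\<lambda>y. \<Psi> (y - \<beta> s)) -` {\<Psi> z / 2<..})"
  have W: "open (W s)" for s
    unfolding W_def by (intro open_vimage continuous_on_compose2[OF cont] continuous_intros) auto
  have cover: "\<exists>s. y \<in> W s" for y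
  proof -
    define V where "V = (\<lambda>x. \<Psi> (y - x)) -` {\<Psi> z / 2<..}"
    have "open V"
      unfolding V_def by (intro open_vimage continuous_on_compose2[OF cont] continuous_intros) auto
    moreover have "y - z \<in> V" using pos by (simp add: V_def)
    ultimately obtain s where "\<beta> s \<in> V" using flow_meets_open[of V] by blast
    then show ?thesis by (auto simp: V_def W_def)
  qed
  have "\<exists>S\<subseteq>range id. finite S \<and> UNIV \<subseteq> (\<Union>s\<in>S. W s)"
    by (rule compactE_image[OF compact_G, of UNIV W]) (use W cover in \<open>auto\<close>)
  then obtain S where S: "finite S" "UNIV \<subseteq> (\<Union>s\<in>S. W s)" by blast
  show ?thesis
  proof (rule that[OF S(1), of "\<Psi> z / 2"])
    fix y
    obtain s where s: "s \<in> S" "y \<in> W s" using S(2) by blast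
    then have "\<Psi> z / 2 \<le> \<Psi> (y - \<beta> s)" by (simp add: W_def)
    also have "\<dots> \<le> (\<Sum>s\<in>S. \<Psi> (y - \<beta> s))" using s(1) S(1) nn by (intro member_le_sum) auto
    finally show "\<Psi> z / 2 \<le> (\<Sum>s\<in>S. \<Psi> (y - \<beta> s))" .
  qed (use pos in simp)
qed

lemma integral_continuous_pos:
  fixes \<Psi> :: "'g \<Rightarrow> real"
  assumes cont: "continuous_on UNIV \<Psi>" and nn: "\<And>y. 0 \<le> \<Psi> y" and pos: "0 < \<Psi> z"
  shows "0 < (\<integral>y. \<Psi> y \<partial>\<mu>)"
proof -
  obtain S c where S: "finite S" "0 < c" "\<And>y. c \<le> (\<Sum>s\<in>S. \<Psi> (y - \<beta> s))"
    using flow_translates_cover[OF assms] by metis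
  have m [measurable]: "\<Psi> \<in> borel_measurable borel" using cont by (rule borel_measurable_continuous_onI)
  obtain B where B: "\<And>y. norm (\<Psi> y) \<le> B" using continuous_bounded[OF cont] by blast
  have int: "integrable \<mu> \<Psi>" using m B by (rule integrable_bounded)
  have ints: "integrable \<mu> (\<lambda>y. \<Psi> (y - \<beta> s))" for s using integrable_shift[OF int, of "- \<beta> s"] by simp
  have "c = (\<integral>y. c \<partial>\<mu>)" using prob_space by simp
  also have "\<dots> \<le> (\<integral>y. (\<Sum>s\<in>S. \<Psi> (y - \<beta> s)) \<partial>\<mu>)"
    by (intro integral_mono Bochner_Integration.integrable_sum ints S(3)) simp
  also have "\<dots> = (\<Sum>s\<in>S. \<integral>y. \<Psi> (y - \<beta> s) \<partial>\<mu>)" by (rule Bochner_Integration.integral_sum) (rule ints)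
  also have "\<dots> = (\<Sum>s\<in>S. \<integral>y. \<Psi> y \<partial>\<mu>)"
    using integral_shift[OF m, of "- \<beta> _"] by simp
  finally have "c \<le> card S * (\<integral>y. \<Psi> y \<partial>\<mu>)" by simp
  then show ?thesis using S(2) by (metis less_le_trans mult_le_0_iff not_le of_nat_0_le_iff)
qed

text \<open>With the sign \<open>y + \<beta> t\<close>, the coefficient at a character \<open>h\<close> is multiplied by \<open>\<integral> k(t) h(\<beta> t) dt\<close>;
for the character of frequency \<open>x\<close> this is the Fourier transform of \<open>k\<close> at \<open>x\<close>.\<close>

definition flow_conv :: "('g \<Rightarrow> complex) \<Rightarrow> (real \<Rightarrow> complex) \<Rightarrow> 'g \<Rightarrow> complex" where
  "flow_conv f k y = (\<integral>t. f (y + \<beta> t) * k t \<partial>lborel)"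

lemma flow_pair_integrable:
  fixes f :: "'g \<Rightarrow> complex" and k :: "real \<Rightarrow> complex"
  assumes f: "integrable \<mu> f" and k: "integrable lborel k"
  shows "integrable (lborel \<Otimes>\<^sub>M \<mu>) (\<lambda>(t, y). f (y + \<beta> t) * k t)"
proof (rule TG.Fubini_integrable)
  have fm [measurable]: "f \<in> borel_measurable borel" using f sets_\<mu> by (simp add: borel_measurable_integrable cong: measurable_cong_sets)
  have [measurable]: "k \<in> borel_measurable borel" using borel_measurable_integrable[OF k] by simp
  show "(\<lambda>(t, y). f (y + \<beta> t) * k t) \<in> borel_measurable (lborel \<Otimes>\<^sub>M \<mu>)"
    by (simp add: case_prod_beta')
  have "(\<lambda>t. \<integral>y. norm (case (t, y) of (t, y) \<Rightarrow> f (y + \<beta> t) * k t) \<partial>\<mu>) = (\<lambda>t. (\<integral>y. norm (f y) \<partial>\<mu>) * norm (k t))"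
    using integral_shift[of "\<lambda>y. norm (f y)"] by (simp add: norm_mult)
  then show "integrable lborel (\<lambda>t. \<integral>y. norm (case (t, y) of (t, y) \<Rightarrow> f (y + \<beta> t) * k t) \<partial>\<mu>)"
    using k by simp
  show "AE t in lborel. integrable \<mu> (\<lambda>y. case (t, y) of (t, y) \<Rightarrow> f (y + \<beta> t) * k t)"
    using integrable_shift[OF f] by (intro AE_I2) simp
qed

lemma
  assumes f: "integrable \<mu> f" and k: "integrable lborel k"
  shows flow_conv_integrable: "integrable \<mu> (flow_conv f k)"
    and AE_flow_integrable: "AE y in \<mu>. integrable lborel (\<lambda>t. f (y + \<beta> t) * k t)"
proof -
  note P = flow_pair_integrable[OF f k]
  show "integrable \<mu> (flow_conv f k)"
    using TG.integrable_snd[OF P] unfolding flow_conv_def[abs_def] .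
  show "AE y in \<mu>. integrable lborel (\<lambda>t. f (y + \<beta> t) * k t)"
    using TG.AE_integrable_snd[OF P] by simp
qed

lemma flow_conv_pairing:
  assumes f: "integrable \<mu> f" and k: "integrable lborel k"
    and b: "b \<in> borel_measurable borel" "\<And>y. norm (b y) \<le> B"
  shows "(\<integral>y. flow_conv f k y * b y \<partial>\<mu>) = (\<integral>t. k t * (\<integral>y. f (y + \<beta> t) * b y \<partial>\<mu>) \<partial>lborel)"
proof -
  have [measurable]: "b \<in> borel_measurable \<mu>" using b(1) by measurable
  have "integrable (lborel \<Otimes>\<^sub>M \<mu>) (\<lambda>z. (case z of (t, y) \<Rightarrow> f (y + \<beta> t) * k t) * b (snd z))"
    by (rule integrable_mult_bounded[OF flow_pair_integrable[OF f k] _ b(2)]) measurable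
  then have I: "integrable (lborel \<Otimes>\<^sub>M \<mu>) (\<lambda>(t, y). f (y + \<beta> t) * k t * b y)"
    by (simp add: case_prod_beta')
  have "(\<integral>y. flow_conv f k y * b y \<partial>\<mu>) = (\<integral>y. (\<integral>t. f (y + \<beta> t) * k t * b y \<partial>lborel) \<partial>\<mu>)"
    unfolding flow_conv_def by (simp only: integral_mult_left_zero)
  also have "\<dots> = (\<integral>t. (\<integral>y. f (y + \<beta> t) * k t * b y \<partial>\<mu>) \<partial>lborel)"
    by (rule TG.Fubini_integral[OF I])
  also have "\<dots> = (\<integral>t. (\<integral>y. k t * (f (y + \<beta> t) * b y) \<partial>\<mu>) \<partial>lborel)"
    by (simp only: mult_ac)
  also have "\<dots> = (\<integral>t. k t * (\<integral>y. f (y + \<beta> t) * b y \<partial>\<mu>) \<partial>lborel)"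
    by (simp only: integral_mult_right_zero)
  finally show ?thesis .
qed

end

section \<open>Nonzero continuous functions have nonzero Fourier coefficients\<close>

lemma borel_measurable_cnj [measurable]: "cnj \<in> borel_measurable borel"
  by (intro borel_measurable_continuous_onI continuous_intros)

lemma norm_integral_le:
  fixes f :: "'a \<Rightarrow> 'b::{banach,second_countable_topology}"
  assumes "integrable M f" "integrable M g" "\<And>x. norm (f x) \<le> g x"
  shows "norm (\<integral>x. f x \<partial>M) \<le> (\<integral>x. g x \<partial>M)"
  by (rule order_trans[OF integral_norm_bound integral_mono]) (use assms in auto)

context flow_group
begin

text \<open>The flow spends a positive proportion of every long time scale where \<open>\<Psi>\<close> is positive: finitely many
shifts \<open>\<beta> s\<close> of \<open>\<Psi>\<close> have a sum bounded below, and on the time scale \<open>n + 1\<close> a shift by \<open>s\<close> only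
moves the profile \<open>g\<close> by \<open>s / (n + 1)\<close>, which is negligible in \<open>L\<^sub>1\<close>.\<close>

lemma flow_recurrence:
  fixes \<Psi> :: "'g \<Rightarrow> real" and g :: "real \<Rightarrow> real"
  assumes cont: "continuous_on UNIV \<Psi>" and nn: "\<And>y. 0 \<le> \<Psi> y" and pos: "0 < \<Psi> z"
    and g: "continuous_on UNIV g" "\<And>v. 0 \<le> g v" "integrable lborel g" "0 < (\<integral>v. g v \<partial>lborel)"
  obtains c N where "0 < c" "\<And>n. n \<ge> N \<Longrightarrow> c \<le> (\<integral>v. \<Psi> (\<beta> (real (Suc n) * v)) * g v \<partial>lborel)"
proof -
  obtain S c where S: "finite S" "0 < c" "\<And>y. c \<le> (\<Sum>s\<in>S. \<Psi> (y - \<beta> s))"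
    using flow_translates_cover[OF cont nn pos] by metis
  have gm [measurable]: "g \<in> borel_measurable borel" using g(1) by (rule borel_measurable_continuous_onI)
  obtain B where B: "0 < B" "\<And>y. norm (\<Psi> y) \<le> B" using continuous_bounded[OF cont] by blast
  define I where "I = (\<lambda>n. \<integral>v. \<Psi> (\<beta> (real (Suc n) * v)) * g v \<partial>lborel)"
  define w where "w = (\<lambda>n s. \<integral>v. \<bar>g (v + s / real (Suc n)) - g v\<bar> \<partial>lborel)"
  have [measurable]: "(\<lambda>v. \<Psi> (\<beta> (a * v) - b)) \<in> borel_measurable borel" for a b
    by (intro borel_measurable_continuous_onI continuous_on_compose2[OF cont] continuous_intros continuous_on_compose2[OF cont_\<beta>]) auto
  from this[of _ 0] have [measurable]: "(\<lambda>v. \<Psi> (\<beta> (a * v))) \<in> borel_measurable borel" for a by simp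
  have gshift: "integrable lborel (\<lambda>v. g (v + a))" for a
    using lborel_integrable_real_affine[OF g(3), of 1 a] by (simp add: add.commute)
  have bint: "integrable lborel (\<lambda>v. \<Psi> (\<beta> (a * v) - b) * k v)" if "integrable lborel k" for k :: "real \<Rightarrow> real" and a b
    by (rule Bochner_Integration.integrable_bound[OF integrable_mult_right[OF that, of B]])
       (use B nn that in \<open>auto intro!: AE_I2 mult_right_mono simp: abs_mult\<close>)
  have bint0: "integrable lborel (\<lambda>v. \<Psi> (\<beta> (a * v)) * k v)" if "integrable lborel k" for k :: "real \<Rightarrow> real" and a
    using bint[OF that, of a 0] by simp
  (* Shifting \<Psi> by \<beta> s is absorbed by translating the integration variable. *)
  have each: "(\<integral>v. \<Psi> (\<beta> (real (Suc n) * v) - \<beta> s) * g v \<partial>lborel) \<le> I n + B * w n s" for n s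
  proof -
    define a where "a = s / real (Suc n)"
    have *: "\<beta> (real (Suc n) * (a + 1 * v)) - \<beta> s = \<beta> (real (Suc n) * v)" for v
    proof -
      have "real (Suc n) * (a + 1 * v) = s + real (Suc n) * v" by (simp add: a_def field_simps)
      then show ?thesis by (simp only: \<beta>_add) simp
    qed
    have di: "integrable lborel (\<lambda>v. \<bar>g (v + a) - g v\<bar>)"
      using g(3) gshift by (intro integrable_abs Bochner_Integration.integrable_diff)
    have "(\<integral>v. \<Psi> (\<beta> (real (Suc n) * v) - \<beta> s) * g v \<partial>lborel)
        = \<bar>1\<bar> *\<^sub>R (\<integral>v. \<Psi> (\<beta> (real (Suc n) * (a + 1 * v)) - \<beta> s) * g (a + 1 * v) \<partial>lborel)"
      by (rule lborel_integral_real_affine) simp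
    also have "\<dots> = (\<integral>v. \<Psi> (\<beta> (real (Suc n) * v)) * g (v + a) \<partial>lborel)"
      unfolding * by (simp add: add.commute)
    also have "\<dots> \<le> (\<integral>v. \<Psi> (\<beta> (real (Suc n) * v)) * g v + B * \<bar>g (v + a) - g v\<bar> \<partial>lborel)"
    proof (rule integral_mono)
      fix v
      have "\<Psi> (\<beta> (real (Suc n) * v)) * (g (v + a) - g v) \<le> \<Psi> (\<beta> (real (Suc n) * v)) * \<bar>g (v + a) - g v\<bar>"
        by (intro mult_left_mono nn) simp
      also have "\<dots> \<le> B * \<bar>g (v + a) - g v\<bar>"
        using B(2)[of "\<beta> (real (Suc n) * v)"] by (intro mult_right_mono) auto
      finally have "\<Psi> (\<beta> (real (Suc n) * v)) * (g (v + a) - g v) \<le> B * \<bar>g (v + a) - g v\<bar>" .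
      then show "\<Psi> (\<beta> (real (Suc n) * v)) * g (v + a) \<le> \<Psi> (\<beta> (real (Suc n) * v)) * g v + B * \<bar>g (v + a) - g v\<bar>"
        unfolding right_diff_distrib by linarith
    qed (use bint0 gshift g(3) di in \<open>auto intro!: Bochner_Integration.integrable_add\<close>)
    also have "\<dots> = I n + B * w n s"
      using bint0[OF g(3)] di by (simp add: I_def w_def a_def)
    finally show ?thesis .
  qed
  have low: "c * (\<integral>v. g v \<partial>lborel) \<le> card S * I n + B * (\<Sum>s\<in>S. w n s)" for n
  proof -
    have "c * (\<integral>v. g v \<partial>lborel) = (\<integral>v. c * g v \<partial>lborel)" by simp
    also have "\<dots> \<le> (\<integral>v. (\<Sum>s\<in>S. \<Psi> (\<beta> (real (Suc n) * v) - \<beta> s) * g v) \<partial>lborel)"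
    proof (rule integral_mono)
      show "c * g v \<le> (\<Sum>s\<in>S. \<Psi> (\<beta> (real (Suc n) * v) - \<beta> s) * g v)" for v
        unfolding sum_distrib_right[symmetric] by (intro mult_right_mono S(3) g(2))
    qed (intro integrable_mult_right g(3) Bochner_Integration.integrable_sum bint)+
    also have "\<dots> = (\<Sum>s\<in>S. \<integral>v. \<Psi> (\<beta> (real (Suc n) * v) - \<beta> s) * g v \<partial>lborel)"
      by (rule Bochner_Integration.integral_sum) (rule bint[OF g(3)])
    also have "\<dots> \<le> (\<Sum>s\<in>S. I n + B * w n s)" by (intro sum_mono each)
    finally show ?thesis by (simp add: sum.distrib sum_distrib_left)
  qed
  have "(\<lambda>n. B * (\<Sum>s\<in>S. w n s)) \<longlonglongrightarrow> B * (\<Sum>s\<in>S. 0)"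
  proof (intro tendsto_intros tendsto_sum)
    fix s
    have "(\<lambda>n. s / real (Suc n)) \<longlonglongrightarrow> 0" by real_asymp
    from translation_L1_tendsto[OF g(1,3) this] show "(\<lambda>n. w n s) \<longlonglongrightarrow> 0" unfolding w_def .
  qed
  then have "(\<lambda>n. B * (\<Sum>s\<in>S. w n s)) \<longlonglongrightarrow> 0" by simp
  moreover have cg: "0 < c * (\<integral>v. g v \<partial>lborel) / 2" using S(2) g(4) by simp
  ultimately have "\<forall>\<^sub>F n in sequentially. B * (\<Sum>s\<in>S. w n s) < c * (\<integral>v. g v \<partial>lborel) / 2"
    by (rule order_tendstoD(2))
  then obtain N where N: "\<And>n. n \<ge> N \<Longrightarrow> B * (\<Sum>s\<in>S. w n s) < c * (\<integral>v. g v \<partial>lborel) / 2"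
    by (auto simp: eventually_sequentially)
  show ?thesis
  proof (rule that[of "c * (\<integral>v. g v \<partial>lborel) / 2 / (card S + 1)" N])
    show "0 < c * (\<integral>v. g v \<partial>lborel) / 2 / (card S + 1)" using cg by simp
    fix n assume "n \<ge> N"
    have Inn: "0 \<le> I n" unfolding I_def by (intro Bochner_Integration.integral_nonneg mult_nonneg_nonneg nn g(2))
    have "c * (\<integral>v. g v \<partial>lborel) / 2 \<le> card S * I n" using low[of n] N[OF \<open>n \<ge> N\<close>] by linarith
    also have "\<dots> \<le> (card S + 1) * I n" using Inn by (simp add: distrib_right)
    finally have "c * (\<integral>v. g v \<partial>lborel) / 2 / (card S + 1) \<le> I n"
      by (subst pos_divide_le_eq) (simp, simp only: mult.commute)
    then show "c * (\<integral>v. g v \<partial>lborel) / 2 / (card S + 1) \<le> (\<integral>v. \<Psi> (\<beta> (real (Suc n) * v)) * g v \<partial>lborel)"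
      unfolding I_def .
  qed
qed

definition autocorr :: "('g \<Rightarrow> complex) \<Rightarrow> 'g \<Rightarrow> complex" where
  "autocorr f z = (\<integral>y. f (y + z) * cnj (f y) \<partial>\<mu>)"

lemma
  assumes f: "continuous_on UNIV f"
  shows autocorr_continuous: "continuous_on UNIV (autocorr f)"
    and autocorr_0: "autocorr f 0 = of_real (\<integral>y. (norm (f y))\<^sup>2 \<partial>\<mu>)"
proof -
  obtain B where B: "0 < B" "\<And>y. norm (f y) \<le> B" using continuous_bounded[OF f] by blast
  have fm [measurable]: "f \<in> borel_measurable borel" using f by (rule borel_measurable_continuous_onI)
  have int: "integrable \<mu> (\<lambda>y. f (y + z) * cnj (f y))" for z
  proof (rule integrable_bounded)
    show "norm (f (y + z) * cnj (f y)) \<le> B * B" for y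
      using B(2)[of "y + z"] B(2)[of y] less_imp_le[OF B(1)] by (simp add: norm_mult mult_mono)
  qed measurable
  show "continuous_on UNIV (autocorr f)"
  proof (rule continuous_from_modulus)
    fix e :: real assume "0 < e"
    then obtain U where U: "open U" "0 \<in> U" "\<And>y u. u \<in> U \<Longrightarrow> norm (f (y + u) - f y) \<le> e / B"
      using uniform_modulus[OF f, of "e / B"] B(1) by (metis divide_pos_pos)
    have "norm (autocorr f (z + u) - autocorr f z) \<le> e" if u: "u \<in> U" for z u
    proof -
      have "autocorr f (z + u) - autocorr f z = (\<integral>y. f (y + (z + u)) * cnj (f y) - f (y + z) * cnj (f y) \<partial>\<mu>)"
        unfolding autocorr_def by (rule Bochner_Integration.integral_diff[symmetric, OF int int])
      also have "norm \<dots> \<le> (\<integral>y. e \<partial>\<mu>)"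
      proof (rule norm_integral_le)
        show "integrable \<mu> (\<lambda>y. f (y + (z + u)) * cnj (f y) - f (y + z) * cnj (f y))"
          by (rule Bochner_Integration.integrable_diff[OF int int])
        fix y
        have "norm (f (y + (z + u)) * cnj (f y) - f (y + z) * cnj (f y)) = norm (f (y + z + u) - f (y + z)) * norm (f y)"
          by (simp add: norm_mult add.assoc flip: left_diff_distrib)
        also have "\<dots> \<le> (e / B) * B" using U(3)[OF u] B \<open>0 < e\<close> by (intro mult_mono) auto
        finally show "norm (f (y + (z + u)) * cnj (f y) - f (y + z) * cnj (f y)) \<le> e" using B(1) by simp
      qed simp
      also have "\<dots> = e" using prob_space by simp
      finally show ?thesis .
    qed
    then show "\<exists>U. open U \<and> 0 \<in> U \<and> (\<forall>z. \<forall>u\<in>U. norm (autocorr f (z + u) - autocorr f z) \<le> e)"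
      using U(1,2) by blast
  qed
  show "autocorr f 0 = of_real (\<integral>y. (norm (f y))\<^sup>2 \<partial>\<mu>)"
    by (simp add: autocorr_def complex_norm_square[symmetric] integral_complex_of_real del: of_real_power)
qed

lemma integral_gaussian_pos:
  fixes \<epsilon> :: real
  assumes "0 < \<epsilon>"
  shows "0 < (\<integral>\<xi>. exp (- (\<epsilon> * \<xi>)\<^sup>2 / 2) \<partial>lborel)"
proof -
  have "complex_of_real (\<integral>\<xi>. exp (- (\<epsilon> * \<xi>)\<^sup>2 / 2) \<partial>lborel) = of_real (2 * pi / \<epsilon> * std_normal_density (0 / \<epsilon>))"
    using fourier_gaussian[OF assms, of 0] by (simp only: integral_complex_of_real[symmetric]) simp
  then have "(\<integral>\<xi>. exp (- (\<epsilon> * \<xi>)\<^sup>2 / 2) \<partial>lborel) = 2 * pi / \<epsilon> * std_normal_density (0 / \<epsilon>)"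
    unfolding of_real_eq_iff .
  then show ?thesis using assms by (simp add: normal_density_pos)
qed

text \<open>Up to a constant, the Gaussian of width \<open>T\<close> is itself an autocorrelation, of the narrower Gaussian
\<open>q\<close>: \<open>q (r + t) q r = exp (- 2 (r + t / 2)\<^sup>2 / T\<^sup>2) exp (- t\<^sup>2 / (2 T\<^sup>2))\<close>.  Hence the transform is a
positive multiple of the squared \<open>L\<^sub>2\<close> norm of the flow convolution of \<open>f\<close> with \<open>e\<^sup>-\<^sup>i\<^sup>\<xi>\<^sup>s q(s)\<close>.\<close>

lemma autocorr_fourier_nonneg:
  assumes f: "continuous_on UNIV f" and T: "0 < T"
  shows "\<exists>N\<ge>0. fourier (\<lambda>t. autocorr f (\<beta> t) * of_real (exp (- (t / T)\<^sup>2 / 2))) \<xi> = of_real N"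
proof -
  obtain B where B: "0 < B" "\<And>y. norm (f y) \<le> B" using continuous_bounded[OF f] by blast
  have fm [measurable]: "f \<in> borel_measurable borel" using f by (rule borel_measurable_continuous_onI)
  have fi: "integrable \<mu> f" by (rule integrable_bounded[OF fm B(2)])
  define C where "C = (\<lambda>t. autocorr f (\<beta> t))"
  have Cc: "continuous_on UNIV C" unfolding C_def
    by (rule continuous_on_compose2[OF autocorr_continuous[OF f] cont_\<beta>]) auto
  have Cm [measurable]: "C \<in> borel_measurable borel" using Cc by (rule borel_measurable_continuous_onI)
  obtain B' where B': "0 < B'" "\<And>y. norm (autocorr f y) \<le> B'"
    using continuous_bounded[OF autocorr_continuous[OF f]] by blast
  then have CB: "norm (C t) \<le> B'" for t unfolding C_def by simp
  define q where "q = (\<lambda>s. exp (- (sqrt 2 / T * s)\<^sup>2 / 2))"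
  have qi: "integrable lborel q" unfolding q_def using T by (intro integrable_gaussian) simp
  have [measurable]: "q \<in> borel_measurable borel" unfolding q_def by measurable
  have qnn: "0 \<le> q s" for s unfolding q_def by simp
  define p where "p = (\<lambda>s. exp (- \<i> * of_real (\<xi> * s)) * of_real (q s))"
  have [measurable]: "p \<in> borel_measurable borel" unfolding p_def by measurable
  have np: "norm (p s) = q s" for s using qnn by (simp add: p_def norm_mult)
  have pint: "integrable lborel p"
    by (rule Bochner_Integration.integrable_bound[OF qi]) (auto simp: np)
  define a where "a = flow_conv f p"
  have [measurable]: "a \<in> borel_measurable borel"
    unfolding a_def using flow_conv_integrable[OF fi pint] sets_\<mu> by (simp add: borel_measurable_integrable cong: measurable_cong_sets)
  have aB: "norm (a y) \<le> B * (\<integral>s. q s \<partial>lborel)" for y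
  proof -
    have "norm (a y) \<le> (\<integral>s. B * q s \<partial>lborel)"
      unfolding a_def flow_conv_def
    proof (rule Bochner_Integration.integral_norm_bound_integral)
      show "integrable lborel (\<lambda>t. f (y + \<beta> t) * p t)"
        by (subst mult.commute, rule integrable_mult_bounded[OF pint _ B(2)]) measurable
    qed (use qi B np qnn in \<open>auto simp: norm_mult intro!: mult_right_mono\<close>)
    then show ?thesis by simp
  qed
  have "of_real (\<integral>y. (norm (a y))\<^sup>2 \<partial>\<mu>) = (\<integral>y. flow_conv f p y * cnj (a y) \<partial>\<mu>)"
    by (simp add: a_def[symmetric] complex_norm_square[symmetric] integral_complex_of_real del: of_real_power)
  also have "\<dots> = (\<integral>s. p s * (\<integral>y. f (y + \<beta> s) * cnj (a y) \<partial>\<mu>) \<partial>lborel)"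
    by (rule flow_conv_pairing[OF fi pint]) (use aB in auto)
  also have "\<dots> = (\<integral>s. p s * (\<integral>r. cnj (p r) * C (s - r) \<partial>lborel) \<partial>lborel)"
  proof -
    have "(\<integral>y. f (y + \<beta> s) * cnj (a y) \<partial>\<mu>) = (\<integral>r. cnj (p r) * C (s - r) \<partial>lborel)" for s
    proof -
      have inner: "(\<integral>y. f (y + \<beta> s) * cnj (f (y + \<beta> r)) \<partial>\<mu>) = C (s - r)" for r
      proof -
        have m: "(\<lambda>y. f (y + \<beta> (s - r)) * cnj (f y)) \<in> borel_measurable borel" by measurable
        have e: "y + \<beta> r + \<beta> (s - r) = y + \<beta> s" for y by (simp add: \<beta>_diff)
        show ?thesis using integral_shift[OF m, of "\<beta> r"] unfolding e C_def autocorr_def .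
      qed
      have "(\<integral>y. f (y + \<beta> s) * cnj (a y) \<partial>\<mu>) = cnj (\<integral>y. flow_conv f p y * cnj (f (y + \<beta> s)) \<partial>\<mu>)"
        by (simp add: a_def mult.commute flip: Bochner_Integration.integral_cnj)
      also have "\<dots> = cnj (\<integral>r. p r * (\<integral>y. f (y + \<beta> r) * cnj (f (y + \<beta> s)) \<partial>\<mu>) \<partial>lborel)"
        by (subst flow_conv_pairing[OF fi pint, where B=B]) (use B in auto)
      also have "\<dots> = (\<integral>r. cnj (p r) * (\<integral>y. f (y + \<beta> s) * cnj (f (y + \<beta> r)) \<partial>\<mu>) \<partial>lborel)"
        by (simp add: mult.commute flip: Bochner_Integration.integral_cnj)
      also have "\<dots> = (\<integral>r. cnj (p r) * C (s - r) \<partial>lborel)"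
        by (simp only: inner)
      finally show ?thesis .
    qed
    then show ?thesis by simp
  qed
  also have "\<dots> = (\<integral>s. (\<integral>r. p s * cnj (p r) * C (s - r) \<partial>lborel) \<partial>lborel)"
    by (simp only: mult.assoc integral_mult_right_zero)
  also have "\<dots> = (\<integral>r. (\<integral>s. p s * cnj (p r) * C (s - r) \<partial>lborel) \<partial>lborel)"
  proof (rule lborel_pair.Fubini_integral[symmetric])
    show "integrable (lborel \<Otimes>\<^sub>M lborel) (\<lambda>(s, r). p s * cnj (p r) * C (s - r))"
    proof (rule integrable_pair_dominated[OF _ _ _ integrable_mult_right[OF qi, of B'] qi])
      show "norm (case (s, r) of (s, r) \<Rightarrow> p s * cnj (p r) * C (s - r)) \<le> B' * q s * q r" for s r
        using mult_left_mono[OF CB[of "s - r"], of "q s * q r"] qnn by (simp add: norm_mult np mult_ac)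
    qed (auto simp: sigma_finite_lborel)
  qed
  also have "\<dots> = (\<integral>r. (\<integral>t. p (r + t) * cnj (p r) * C t \<partial>lborel) \<partial>lborel)"
  proof -
    have "(\<integral>s. p s * cnj (p r) * C (s - r) \<partial>lborel) = \<bar>1\<bar> *\<^sub>R (\<integral>t. p (r + 1 * t) * cnj (p r) * C ((r + 1 * t) - r) \<partial>lborel)" for r
      by (rule lborel_integral_real_affine) simp
    then show ?thesis by simp
  qed
  also have "\<dots> = (\<integral>t. (\<integral>r. p (r + t) * cnj (p r) * C t \<partial>lborel) \<partial>lborel)"
  proof (rule lborel_pair.Fubini_integral[symmetric, where f="\<lambda>r t. p (r + t) * cnj (p r) * C t"])
    have "integrable (lborel \<Otimes>\<^sub>M lborel) (\<lambda>(r, t). p (r + t) * cnj (p r) * C t)"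
    proof (rule lborel_pair.Fubini_integrable)
      have qsh: "integrable lborel (\<lambda>t. q (r + t))" "(\<integral>t. q (r + t) \<partial>lborel) = (\<integral>t. q t \<partial>lborel)" for r
        using lborel_integrable_real_affine[OF qi, of 1 r] lborel_integral_real_affine[of 1 q r] by simp_all
      have bd: "norm (p (r + t) * cnj (p r) * C t) \<le> q r * B' * q (r + t)" for r t
        using mult_left_mono[OF CB[of t], of "q r * q (r + t)"] qnn by (simp add: norm_mult np mult_ac)
      have ri: "integrable lborel (\<lambda>t. p (r + t) * cnj (p r) * C t)" for r
        by (rule Bochner_Integration.integrable_bound[OF integrable_mult_right[OF qsh(1), of "q r * B'"]])
           (use bd B'(1) qnn in \<open>auto intro!: AE_I2 simp: abs_mult\<close>)
      then show "AE r in lborel. integrable lborel (\<lambda>t. case (r, t) of (r, t) \<Rightarrow> p (r + t) * cnj (p r) * C t)" by simp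
      show "integrable lborel (\<lambda>r. \<integral>t. norm (case (r, t) of (r, t) \<Rightarrow> p (r + t) * cnj (p r) * C t) \<partial>lborel)"
      proof (rule Bochner_Integration.integrable_bound[OF integrable_mult_right[OF qi, of "B' * (\<integral>t. q t \<partial>lborel)"]])
        show "AE r in lborel. norm (\<integral>t. norm (case (r, t) of (r, t) \<Rightarrow> p (r + t) * cnj (p r) * C t) \<partial>lborel) \<le> norm (B' * (\<integral>t. q t \<partial>lborel) * q r)"
        proof (rule AE_I2)
          fix r
          have "(\<integral>t. norm (p (r + t) * cnj (p r) * C t) \<partial>lborel) \<le> (\<integral>t. q r * B' * q (r + t) \<partial>lborel)"
            by (rule integral_mono[OF integrable_norm[OF ri] integrable_mult_right[OF qsh(1)] bd])
          also have "\<dots> = B' * (\<integral>t. q t \<partial>lborel) * q r" by (simp add: qsh(2))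
          finally have *: "(\<integral>t. norm (p (r + t) * cnj (p r) * C t) \<partial>lborel) \<le> B' * (\<integral>t. q t \<partial>lborel) * q r" .
          have "0 \<le> (\<integral>t. norm (p (r + t) * cnj (p r) * C t) \<partial>lborel)"
            by (rule Bochner_Integration.integral_nonneg) simp
          then show "norm (\<integral>t. norm (case (r, t) of (r, t) \<Rightarrow> p (r + t) * cnj (p r) * C t) \<partial>lborel) \<le> norm (B' * (\<integral>t. q t \<partial>lborel) * q r)"
            using * by simp
        qed
      qed measurable
    qed measurable
    then show "integrable (lborel \<Otimes>\<^sub>M lborel) (\<lambda>(r, t). p (r + t) * cnj (p r) * C t)" .
  qed
  also have "\<dots> = (\<integral>t. of_real (\<integral>r. exp (- (2 / T * r)\<^sup>2 / 2) \<partial>lborel) * (C t * of_real (exp (- (t / T)\<^sup>2 / 2)) * exp (- \<i> * of_real (\<xi> * t))) \<partial>lborel)"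
  proof -
    have "(\<integral>r. p (r + t) * cnj (p r) * C t \<partial>lborel)
        = of_real (\<integral>r. exp (- (2 / T * r)\<^sup>2 / 2) \<partial>lborel) * (C t * of_real (exp (- (t / T)\<^sup>2 / 2)) * exp (- \<i> * of_real (\<xi> * t)))" for t
    proof -
      (* The phase depends on the difference t only, and completing the square separates t from r. *)
      have pp: "p (r + t) * cnj (p r) = exp (- \<i> * of_real (\<xi> * t)) * of_real (q (r + t) * q r)" for r
        by (simp add: p_def exp_cnj ring_distribs exp_add exp_minus)
      have qq: "q (r + t) * q r = exp (- (2 / T * (t / 2 + 1 * r))\<^sup>2 / 2) * exp (- (t / T)\<^sup>2 / 2)" for r
        using T unfolding q_def exp_add[symmetric]
        by (simp add: power_mult_distrib power_divide field_simps power2_eq_square)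
      have "(\<integral>r. p (r + t) * cnj (p r) * C t \<partial>lborel)
         = (\<integral>r. (C t * of_real (exp (- (t / T)\<^sup>2 / 2)) * exp (- \<i> * of_real (\<xi> * t))) * of_real (exp (- (2 / T * (t / 2 + 1 * r))\<^sup>2 / 2)) \<partial>lborel)"
        unfolding pp qq by (simp only: of_real_mult mult_ac)
      also have "\<dots> = (C t * of_real (exp (- (t / T)\<^sup>2 / 2)) * exp (- \<i> * of_real (\<xi> * t))) * of_real (\<integral>r. exp (- (2 / T * (t / 2 + 1 * r))\<^sup>2 / 2) \<partial>lborel)"
        by (simp only: integral_mult_right_zero integral_complex_of_real)
      also have "(\<integral>r. exp (- (2 / T * (t / 2 + 1 * r))\<^sup>2 / 2) \<partial>lborel) = (\<integral>r. exp (- (2 / T * r)\<^sup>2 / 2) \<partial>lborel)"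
        using lborel_integral_real_affine[of 1 "\<lambda>r. exp (- (2 / T * r)\<^sup>2 / 2)" "t / 2"] by simp
      finally show ?thesis by (simp only: mult.commute)
    qed
    then show ?thesis by (simp only:)
  qed
  also have "\<dots> = of_real (\<integral>r. exp (- (2 / T * r)\<^sup>2 / 2) \<partial>lborel) * fourier (\<lambda>t. C t * of_real (exp (- (t / T)\<^sup>2 / 2))) \<xi>"
    unfolding fourier_def by (rule integral_mult_right_zero)
  finally have eq: "of_real (\<integral>y. (norm (a y))\<^sup>2 \<partial>\<mu>) = of_real (\<integral>r. exp (- (2 / T * r)\<^sup>2 / 2) \<partial>lborel) * fourier (\<lambda>t. C t * of_real (exp (- (t / T)\<^sup>2 / 2))) \<xi>" .
  have K: "0 < (\<integral>r. exp (- (2 / T * r)\<^sup>2 / 2) \<partial>lborel)" (is "0 < ?K")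
    by (rule integral_gaussian_pos) (use T in simp)
  have "fourier (\<lambda>t. C t * of_real (exp (- (t / T)\<^sup>2 / 2))) \<xi> = of_real ((\<integral>y. (norm (a y))\<^sup>2 \<partial>\<mu>) / ?K)"
    using eq K by (simp add: field_simps)
  moreover have "0 \<le> (\<integral>y. (norm (a y))\<^sup>2 \<partial>\<mu>) / ?K"
    using K by (intro divide_nonneg_pos Bochner_Integration.integral_nonneg) auto
  ultimately show ?thesis unfolding C_def by blast
qed

end

context flow_group
begin

lemma \<beta>_rationals_dense: "closure (\<beta> ` \<rat>) = UNIV"
proof -
  have "range \<beta> = \<beta> ` closure \<rat>" by (simp add: Rats_closure_real)
  also have "\<dots> \<subseteq> closure (\<beta> ` \<rat>)"
    by (rule continuous_image_closure_subset[OF cont_\<beta>]) auto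
  finally have "closure (range \<beta>) \<subseteq> closure (\<beta> ` \<rat>)" by (rule closure_minimal) simp
  then show ?thesis using dense_\<beta> by auto
qed

text \<open>The autocorrelation restricted to the flow and cut off by a Gaussian of width \<open>T\<close> has a
nonnegative transform and, by recurrence, squared \<open>L\<^sub>2\<close> norm at least \<open>c T\<close>, while its value \<open>D\<close> at \<open>0\<close>
does not depend on \<open>T\<close>.  The bound \<open>nonneg_fourier_L2_bound\<close> therefore yields a frequency where the transform exceeds
\<open>c T / (2 D)\<close>; after division by \<open>T\<close> this is the pairing of the Gaussian average with \<open>f\<close>.\<close>

lemma gaussian_average_detects:
  assumes f: "continuous_on UNIV f" and nz: "f z \<noteq> 0"
  obtains c N \<xi> where "0 < c" "\<And>n. n \<ge> N \<Longrightarrow>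
     c \<le> norm (\<integral>y. flow_conv f (\<lambda>t. exp (- \<i> * of_real (\<xi> n * t)) * of_real (exp (- (t / real (Suc n))\<^sup>2 / 2) / real (Suc n))) y * cnj (f y) \<partial>\<mu>)"
proof -
  define C where "C = (\<lambda>t. autocorr f (\<beta> t))"
  have ac: "continuous_on UNIV (autocorr f)" by (rule autocorr_continuous[OF f])
  have Cc: "continuous_on UNIV C" unfolding C_def
    by (rule continuous_on_compose2[OF ac cont_\<beta>]) auto
  have Cm [measurable]: "C \<in> borel_measurable borel" using Cc by (rule borel_measurable_continuous_onI)
  obtain B where B: "0 < B" "\<And>y. norm (autocorr f y) \<le> B" using continuous_bounded[OF ac] by blast
  then have CB: "norm (C t) \<le> B" for t unfolding C_def by simp
  obtain Bf where Bf: "0 < Bf" "\<And>y. norm (f y) \<le> Bf" using continuous_bounded[OF f] by blast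
  have fm [measurable]: "f \<in> borel_measurable borel" using f by (rule borel_measurable_continuous_onI)
  have fi: "integrable \<mu> f" by (rule integrable_bounded[OF fm Bf(2)])
  define D where "D = (\<integral>y. (norm (f y))\<^sup>2 \<partial>\<mu>)"
  have D: "0 < D"
    unfolding D_def by (rule integral_continuous_pos[where z=z]) (use nz in \<open>auto intro!: continuous_intros f\<close>)
  define g where "g = (\<lambda>v::real. exp (- (1 * v)\<^sup>2 / 2))"
  have gi: "integrable lborel g" unfolding g_def by (rule integrable_gaussian) simp
  have gc: "continuous_on UNIV g" unfolding g_def by (intro continuous_intros) simp
  define g2 where "g2 = (\<lambda>v::real. exp (- (sqrt 2 * v)\<^sup>2 / 2))"
  have g2: "g2 v = (g v)\<^sup>2" for v by (simp add: g2_def g_def power2_eq_square flip: exp_add)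
  have g2i: "integrable lborel g2" unfolding g2_def by (rule integrable_gaussian) simp
  have g2c: "continuous_on UNIV g2" unfolding g2_def by (intro continuous_intros) simp
  have [measurable]: "g \<in> borel_measurable borel" "g2 \<in> borel_measurable borel"
    unfolding g_def g2_def by measurable
  have "0 < (norm (autocorr f 0))\<^sup>2" using D by (simp add: autocorr_0[OF f] D_def[symmetric])
  moreover have "continuous_on UNIV (\<lambda>y. (norm (autocorr f y))\<^sup>2)" by (intro continuous_intros ac)
  moreover have "0 < (\<integral>v. g2 v \<partial>lborel)" unfolding g2_def by (rule integral_gaussian_pos) simp
  moreover have "0 \<le> g2 v" for v by (simp add: g2_def)
  ultimately obtain c N where c: "0 < c"
    "\<And>n. n \<ge> N \<Longrightarrow> c \<le> (\<integral>v. (norm (autocorr f (\<beta> (real (Suc n) * v))))\<^sup>2 * g2 v \<partial>lborel)"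
    using flow_recurrence[of "\<lambda>y. (norm (autocorr f y))\<^sup>2" 0 g2, OF _ _ _ g2c _ g2i] by auto
  (* If no frequency were that large, the L2 bound would contradict recurrence. *)
  have ex: "\<exists>\<xi>. c / (2 * D) \<le> norm (\<integral>y. flow_conv f (\<lambda>t. exp (- \<i> * of_real (\<xi> * t)) * of_real (exp (- (t / real (Suc n))\<^sup>2 / 2) / real (Suc n))) y * cnj (f y) \<partial>\<mu>)"
    if n: "n \<ge> N" for n
  proof -
    define T where "T = real (Suc n)"
    have T: "0 < T" by (simp add: T_def)
    define u where "u = (\<lambda>t. C t * of_real (exp (- (t / T)\<^sup>2 / 2)))"
    have eT: "exp (- (t / T)\<^sup>2 / 2) = g (t / T)" for t by (simp add: g_def)
    have giT: "integrable lborel (\<lambda>t. g (t / T))"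
      using lborel_integrable_real_affine[OF gi, of "1 / T" 0] T by simp
    have uc: "continuous_on UNIV u" unfolding u_def using T by (intro continuous_intros Cc) auto
    have ub: "norm (u t) \<le> B" for t
    proof -
      have "norm (C t) * exp (- (t / T)\<^sup>2 / 2) \<le> B * 1" using CB B(1) by (intro mult_mono) auto
      then show ?thesis by (simp add: u_def norm_mult)
    qed
    have ui: "integrable lborel u"
      unfolding u_def eT using integrable_mult_bounded[OF integrable_of_real[OF giT] _ CB] by (subst mult.commute) simp
    have "\<forall>\<xi>. \<exists>N\<ge>0. fourier u \<xi> = of_real N"
      unfolding u_def C_def using autocorr_fourier_nonneg[OF f T] by blast
    then obtain M where M: "\<And>\<xi>. fourier u \<xi> = of_real (M \<xi>)" "\<And>\<xi>. 0 \<le> M \<xi>" by metis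
    have L2: "T * c \<le> (\<integral>t. (norm (u t))\<^sup>2 \<partial>lborel)"
    proof -
      have "(\<integral>t. (norm (u t))\<^sup>2 \<partial>lborel) = \<bar>T\<bar> *\<^sub>R (\<integral>v. (norm (u (0 + T * v)))\<^sup>2 \<partial>lborel)"
        by (rule lborel_integral_real_affine) (use T in simp)
      also have "(\<lambda>v. (norm (u (0 + T * v)))\<^sup>2) = (\<lambda>v. (norm (autocorr f (\<beta> (real (Suc n) * v))))\<^sup>2 * g2 v)"
        using T by (auto simp: u_def C_def eT norm_mult power_mult_distrib g2 T_def g_def)
      finally show ?thesis using c(2)[OF n] T by simp
    qed
    have u0: "norm (u 0) = D" using D by (simp add: u_def C_def autocorr_0[OF f] D_def[symmetric])
    have "\<not> (\<forall>\<xi>. M \<xi> \<le> T * c / (2 * D))"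
    proof
      assume "\<forall>\<xi>. M \<xi> \<le> T * c / (2 * D)"
      then have "(\<integral>t. (norm (u t))\<^sup>2 \<partial>lborel) \<le> T * c / (2 * D) * norm (u 0)"
        by (intro nonneg_fourier_L2_bound[OF uc ub ui M]) blast
      also have "\<dots> = T * c / 2" using D by (simp add: u0)
      also have "\<dots> < T * c" using T c(1) by simp
      finally show False using L2 by simp
    qed
    then obtain \<xi> where \<xi>: "T * c / (2 * D) < M \<xi>" by (auto simp: not_le)
    define k where "k = (\<lambda>t. exp (- \<i> * of_real (\<xi> * t)) * of_real (exp (- (t / T)\<^sup>2 / 2) / T) :: complex)"
    have ki: "integrable lborel k"
      unfolding k_def eT
      using integrable_mult_bounded[OF integrable_of_real[OF integrable_divide[OF giT, of T]], of "\<lambda>t. exp (- \<i> * of_real (\<xi> * t))" 1]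
      by (subst mult.commute) simp
    have "(\<integral>y. flow_conv f k y * cnj (f y) \<partial>\<mu>) = (\<integral>t. k t * C t \<partial>lborel)"
      using flow_conv_pairing[OF fi ki, of "\<lambda>y. cnj (f y)" Bf] Bf by (simp add: C_def autocorr_def)
    also have "\<dots> = (\<integral>t. of_real (1 / T) * (u t * exp (- \<i> * of_real (\<xi> * t))) \<partial>lborel)"
      by (rule Bochner_Integration.integral_cong) (auto simp: k_def u_def)
    also have "\<dots> = of_real (1 / T) * fourier u \<xi>"
      unfolding fourier_def by (rule integral_mult_right_zero)
    also have "\<dots> = of_real (M \<xi> / T)" by (simp add: M(1))
    finally have eq: "(\<integral>y. flow_conv f k y * cnj (f y) \<partial>\<mu>) = of_real (M \<xi> / T)" .
    have "norm (\<integral>y. flow_conv f k y * cnj (f y) \<partial>\<mu>) = M \<xi> / T"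
      unfolding eq norm_of_real using M(2)[of \<xi>] T by simp
    moreover have "c / (2 * D) \<le> M \<xi> / T" using \<xi> T D by (simp add: field_simps)
    ultimately have "c / (2 * D) \<le> norm (\<integral>y. flow_conv f k y * cnj (f y) \<partial>\<mu>)" by simp
    then show ?thesis unfolding k_def T_def by (rule exI)
  qed
  have "\<forall>n. \<exists>\<xi>. n \<ge> N \<longrightarrow> c / (2 * D) \<le> norm (\<integral>y. flow_conv f (\<lambda>t. exp (- \<i> * of_real (\<xi> * t)) * of_real (exp (- (t / real (Suc n))\<^sup>2 / 2) / real (Suc n))) y * cnj (f y) \<partial>\<mu>)"
    using ex by blast
  from choice[OF this] obtain \<xi> where "\<And>n. n \<ge> N \<Longrightarrow> c / (2 * D) \<le> norm (\<integral>y. flow_conv f (\<lambda>t. exp (- \<i> * of_real (\<xi> n * t)) * of_real (exp (- (t / real (Suc n))\<^sup>2 / 2) / real (Suc n))) y * cnj (f y) \<partial>\<mu>)"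
    by blast
  with that[of "c / (2 * D)" N \<xi>] c(1) D show ?thesis by (simp only: divide_pos_pos mult_pos_pos zero_less_numeral)
qed

text \<open>The Gaussian averages \<open>F n\<close> at the detected frequencies \<open>\<xi> n\<close> are uniformly bounded and inherit the
modulus of continuity of \<open>f\<close>, so a subsequence that converges on the countable dense set \<open>\<beta> ` \<rat>\<close>
converges everywhere to a continuous \<open>L\<close>.  Moving by \<open>\<beta> s\<close> multiplies \<open>F n\<close> by \<open>e\<^sup>i\<^sup>\<xi>\<^sup>s\<close> up to an
error that vanishes as the time scale grows.  In the limit, \<open>L\<close> is a multiple of a character, and
the lower bound on the pairing with \<open>f\<close> survives.\<close>

lemma continuous_nonzero_fourier_coeff:
  assumes f: "continuous_on UNIV f" and nz: "f z \<noteq> 0"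
  shows "\<exists>h\<in>characters. fourier_coeff \<mu> f h \<noteq> 0"
proof -
  obtain Bf where Bf: "0 < Bf" "\<And>y. norm (f y) \<le> Bf" using continuous_bounded[OF f] by blast
  have fm [measurable]: "f \<in> borel_measurable borel" using f by (rule borel_measurable_continuous_onI)
  have fi: "integrable \<mu> f" by (rule integrable_bounded[OF fm Bf(2)])
  define k where "k = (\<lambda>\<xi> n t. exp (- \<i> * of_real (\<xi> * t)) * of_real (exp (- (t / real (Suc n))\<^sup>2 / 2) / real (Suc n)) :: complex)"
  obtain c N \<xi> where c: "0 < c" "\<And>n. n \<ge> N \<Longrightarrow> c \<le> norm (\<integral>y. flow_conv f (k (\<xi> n) n) y * cnj (f y) \<partial>\<mu>)"
  proof (rule gaussian_average_detects[OF f nz])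
    fix c N \<xi>
    assume "0 < c" "\<And>n. n \<ge> N \<Longrightarrow> c \<le> norm (\<integral>y. flow_conv f (\<lambda>t. exp (- \<i> * of_real (\<xi> n * t)) * of_real (exp (- (t / real (Suc n))\<^sup>2 / 2) / real (Suc n))) y * cnj (f y) \<partial>\<mu>)"
    then show thesis by (intro that[of c N \<xi>]) (simp_all only: k_def)
  qed
  define F where "F = (\<lambda>n. flow_conv f (k (\<xi> n) n))"
  define g where "g = (\<lambda>v::real. exp (- (1 * v)\<^sup>2 / 2))"
  have gi: "integrable lborel g" unfolding g_def by (rule integrable_gaussian) simp
  have gc: "continuous_on UNIV g" unfolding g_def by (intro continuous_intros) simp
  have gm [measurable]: "g \<in> borel_measurable borel" unfolding g_def by measurable
  have gnn: "0 \<le> g v" for v by (simp add: g_def)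
  define A where "A = (\<integral>v. g v \<partial>lborel)"
  have Ann: "0 \<le> A" unfolding A_def by (rule Bochner_Integration.integral_nonneg) (rule gnn)
  have kg: "k x n t = exp (- \<i> * of_real (x * t)) * of_real (g (t / real (Suc n)) / real (Suc n))" for x n t
    by (simp add: k_def g_def)
  have [measurable]: "k x n \<in> borel_measurable borel" for x n unfolding k_def by measurable
  have nk: "norm (k x n t) = g (t / real (Suc n)) / real (Suc n)" for x n t
    unfolding kg norm_mult norm_of_real norm_exp_ii using gnn[of "t / real (Suc n)"] by simp
  have giT: "integrable lborel (\<lambda>t. g (t / real (Suc n)) / real (Suc n))" for n
    using lborel_integrable_real_affine[OF gi, of "1 / real (Suc n)" 0] by simp
  have ki: "integrable lborel (k x n)" for x n
    by (rule Bochner_Integration.integrable_bound[OF giT[of n]]) (measurable, intro AE_I2, simp add: nk divide_right_mono)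
  have giA: "(\<integral>t. g (t / real (Suc n)) / real (Suc n) \<partial>lborel) = A" for n
  proof -
    have "(\<integral>t. g (t / real (Suc n)) / real (Suc n) \<partial>lborel)
        = \<bar>real (Suc n)\<bar> *\<^sub>R (\<integral>v. g ((0 + real (Suc n) * v) / real (Suc n)) / real (Suc n) \<partial>lborel)"
      by (rule lborel_integral_real_affine) simp
    also have "\<dots> = A" by (simp add: A_def del: of_nat_Suc)
    finally show ?thesis .
  qed
  have fk: "integrable lborel (\<lambda>t. f (y + \<beta> t) * k x n t)" for y x n
    by (subst mult.commute, rule integrable_mult_bounded[OF ki _ Bf(2)]) measurable
  have FB: "norm (F n y) \<le> Bf * A" for n y
  proof -
    have "norm (F n y) \<le> (\<integral>t. Bf * (g (t / real (Suc n)) / real (Suc n)) \<partial>lborel)"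
      unfolding F_def flow_conv_def
    proof (rule norm_integral_le[OF fk integrable_mult_right[OF giT]])
      show "norm (f (y + \<beta> t) * k (\<xi> n) n t) \<le> Bf * (g (t / real (Suc n)) / real (Suc n))" for t
        unfolding norm_mult nk using gnn by (intro mult_right_mono Bf) simp
    qed
    also have "\<dots> = Bf * A" by (simp only: integral_mult_right_zero giA)
    finally show ?thesis .
  qed
  have FU: "norm (F n (y + u) - F n y) \<le> e * A" if U: "\<And>y. norm (f (y + u) - f y) \<le> e" for n y u e
  proof -
    have "F n (y + u) - F n y = (\<integral>t. f (y + u + \<beta> t) * k (\<xi> n) n t - f (y + \<beta> t) * k (\<xi> n) n t \<partial>lborel)"
      unfolding F_def flow_conv_def by (rule Bochner_Integration.integral_diff[symmetric, OF fk fk])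
    also have "norm \<dots> \<le> (\<integral>t. e * (g (t / real (Suc n)) / real (Suc n)) \<partial>lborel)"
    proof (rule norm_integral_le[OF Bochner_Integration.integrable_diff[OF fk fk] integrable_mult_right[OF giT]])
      fix t
      have "norm (f (y + u + \<beta> t) - f (y + \<beta> t)) \<le> e" using U[of "y + \<beta> t"] by (simp add: ac_simps)
      then show "norm (f (y + u + \<beta> t) * k (\<xi> n) n t - f (y + \<beta> t) * k (\<xi> n) n t) \<le> e * (g (t / real (Suc n)) / real (Suc n))"
        unfolding left_diff_distrib[symmetric] norm_mult nk using gnn by (intro mult_right_mono) simp_all
    qed
    also have "\<dots> = e * A" by (simp only: integral_mult_right_zero giA)
    finally show ?thesis .
  qed
  (* Up to the phase, moving by \<beta> s only translates the Gaussian, by a vanishing part of its width. *)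
  have Fshift: "(\<lambda>n. F n (y + \<beta> s) - exp (\<i> * of_real (\<xi> n * s)) * F n y) \<longlonglongrightarrow> 0" for y s
  proof (rule Lim_null_comparison)
    have "(\<lambda>n. - s / real (Suc n)) \<longlonglongrightarrow> 0" by real_asymp
    from tendsto_mult_right_zero[OF translation_L1_tendsto[OF gc gi this], of Bf]
    show "(\<lambda>n. Bf * (\<integral>v. \<bar>g (v + - s / real (Suc n)) - g v\<bar> \<partial>lborel)) \<longlonglongrightarrow> 0" .
    have "norm (F n (y + \<beta> s) - exp (\<i> * of_real (\<xi> n * s)) * F n y) \<le> Bf * (\<integral>v. \<bar>g (v + - s / real (Suc n)) - g v\<bar> \<partial>lborel)" for n
    proof -
      define T where "T = real (Suc n)"
      have T: "0 < T" by (simp add: T_def)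
      define E where "E = (\<lambda>t. exp (- \<i> * of_real (\<xi> n * t)) :: complex)"
      have kT: "k (\<xi> n) n t = E t * of_real (g (t / T) / T)" for t by (simp add: kg E_def T_def)
      have [measurable]: "E \<in> borel_measurable borel" unfolding E_def by measurable
      have nE: "norm (E t) = 1" for t unfolding E_def by simp
      have Es: "E (t - s) = exp (\<i> * of_real (\<xi> n * s)) * E t" for t
        by (simp add: E_def right_diff_distrib flip: exp_add)
      have ns: "norm (exp (\<i> * complex_of_real (\<xi> n * s))) = 1" by simp
      have giTs: "integrable lborel (\<lambda>t. g ((t - s) / T) / T)"
        using lborel_integrable_real_affine[OF gi, of "1 / T" "- s / T"] T by (simp add: diff_divide_distrib add.commute)
      have giT0: "integrable lborel (\<lambda>t. g (t / T) / T)" using giT[of n] by (simp add: T_def)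
      have "F n (y + \<beta> s) = \<bar>1\<bar> *\<^sub>R (\<integral>t. f (y + \<beta> s + \<beta> (- s + 1 * t)) * k (\<xi> n) n (- s + 1 * t) \<partial>lborel)"
        unfolding F_def flow_conv_def by (rule lborel_integral_real_affine) simp
      also have "\<dots> = (\<integral>t. exp (\<i> * of_real (\<xi> n * s)) * (f (y + \<beta> t) * E t * of_real (g ((t - s) / T) / T)) \<partial>lborel)"
        unfolding kT by (simp add: \<beta>_add \<beta>_minus \<beta>_diff Es mult_ac)
      also have "\<dots> = exp (\<i> * of_real (\<xi> n * s)) * (\<integral>t. f (y + \<beta> t) * E t * of_real (g ((t - s) / T) / T) \<partial>lborel)"
        by (rule integral_mult_right_zero)
      finally have 1: "F n (y + \<beta> s) = exp (\<i> * of_real (\<xi> n * s)) * (\<integral>t. f (y + \<beta> t) * E t * of_real (g ((t - s) / T) / T) \<partial>lborel)" .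
      have 2: "F n y = (\<integral>t. f (y + \<beta> t) * E t * of_real (g (t / T) / T) \<partial>lborel)"
        unfolding F_def flow_conv_def kT by (simp only: mult_ac)
      have b: "norm (f (y + \<beta> t) * E t) \<le> Bf" for t using Bf by (simp add: norm_mult nE)
      have int: "integrable lborel (\<lambda>t. f (y + \<beta> t) * E t * of_real (h t))" if "integrable lborel h" for h :: "real \<Rightarrow> real"
        by (subst mult.commute, rule integrable_mult_bounded[OF integrable_of_real[OF that] _ b]) measurable
      have "norm (F n (y + \<beta> s) - exp (\<i> * of_real (\<xi> n * s)) * F n y)
         = norm ((\<integral>t. f (y + \<beta> t) * E t * of_real (g ((t - s) / T) / T) \<partial>lborel) - (\<integral>t. f (y + \<beta> t) * E t * of_real (g (t / T) / T) \<partial>lborel))"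
        unfolding 1 2 right_diff_distrib[symmetric] norm_mult ns by simp
      also have "\<dots> = norm (\<integral>t. f (y + \<beta> t) * E t * of_real (g ((t - s) / T) / T) - f (y + \<beta> t) * E t * of_real (g (t / T) / T) \<partial>lborel)"
        by (subst Bochner_Integration.integral_diff[OF int[OF giTs] int[OF giT0]]) (rule refl)
      also have "\<dots> \<le> (\<integral>t. Bf * \<bar>g ((t - s) / T) / T - g (t / T) / T\<bar> \<partial>lborel)"
      proof (rule norm_integral_le[OF Bochner_Integration.integrable_diff[OF int[OF giTs] int[OF giT0]]])
        show "integrable lborel (\<lambda>t. Bf * \<bar>g ((t - s) / T) / T - g (t / T) / T\<bar>)"
          by (intro integrable_mult_right integrable_abs Bochner_Integration.integrable_diff giTs giT0)
        fix t
        have "norm (f (y + \<beta> t) * E t * of_real (g ((t - s) / T) / T) - f (y + \<beta> t) * E t * of_real (g (t / T) / T))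
           = norm (f (y + \<beta> t) * E t) * \<bar>g ((t - s) / T) / T - g (t / T) / T\<bar>"
          unfolding right_diff_distrib[symmetric] of_real_diff[symmetric] norm_mult norm_of_real ..
        also have "\<dots> \<le> Bf * \<bar>g ((t - s) / T) / T - g (t / T) / T\<bar>" by (intro mult_right_mono b) simp
        finally show "norm (f (y + \<beta> t) * E t * of_real (g ((t - s) / T) / T) - f (y + \<beta> t) * E t * of_real (g (t / T) / T))
           \<le> Bf * \<bar>g ((t - s) / T) / T - g (t / T) / T\<bar>" .
      qed
      also have "\<dots> = Bf * (\<integral>t. \<bar>g ((t - s) / T) / T - g (t / T) / T\<bar> \<partial>lborel)"
        by (rule integral_mult_right_zero)
      also have "(\<integral>t. \<bar>g ((t - s) / T) / T - g (t / T) / T\<bar> \<partial>lborel)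
          = \<bar>T\<bar> *\<^sub>R (\<integral>v. \<bar>g (((0 + T * v) - s) / T) / T - g ((0 + T * v) / T) / T\<bar> \<partial>lborel)"
        by (rule lborel_integral_real_affine) (use T in simp)
      also have "\<dots> = (\<integral>v. \<bar>g (v + - s / real (Suc n)) - g v\<bar> \<partial>lborel)"
      proof -
        have "\<bar>g (((0 + T * v) - s) / T) / T - g ((0 + T * v) / T) / T\<bar> = 1 / T * \<bar>g (v + - s / T) - g v\<bar>" for v
        proof -
          have "((0 + T * v) - s) / T = v + - s / T" "(0 + T * v) / T = v" using T by (simp_all add: field_simps)
          then have "g (((0 + T * v) - s) / T) / T - g ((0 + T * v) / T) / T = 1 / T * (g (v + - s / T) - g v)"
            by (simp only: right_diff_distrib) simp
          then show ?thesis using T by (simp only: abs_mult) simp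
        qed
        then show ?thesis using T by (simp add: T_def)
      qed
      finally show ?thesis .
    qed
    then show "\<forall>\<^sub>F n in sequentially. norm (F n (y + \<beta> s) - exp (\<i> * of_real (\<xi> n * s)) * F n y) \<le> Bf * (\<integral>v. \<bar>g (v + - s / real (Suc n)) - g v\<bar> \<partial>lborel)"
      by (intro always_eventually allI)
  qed
  obtain r :: "nat \<Rightarrow> nat" where r: "strict_mono r" "\<And>y. y \<in> \<beta> ` \<rat> \<Longrightarrow> \<exists>l. (\<lambda>n. F (r n) y) \<longlonglongrightarrow> l"
    by (rule function_convergent_subsequence[of "\<beta> ` \<rat>" F "Bf * A", OF countable_image[OF countable_rat] FB]) (rule that)
  have conv: "convergent (\<lambda>n. F (r n) y)" for y
  proof -
    have "Cauchy (\<lambda>n. F (r n) y)"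
    proof (rule metric_CauchyI)
      fix e :: real assume e: "0 < e"
      define d where "d = e / (3 * (A + 1))"
      have d: "0 < d" using e Ann by (simp add: d_def)
      have dA: "d * A < e / 3" using e Ann by (simp add: d_def field_simps)
      obtain U where U: "open U" "0 \<in> U" "\<And>y u. u \<in> U \<Longrightarrow> norm (f (y + u) - f y) \<le> d"
        using uniform_modulus[OF f d] by metis
      have "open ((\<lambda>z. z - y) -` U)" using U(1) by (intro open_vimage continuous_intros) auto
      moreover have "y \<in> (\<lambda>z. z - y) -` U" using U(2) by simp
      ultimately have "(\<lambda>z. z - y) -` U \<inter> \<beta> ` \<rat> \<noteq> {}"
        using \<beta>_rationals_dense open_Int_closure_eq_empty by (metis disjoint_iff UNIV_I)
      then obtain z where z: "z \<in> \<beta> ` \<rat>" "z - y \<in> U" by auto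
      have near: "norm (F n z - F n y) < e / 3" for n
        using FU[of "z - y" d n y] U(3)[OF z(2)] dA by auto
      obtain l where "(\<lambda>n. F (r n) z) \<longlonglongrightarrow> l" using r(2)[OF z(1)] by blast
      then have "Cauchy (\<lambda>n. F (r n) z)" by (rule LIMSEQ_imp_Cauchy)
      then obtain M where M: "\<And>m n. m \<ge> M \<Longrightarrow> n \<ge> M \<Longrightarrow> dist (F (r m) z) (F (r n) z) < e / 3"
        using metric_CauchyD[of "\<lambda>n. F (r n) z" "e / 3"] e by auto
      show "\<exists>M. \<forall>m\<ge>M. \<forall>n\<ge>M. dist (F (r m) y) (F (r n) y) < e"
      proof (intro exI allI impI)
        fix m n assume "M \<le> m" "M \<le> n"
        then have "norm (F (r m) z - F (r n) z) < e / 3" using M by (simp add: dist_norm)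
        moreover have "F (r m) y - F (r n) y = (F (r m) z - F (r n) z) - (F (r m) z - F (r m) y) + (F (r n) z - F (r n) y)" by simp
        ultimately have "norm (F (r m) y - F (r n) y) < e / 3 + e / 3 + e / 3"
          using near[of "r m"] near[of "r n"]
          by (smt (verit) norm_triangle_ineq norm_triangle_ineq4)
        then show "dist (F (r m) y) (F (r n) y) < e" by (simp add: dist_norm)
      qed
    qed
    then show ?thesis by (rule Cauchy_convergent)
  qed
  define L where "L = (\<lambda>y. lim (\<lambda>n. F (r n) y))"
  have L: "(\<lambda>n. F (r n) y) \<longlonglongrightarrow> L y" for y
    using conv[of y] unfolding L_def by (simp add: convergent_LIMSEQ_iff)
  have Lc: "continuous_on UNIV L"
  proof (rule continuous_from_modulus)
    fix e :: real assume e: "0 < e"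
    define d where "d = e / (A + 1)"
    have d: "0 < d" using e Ann by (simp add: d_def)
    have dA: "d * A \<le> e" using e Ann by (simp add: d_def field_simps)
    obtain U where U: "open U" "0 \<in> U" "\<And>y u. u \<in> U \<Longrightarrow> norm (f (y + u) - f y) \<le> d"
      using uniform_modulus[OF f d] by metis
    have "norm (L (y + u) - L y) \<le> e" if "u \<in> U" for y u
    proof (rule tendsto_upperbound)
      show "(\<lambda>n. norm (F (r n) (y + u) - F (r n) y)) \<longlonglongrightarrow> norm (L (y + u) - L y)" by (intro tendsto_intros L)
      show "\<forall>\<^sub>F n in sequentially. norm (F (r n) (y + u) - F (r n) y) \<le> e"
        using FU[OF U(3)[OF that]] dA by (intro always_eventually allI) (meson order_trans)
    qed simp
    then show "\<exists>U. open U \<and> 0 \<in> U \<and> (\<forall>y. \<forall>u\<in>U. norm (L (y + u) - L y) \<le> e)"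
      using U(1,2) by blast
  qed
  have LB: "norm (L y) \<le> Bf * A" for y
    by (rule tendsto_upperbound[OF tendsto_norm[OF L]]) (use FB in auto)
  have Fm: "F n \<in> borel_measurable \<mu>" for n unfolding F_def using flow_conv_integrable[OF fi ki] by (rule borel_measurable_integrable)
  have Lm [measurable]: "L \<in> borel_measurable borel" using Lc by (rule borel_measurable_continuous_onI)
  have "(\<lambda>n. \<integral>y. F (r n) y * cnj (f y) \<partial>\<mu>) \<longlonglongrightarrow> (\<integral>y. L y * cnj (f y) \<partial>\<mu>)"
  proof (rule integral_dominated_convergence[where w="\<lambda>_. Bf * A * Bf"])
    show "AE y in \<mu>. (\<lambda>n. F (r n) y * cnj (f y)) \<longlonglongrightarrow> L y * cnj (f y)" by (intro AE_I2 tendsto_intros L)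
    show "AE y in \<mu>. norm (F (r n) y * cnj (f y)) \<le> Bf * A * Bf" for n
      unfolding norm_mult complex_mod_cnj using Ann Bf(1) by (intro AE_I2 mult_mono FB Bf(2)) auto
    show "(\<lambda>y. F (r n) y * cnj (f y)) \<in> borel_measurable \<mu>" for n using Fm[of "r n"] by measurable
  qed (auto)
  then have "c \<le> norm (\<integral>y. L y * cnj (f y) \<partial>\<mu>)"
  proof (intro tendsto_lowerbound[OF tendsto_norm])
    show "\<forall>\<^sub>F n in sequentially. c \<le> norm (\<integral>y. F (r n) y * cnj (f y) \<partial>\<mu>)"
      using c(2) seq_suble[OF r(1)] unfolding F_def eventually_sequentially by (meson order_trans)
  qed simp_all
  then have Lf: "(\<integral>y. L y * cnj (f y) \<partial>\<mu>) \<noteq> 0" using c(1) by auto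
  then obtain y0 where y0: "L y0 \<noteq> 0" by (metis (no_types, lifting) Bochner_Integration.integral_cong integral_zero mult_zero_left)
  (* On the orbit h is a limit of the phases, so it is unimodular there and, by density, everywhere. *)
  define h where "h = (\<lambda>z. L (y0 + z) / L y0)"
  have hc: "continuous_on UNIV h"
    unfolding h_def using y0 by (intro continuous_intros continuous_on_compose2[OF Lc]) auto
  have e_lim: "(\<lambda>n. exp (\<i> * of_real (\<xi> (r n) * s))) \<longlonglongrightarrow> h (\<beta> s)" for s
  proof -
    have "(\<lambda>n. F (r n) (y0 + \<beta> s) - exp (\<i> * of_real (\<xi> (r n) * s)) * F (r n) y0) \<longlonglongrightarrow> 0"
      using LIMSEQ_subseq_LIMSEQ[OF Fshift r(1)] by (simp add: o_def)
    from tendsto_diff[OF L[of "y0 + \<beta> s"] this]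
    have "(\<lambda>n. exp (\<i> * of_real (\<xi> (r n) * s)) * F (r n) y0) \<longlonglongrightarrow> L (y0 + \<beta> s)" by simp
    from tendsto_divide[OF this L[of y0] y0]
    have lim: "(\<lambda>n. exp (\<i> * of_real (\<xi> (r n) * s)) * F (r n) y0 / F (r n) y0) \<longlonglongrightarrow> h (\<beta> s)" unfolding h_def .
    have ne: "\<forall>\<^sub>F n in sequentially. F (r n) y0 \<noteq> 0"
      using tendsto_imp_eventually_ne[OF L y0] .
    show ?thesis
      by (rule Lim_transform_eventually[OF lim]) (use ne in \<open>auto elim!: eventually_mono\<close>)
  qed
  have shift: "L (y + \<beta> s) = h (\<beta> s) * L y" for y s
  proof -
    have lim0: "(\<lambda>n. F (r n) (y + \<beta> s) - exp (\<i> * of_real (\<xi> (r n) * s)) * F (r n) y) \<longlonglongrightarrow> 0"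
      using LIMSEQ_subseq_LIMSEQ[OF Fshift r(1)] by (simp add: o_def)
    have lim1: "(\<lambda>n. F (r n) (y + \<beta> s) - exp (\<i> * of_real (\<xi> (r n) * s)) * F (r n) y) \<longlonglongrightarrow> L (y + \<beta> s) - h (\<beta> s) * L y"
      by (intro tendsto_diff tendsto_mult L e_lim)
    show ?thesis using LIMSEQ_unique[OF lim1 lim0] by simp
  qed
  have dense_eq: "P z = Q z" if "continuous_on UNIV P" "continuous_on UNIV Q" "\<And>s. P (\<beta> s) = Q (\<beta> s)" for P Q :: "'g \<Rightarrow> complex" and z
  proof -
    have "closed {x. P x = Q x}" using that(1,2) by (intro closed_Collect_eq) auto
    then have "closure (range \<beta>) \<subseteq> {x. P x = Q x}" using that(3) by (intro closure_minimal) auto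
    then show ?thesis using dense_\<beta> by auto
  qed
  have mult: "L (y + z) = h z * L y" for y z
  proof (rule dense_eq[of "\<lambda>z. L (y + z)" "\<lambda>z. h z * L y"])
    show "continuous_on UNIV (\<lambda>z. L (y + z))"
      by (rule continuous_on_compose2[OF Lc]) (auto intro: continuous_intros)
    show "continuous_on UNIV (\<lambda>z. h z * L y)" by (intro continuous_on_mult hc continuous_on_const)
  qed (rule shift)
  have norm_h\<beta>: "norm (h (\<beta> s)) = 1" for s
  proof -
    have "(\<lambda>n. 1) \<longlonglongrightarrow> norm (h (\<beta> s))"
      using tendsto_norm[OF e_lim[of s]] by (simp only: norm_exp_ii)
    then show ?thesis by (rule LIMSEQ_unique[OF _ tendsto_const])
  qed
  have norm1: "norm (h z) = 1" for z
  proof -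
    have "complex_of_real (norm (h z)) = of_real 1"
    proof (rule dense_eq[of "\<lambda>z. of_real (norm (h z))" "\<lambda>_. of_real 1"])
      show "continuous_on UNIV (\<lambda>z. complex_of_real (norm (h z)))"
        by (rule continuous_on_of_real[OF continuous_on_norm[OF hc]])
    qed (simp_all only: norm_h\<beta> continuous_on_const)
    then show ?thesis unfolding of_real_eq_iff .
  qed
  have "h (x + z) = h x * h z" for x z
  proof -
    have "L (y0 + (x + z)) = h z * L (y0 + x)" using mult[of "y0 + x" z] by (simp only: add.assoc)
    then show ?thesis by (simp add: h_def)
  qed
  then have hch: "h \<in> characters" unfolding characters_def using hc norm1 by auto
  have L0: "L z = h z * L 0" for z using mult[of 0 z] by simp
  have "L y * cnj (f y) = L 0 * cnj (f y * cnj (h y))" for y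
    by (subst L0[of y]) (simp only: complex_cnj_mult complex_cnj_cnj mult_ac)
  then have "(\<integral>y. L y * cnj (f y) \<partial>\<mu>) = (\<integral>y. L 0 * cnj (f y * cnj (h y)) \<partial>\<mu>)"
    by (simp only:)
  also have "\<dots> = L 0 * cnj (fourier_coeff \<mu> f h)"
    by (simp only: integral_mult_right_zero Bochner_Integration.integral_cnj fourier_coeff_def)
  finally have "fourier_coeff \<mu> f h \<noteq> 0" using Lf by auto
  then show ?thesis using hch by blast
qed

end

section \<open>Uniqueness of Fourier coefficients\<close>

text \<open>The linear span of the characters; the inductive form provides the induction principle along
which integrals against \<open>f\<close> are computed.\<close>

inductive trig_sum :: "('g::{t2_space,topological_ab_group_add} \<Rightarrow> complex) \<Rightarrow> bool" where
  trig_zero: "trig_sum (\<lambda>_. 0)"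
| trig_step: "trig_sum F \<Longrightarrow> h \<in> characters \<Longrightarrow> trig_sum (\<lambda>x. F x + c * h x)"

lemma characters_const: "(\<lambda>_. 1) \<in> characters"
  by (simp add: characters_def continuous_on_const)

lemma characters_mult: "h \<in> characters \<Longrightarrow> g \<in> characters \<Longrightarrow> (\<lambda>x. h x * g x) \<in> characters"
  by (auto simp: characters_def norm_mult mult_ac intro!: continuous_intros)

lemma characters_cnj: "h \<in> characters \<Longrightarrow> (\<lambda>x. cnj (h x)) \<in> characters"
  by (auto simp: characters_def intro!: continuous_intros)

lemma characters_cnj_mult: "h \<in> characters \<Longrightarrow> h x * cnj (h x) = 1"
  by (auto simp: characters_def complex_norm_square[symmetric])

lemma trig_sum_char: "h \<in> characters \<Longrightarrow> trig_sum (\<lambda>x. c * h x)"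
  using trig_step[OF trig_zero, of h c] by simp

lemma trig_sum_add: "trig_sum G \<Longrightarrow> trig_sum F \<Longrightarrow> trig_sum (\<lambda>x. F x + G x)"
proof (induction rule: trig_sum.induct)
  case (trig_step G h c)
  then show ?case using trig_sum.trig_step[of "\<lambda>x. F x + G x" h c] by (simp add: add.assoc)
qed simp

lemma trig_sum_char_mult: "trig_sum F \<Longrightarrow> h \<in> characters \<Longrightarrow> trig_sum (\<lambda>x. c * h x * F x)"
proof (induction rule: trig_sum.induct)
  case (trig_step F g d)
  then show ?case
    using trig_sum.trig_step[of "\<lambda>x. c * h x * F x" "\<lambda>x. h x * g x" "c * d"]
    by (simp add: characters_mult algebra_simps)
qed (simp add: trig_zero)

lemma trig_sum_mult: "trig_sum G \<Longrightarrow> trig_sum F \<Longrightarrow> trig_sum (\<lambda>x. F x * G x)"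
proof (induction rule: trig_sum.induct)
  case (trig_step G h c)
  then have "trig_sum (\<lambda>x. F x * G x + c * h x * F x)" by (intro trig_sum_add trig_sum_char_mult) auto
  then show ?case by (simp add: algebra_simps)
qed (simp add: trig_zero)

lemma trig_sum_continuous: "trig_sum F \<Longrightarrow> continuous_on UNIV F"
  by (induction rule: trig_sum.induct) (auto simp: characters_def intro!: continuous_intros)

lemma Hausdorff_euclidean_t2: "Hausdorff_space (euclidean :: 'a::t2_space topology)"
  unfolding Hausdorff_space_def disjnt_def using hausdorff by auto

context flow_group
begin

lemma urysohn_function:
  assumes K: "closed K" and U: "open U" and KU: "K \<subseteq> U"
  obtains g :: "'g \<Rightarrow> real" where "continuous_on UNIV g" "\<And>x. 0 \<le> g x" "\<And>x. g x \<le> 1"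
    "\<And>x. x \<in> K \<Longrightarrow> g x = 1" "\<And>x. x \<notin> U \<Longrightarrow> g x = 0"
proof -
  have "compact_space (euclidean :: 'g topology)"
    using compact_G by (simp add: compact_space_def)
  then have "normal_space (euclidean :: 'g topology)"
    by (rule compact_Hausdorff_or_regular_imp_normal_space) (simp add: Hausdorff_euclidean_t2)
  then obtain g where g: "continuous_map euclidean (top_of_set {0..1::real}) g" "g ` (- U) \<subseteq> {0}" "g ` K \<subseteq> {1}"
    using Urysohn_lemma[of euclidean "- U" K 0 1] K U KU by (auto simp: disjnt_def)
  then have "continuous_on UNIV g" "\<And>x. g x \<in> {0..1}"
    by (auto simp: continuous_map_in_subtopology)
  then show ?thesis using g(2,3) by (intro that[of g]) auto
qed

lemma character_measurable: "h \<in> characters \<Longrightarrow> h \<in> borel_measurable borel"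
  by (intro borel_measurable_continuous_onI) (simp add: characters_def)

lemma fourier_coeff_shift:
  assumes f: "integrable \<mu> f" and h: "h \<in> characters"
  shows "fourier_coeff \<mu> (\<lambda>y. f (y + z)) h = h z * fourier_coeff \<mu> f h"
proof -
  note [measurable] = character_measurable[OF h]
  have fm [measurable]: "f \<in> borel_measurable borel"
    using borel_measurable_integrable[OF f] by (simp add: measurable_cong_sets[OF sets_\<mu> refl])
  have hz: "cnj (h y) = h z * cnj (h (y + z))" for y
  proof -
    have "h (y + z) = h y * h z" using h by (simp add: characters_def)
    then have "h z * cnj (h (y + z)) = cnj (h y) * (h z * cnj (h z))" by (simp only: complex_cnj_mult mult_ac)
    then show ?thesis by (simp add: characters_cnj_mult[OF h])
  qed
  have m: "(\<lambda>y. f y * cnj (h y)) \<in> borel_measurable borel" by measurable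
  have "fourier_coeff \<mu> (\<lambda>y. f (y + z)) h = (\<integral>y. h z * (f (y + z) * cnj (h (y + z))) \<partial>\<mu>)"
    unfolding fourier_coeff_def by (subst hz) (simp only: mult_ac)
  also have "\<dots> = h z * (\<integral>y. f (y + z) * cnj (h (y + z)) \<partial>\<mu>)" by (rule integral_mult_right_zero)
  also have "\<dots> = h z * fourier_coeff \<mu> f h"
    using integral_shift[OF m, of z] by (simp add: fourier_coeff_def)
  finally show ?thesis .
qed

lemma integrable_mult_character:
  assumes f: "integrable \<mu> f" and h: "h \<in> characters"
  shows "integrable \<mu> (\<lambda>y. f y * cnj (h y))"
proof (rule integrable_mult_bounded[OF f])
  note [measurable] = character_measurable[OF h]
  show "(\<lambda>y. cnj (h y)) \<in> borel_measurable \<mu>" by measurable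
  show "norm (cnj (h y)) \<le> 1" for y using h by (simp add: characters_def)
qed

lemma fourier_coeff_diff:
  assumes "integrable \<mu> f" "integrable \<mu> g" "h \<in> characters"
  shows "fourier_coeff \<mu> (\<lambda>y. f y - g y) h = fourier_coeff \<mu> f h - fourier_coeff \<mu> g h"
  unfolding fourier_coeff_def left_diff_distrib
  by (rule Bochner_Integration.integral_diff) (intro integrable_mult_character assms)+

text \<open>A Urysohn function \<open>g\<close> distinguishing \<open>0\<close> from \<open>z = a - b\<close> differs from its translate by \<open>z\<close>, so the difference has a
nonzero Fourier coefficient at some \<open>h\<close>.  That coefficient is \<open>(h z - 1)\<close> times the one of \<open>g\<close>, hence
\<open>h z \<noteq> 1\<close>.\<close>

lemma characters_separate_points:
  fixes a b :: 'g
  assumes "a \<noteq> b"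
  obtains h where "h \<in> characters" "h a \<noteq> h b"
proof -
  define z where "z = a - b"
  have "open (- {z})" by (intro open_Compl) simp
  moreover have "0 \<in> - {z}" using assms by (simp add: z_def)
  ultimately obtain g :: "'g \<Rightarrow> real" where g: "continuous_on UNIV g" "g 0 = 1" "g z = 0"
    using urysohn_function[of "{0}" "- {z}"] by (metis ComplD closed_singleton empty_subsetI insert_subset singletonI)
  define F where "F = (\<lambda>y. complex_of_real (g y))"
  have F: "continuous_on UNIV F" unfolding F_def by (intro continuous_intros g)
  obtain B where B: "\<And>y. norm (F y) \<le> B" using continuous_bounded[OF F] by blast
  have Fi: "integrable \<mu> F" by (rule integrable_bounded[OF borel_measurable_continuous_onI[OF F] B])
  define f where "f = (\<lambda>y. F (y + z) - F y)"
  have fc: "continuous_on UNIV f" unfolding f_def by (intro continuous_intros continuous_on_compose2[OF F] F) auto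
  have "f 0 \<noteq> 0" using g by (simp add: f_def F_def)
  then obtain h where h: "h \<in> characters" "fourier_coeff \<mu> f h \<noteq> 0"
    using continuous_nonzero_fourier_coeff[OF fc] by blast
  have "fourier_coeff \<mu> f h = h z * fourier_coeff \<mu> F h - fourier_coeff \<mu> F h"
    unfolding f_def fourier_coeff_diff[OF integrable_shift[OF Fi] Fi h(1)] fourier_coeff_shift[OF Fi h(1)] ..
  then have hz: "h z \<noteq> 1" using h(2) by auto
  have "h (b + z) = h b * h z" "norm (h b) = 1" using h(1) unfolding characters_def by blast+
  moreover have "b + z = a" by (simp add: z_def)
  ultimately have "h a = h b * h z" "h b \<noteq> 0" by auto
  then show ?thesis using hz that[OF h(1)] by auto
qed

text \<open>The real-valued trigonometric sums form a point-separating algebra, as they contain the real and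
imaginary parts of every character, so the real Stone-Weierstrass theorem suffices.\<close>

lemma trig_sum_dense:
  fixes g :: "'g \<Rightarrow> real"
  assumes g: "continuous_on UNIV g" and e: "0 < e"
  obtains F u where "trig_sum F" "\<And>x. F x = of_real (u x)" "\<And>x. \<bar>g x - u x\<bar> < e"
proof -
  define R where "R = {u :: 'g \<Rightarrow> real. trig_sum (\<lambda>x. of_real (u x))}"
  have Re: "(\<lambda>x. Re (c * h x)) \<in> R" if h: "h \<in> characters" for h c
  proof -
    have "trig_sum (\<lambda>x. (cnj c / 2) * cnj (h x) + (c / 2) * h x)"
      by (intro trig_sum_add trig_sum_char characters_cnj h)
    also have "(\<lambda>x. (cnj c / 2) * cnj (h x) + (c / 2) * h x) = (\<lambda>x. of_real (Re (c * h x)))"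
      by (auto simp: complex_eq_iff field_simps)
    finally show ?thesis by (simp add: R_def)
  qed
  interpret function_ring_on R UNIV
  proof
    show "compact (UNIV :: 'g set)" by (rule compact_G)
    show "continuous_on UNIV f" if "f \<in> R" for f
    proof -
      have "continuous_on UNIV (\<lambda>x. complex_of_real (f x))"
        using that by (intro trig_sum_continuous) (simp add: R_def)
      from continuous_on_Re[OF this] show ?thesis by simp
    qed
    show "(\<lambda>x. f x + g x) \<in> R" if "f \<in> R" "g \<in> R" for f g
      using that trig_sum_add unfolding R_def by auto
    show "(\<lambda>x. f x * g x) \<in> R" if "f \<in> R" "g \<in> R" for f g
      using that trig_sum_mult unfolding R_def by auto
    show "(\<lambda>_. c) \<in> R" for c
      using Re[OF characters_const, of "of_real c"] by simp
    fix x y :: 'g assume "x \<noteq> y"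
    then obtain h where h: "h \<in> characters" "h x \<noteq> h y" by (rule characters_separate_points)
    then have "Re (1 * h x) \<noteq> Re (1 * h y) \<or> Re (- \<i> * h x) \<noteq> Re (- \<i> * h y)" by (auto simp: complex_eq_iff)
    then show "\<exists>f\<in>R. f x \<noteq> f y"
      using Re[OF h(1), of 1] Re[OF h(1), of "- \<i>"] by (metis (no_types, lifting))
  qed
  obtain u where "u \<in> R" "\<And>x. \<bar>g x - u x\<bar> < e"
    using Stone_Weierstrass_basic[OF g e] by auto
  then show ?thesis using that[of "\<lambda>x. of_real (u x)" u] by (simp add: R_def)
qed

lemma fourier_coeff_zero_annihilates:
  fixes g :: "'g \<Rightarrow> real"
  assumes f: "integrable \<mu> f" and z: "\<And>h. h \<in> characters \<Longrightarrow> fourier_coeff \<mu> f h = 0"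
    and g: "continuous_on UNIV g"
  shows "(\<integral>y. f y * of_real (g y) \<partial>\<mu>) = 0"
proof -
  have trig: "integrable \<mu> (\<lambda>y. f y * cnj (F y)) \<and> (\<integral>y. f y * cnj (F y) \<partial>\<mu>) = 0" if "trig_sum F" for F
    using that
  proof induction
    case (trig_step F h c)
    have i: "integrable \<mu> (\<lambda>y. cnj c * (f y * cnj (h y)))"
      using integrable_mult_character[OF f trig_step(2)] by (rule integrable_mult_right)
    have "(\<integral>y. cnj c * (f y * cnj (h y)) \<partial>\<mu>) = cnj c * fourier_coeff \<mu> f h"
      unfolding fourier_coeff_def by (rule integral_mult_right_zero)
    also have "\<dots> = 0" using z[OF trig_step(2)] by simp
    finally have 0: "(\<integral>y. cnj c * (f y * cnj (h y)) \<partial>\<mu>) = 0" .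
    have e: "f y * cnj (F y + c * h y) = f y * cnj (F y) + cnj c * (f y * cnj (h y))" for y
      by (simp add: algebra_simps)
    show ?case unfolding e
      using trig_step i 0 Bochner_Integration.integral_add[of \<mu> "\<lambda>y. f y * cnj (F y)" "\<lambda>y. cnj c * (f y * cnj (h y))"]
      by (simp only: Bochner_Integration.integrable_add) simp
  qed simp
  obtain B where B: "\<And>y. norm (g y) \<le> B" using continuous_bounded[OF g] by blast
  have gm [measurable]: "g \<in> borel_measurable borel" using g by (rule borel_measurable_continuous_onI)
  have gi: "integrable \<mu> (\<lambda>y. f y * of_real (g y))"
    by (rule integrable_mult_bounded[OF f, where B=B]) (use B in auto)
  define A where "A = (\<integral>y. norm (f y) \<partial>\<mu>)"
  have "norm (\<integral>y. f y * of_real (g y) \<partial>\<mu>) \<le> e * A" if e: "0 < e" for e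
  proof -
    obtain F u where F: "trig_sum F" "\<And>x. F x = of_real (u x)" "\<And>x. \<bar>g x - u x\<bar> < e"
      using trig_sum_dense[OF g e] by metis
    have Fi: "integrable \<mu> (\<lambda>y. f y * of_real (u y))" "(\<integral>y. f y * of_real (u y) \<partial>\<mu>) = 0"
      using trig[OF F(1)] by (simp_all add: F(2))
    have "(\<integral>y. f y * of_real (g y) \<partial>\<mu>) = (\<integral>y. f y * of_real (g y) - f y * of_real (u y) \<partial>\<mu>)"
      using Bochner_Integration.integral_diff[OF gi Fi(1)] Fi(2) by simp
    also have "norm \<dots> \<le> (\<integral>y. e * norm (f y) \<partial>\<mu>)"
    proof (rule norm_integral_le[OF Bochner_Integration.integrable_diff[OF gi Fi(1)] integrable_mult_right[OF integrable_norm[OF f]]])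
      fix y
      have "norm (f y * of_real (g y) - f y * of_real (u y)) = norm (f y) * \<bar>g y - u y\<bar>"
        unfolding right_diff_distrib[symmetric] of_real_diff[symmetric] norm_mult norm_of_real ..
      also have "\<dots> \<le> norm (f y) * e" using F(3)[of y] by (intro mult_left_mono) auto
      finally show "norm (f y * of_real (g y) - f y * of_real (u y)) \<le> e * norm (f y)" by (simp add: mult.commute)
    qed
    also have "\<dots> = e * A" unfolding A_def by (rule integral_mult_right_zero)
    finally show ?thesis .
  qed
  then have "norm (\<integral>y. f y * of_real (g y) \<partial>\<mu>) \<le> 0 + e" if "0 < e" for e
  proof -
    have A: "0 \<le> A" unfolding A_def by (rule Bochner_Integration.integral_nonneg) simp
    have "norm (\<integral>y. f y * of_real (g y) \<partial>\<mu>) \<le> e / (A + 1) * A"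
      using \<open>\<And>e. 0 < e \<Longrightarrow> _\<close>[of "e / (A + 1)"] that A by simp
    also have "\<dots> \<le> e" using A that by (simp add: field_simps)
    finally show ?thesis by simp
  qed
  then have "norm (\<integral>y. f y * of_real (g y) \<partial>\<mu>) \<le> 0" by (rule field_le_epsilon)
  then show ?thesis by simp
qed

lemma compact_open_approximation:
  assumes A: "A \<in> sets borel" and e: "0 < e"
  obtains K U where "closed K" "open U" "K \<subseteq> A" "A \<subseteq> U" "measure \<mu> (U - K) < e"
proof -
  have inner: "emeasure \<mu> A = (SUP K\<in>{K. K \<subseteq> A \<and> compact K}. emeasure \<mu> K)"
    and outer: "emeasure \<mu> A = (INF U\<in>{U. A \<subseteq> U \<and> open U}. emeasure \<mu> U)"
    using haar A unfolding haar_measure_def by blast+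
  have m: "emeasure \<mu> X = ennreal (measure \<mu> X)" for X by (rule emeasure_eq_measure)
  have "\<exists>K. K \<subseteq> A \<and> compact K \<and> measure \<mu> A - e / 2 < measure \<mu> K"
  proof (rule ccontr)
    assume "\<not> ?thesis"
    then have *: "measure \<mu> K \<le> measure \<mu> A - e / 2" if "K \<subseteq> A" "compact K" for K
      using that by (meson not_le)
    have nn: "0 \<le> measure \<mu> A - e / 2" using *[of "{}"] by simp
    have "emeasure \<mu> A \<le> ennreal (measure \<mu> A - e / 2)"
      unfolding inner by (rule SUP_least) (use * in \<open>auto simp: m intro!: ennreal_leI\<close>)
    then show False using nn e by (simp add: m)
  qed
  then obtain K where K: "K \<subseteq> A" "compact K" "measure \<mu> A - e / 2 < measure \<mu> K" by blast
  have "\<exists>U. A \<subseteq> U \<and> open U \<and> measure \<mu> U < measure \<mu> A + e / 2"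
  proof (rule ccontr)
    assume "\<not> ?thesis"
    then have *: "measure \<mu> A + e / 2 \<le> measure \<mu> U" if "A \<subseteq> U" "open U" for U
      using that by (meson not_le)
    have "ennreal (measure \<mu> A + e / 2) \<le> emeasure \<mu> A"
      unfolding outer by (rule INF_greatest) (use * in \<open>auto simp: m intro!: ennreal_leI\<close>)
    then have "measure \<mu> A + e / 2 \<le> measure \<mu> A" unfolding m by (rule ennreal_le_iff[THEN iffD1, rotated]) simp
    then show False using e by simp
  qed
  then obtain U where U: "A \<subseteq> U" "open U" and U': "measure \<mu> U < measure \<mu> A + e / 2" by blast
  have cK: "closed K" using K(2) by (rule compact_imp_closed)
  have "measure \<mu> (U - K) = measure \<mu> U - measure \<mu> K"
    using K(1) U(1,2) cK by (intro finite_measure_Diff) (auto simp: sets_\<mu>)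
  then have "measure \<mu> (U - K) < e" using K(3) U' by simp
  then show ?thesis using that cK U K(1) by blast
qed

text \<open>An \<open>f\<close> with vanishing coefficients annihilates all continuous functions.  By regularity and
Urysohn's lemma indicators of Borel sets are \<open>L\<^sub>1\<close> limits of such functions with values in
\<open>[0, 1]\<close>, hence along a subsequence a.e. limits, and dominated convergence applies.\<close>

theorem fourier_uniqueness:
  assumes f: "integrable \<mu> f" and z: "\<And>h. h \<in> characters \<Longrightarrow> fourier_coeff \<mu> f h = 0"
  shows "AE y in \<mu>. f y = 0"
proof (rule density_zero[OF f])
  fix A assume "A \<in> sets \<mu>"
  then have A: "A \<in> sets borel" by (simp add: sets_\<mu>)
  have fm [measurable]: "f \<in> borel_measurable \<mu>" using f by (rule borel_measurable_integrable)
  have "\<exists>g :: 'g \<Rightarrow> real. continuous_on UNIV g \<and> (\<forall>x. 0 \<le> g x \<and> g x \<le> 1) \<and> (\<integral>x. norm (g x - indicator A x) \<partial>\<mu>) \<le> 1 / real (Suc n)" for n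
  proof -
    obtain K U where KU: "closed K" "open U" "K \<subseteq> A" "A \<subseteq> U" "measure \<mu> (U - K) < 1 / real (Suc n)"
      using compact_open_approximation[OF A, of "1 / real (Suc n)"] by auto
    have "K \<subseteq> U" using KU by blast
    then obtain g :: "'g \<Rightarrow> real" where g: "continuous_on UNIV g" "\<And>x. 0 \<le> g x" "\<And>x. g x \<le> 1"
      "\<And>x. x \<in> K \<Longrightarrow> g x = 1" "\<And>x. x \<notin> U \<Longrightarrow> g x = 0"
      using urysohn_function[OF KU(1,2)] by metis
    have [measurable]: "g \<in> borel_measurable borel" using g(1) by (rule borel_measurable_continuous_onI)
    have UK: "U - K \<in> sets borel" using KU by auto
    have "(\<integral>x. norm (g x - indicator A x) \<partial>\<mu>) \<le> (\<integral>x. indicator (U - K) x \<partial>\<mu>)"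
    proof (rule integral_mono)
      show "integrable \<mu> (\<lambda>x. norm (g x - indicator A x))"
        proof (rule integrable_bounded)
          show "norm (norm (g x - indicator A x)) \<le> 2" for x
            using g(2)[of x] g(3)[of x] by (auto simp: indicator_def)
          show "(\<lambda>x. norm (g x - indicator A x)) \<in> borel_measurable borel" using A by measurable
        qed
      show "integrable \<mu> (indicat_real (U - K))"
        by (rule integrable_bounded[where B=1]) (use UK in \<open>auto simp: indicator_def\<close>)
      show "norm (g x - indicator A x) \<le> indicator (U - K) x" for x
        using g(2)[of x] g(3)[of x] g(4)[of x] g(5)[of x] KU(3,4) by (auto simp: indicator_def)
    qed
    also have "\<dots> = measure \<mu> (U - K)" using UK by (simp add: sets_\<mu>)
    finally show ?thesis using g KU(5) by (intro exI[of _ g]) auto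
  qed
  then obtain g :: "nat \<Rightarrow> 'g \<Rightarrow> real" where g: "\<And>n. continuous_on UNIV (g n)" "\<And>n x. 0 \<le> g n x" "\<And>n x. g n x \<le> 1"
    "\<And>n. (\<integral>x. norm (g n x - indicator A x) \<partial>\<mu>) \<le> 1 / real (Suc n)" by metis
  have gm [measurable]: "g n \<in> borel_measurable borel" for n using g(1) by (rule borel_measurable_continuous_onI)
  have di: "integrable \<mu> (\<lambda>x. g n x - indicator A x)" for n
    proof (rule integrable_bounded)
      show "norm (g n x - indicator A x) \<le> 2" for x
        using g(2)[of n x] g(3)[of n x] by (auto simp: indicator_def)
      show "(\<lambda>x. g n x - indicator A x) \<in> borel_measurable borel" using A by measurable
    qed
  have "(\<lambda>n. \<integral>x. norm (g n x - indicator A x) \<partial>\<mu>) \<longlonglongrightarrow> 0"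
  proof (rule tendsto_sandwich[OF always_eventually always_eventually tendsto_const])
    show "\<forall>n. 0 \<le> (\<integral>x. norm (g n x - indicator A x) \<partial>\<mu>)" by (intro allI Bochner_Integration.integral_nonneg) simp
    show "\<forall>n. (\<integral>x. norm (g n x - indicator A x) \<partial>\<mu>) \<le> 1 / real (Suc n)" using g(4) by blast
    show "(\<lambda>n. 1 / real (Suc n)) \<longlonglongrightarrow> 0" by real_asymp
  qed
  from tendsto_L1_AE_subseq[OF di this] obtain r where
    r: "strict_mono r" "AE x in \<mu>. (\<lambda>n. g (r n) x - indicator A x) \<longlonglongrightarrow> 0" by blast
  have "(\<lambda>n. \<integral>x. f x * of_real (g (r n) x) \<partial>\<mu>) \<longlonglongrightarrow> (\<integral>x. f x * of_real (indicator A x) \<partial>\<mu>)"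
  proof (rule integral_dominated_convergence[where w="\<lambda>x. norm (f x)"])
    show "AE x in \<mu>. (\<lambda>n. f x * of_real (g (r n) x)) \<longlonglongrightarrow> f x * of_real (indicator A x)"
      using r(2) by eventually_elim (intro tendsto_intros, simp add: LIM_zero_iff)
    show "AE x in \<mu>. norm (f x * of_real (g (r n) x)) \<le> norm (f x)" for n
      using g(2,3) by (intro AE_I2) (simp add: norm_mult mult_left_le)
  qed (use f A in \<open>auto simp: sets_\<mu>\<close>)
  moreover have "(\<integral>x. f x * of_real (g (r n) x) \<partial>\<mu>) = 0" for n
    by (rule fourier_coeff_zero_annihilates[OF f z g(1)])
  ultimately have "(\<integral>x. f x * of_real (indicator A x) \<partial>\<mu>) = 0" by (simp add: LIMSEQ_const_iff)
  then show "set_lebesgue_integral \<mu> A f = 0"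
    by (simp add: set_lebesgue_integral_def scaleR_conv_of_real mult.commute)
qed

text \<open>If \<open>h z \<noteq> g z\<close>, translating the integral of \<open>h\<close> against \<open>cnj g\<close> by \<open>z\<close> multiplies it by
\<open>h z / g z \<noteq> 1\<close> and leaves it unchanged.\<close>

lemma character_orthogonality:
  assumes h: "h \<in> characters" and g: "g \<in> characters"
  shows "fourier_coeff \<mu> h g = (if h = g then 1 else 0)"
proof (cases "h = g")
  case True
  then show ?thesis using prob_space by (simp add: fourier_coeff_def characters_cnj_mult[OF g])
next
  case False
  then obtain z where z: "h z \<noteq> g z" by blast
  have hi: "integrable \<mu> h"
    by (rule integrable_bounded[OF character_measurable[OF h], of 1]) (use h in \<open>simp add: characters_def\<close>)
  have "fourier_coeff \<mu> (\<lambda>y. h (y + z)) g = (\<integral>y. h z * (h y * cnj (g y)) \<partial>\<mu>)"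
    using h by (simp add: fourier_coeff_def characters_def mult_ac)
  also have "\<dots> = h z * fourier_coeff \<mu> h g" unfolding fourier_coeff_def by (rule integral_mult_right_zero)
  finally have "h z * fourier_coeff \<mu> h g = g z * fourier_coeff \<mu> h g"
    unfolding fourier_coeff_shift[OF hi g] by (rule sym)
  then have "fourier_coeff \<mu> h g = 0" using z mult_right_cancel by blast
  then show ?thesis using False by simp
qed

end

section \<open>\<open>L\<^sub>p\<close> bounds of flow convolutions\<close>

text \<open>The tangent at \<open>c\<close> lies below the convex function; in this form it is Young's inequality for \<open>a\<close>
and \<open>c\<^sup>q\<^sup>-\<^sup>1\<close>.\<close>

lemma powr_tangent:
  assumes q: "1 \<le> q" and a: "0 \<le> a" and c: "0 < c"
  shows "c powr q + q * c powr (q - 1) * (a - c) \<le> (a::real) powr q"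
proof (cases "q = 1")
  case True
  then show ?thesis using a c by simp
next
  case False
  then have q1: "1 < q" using q by simp
  define b where "b = c powr (q - 1)"
  have b: "0 \<le> b" by (simp add: b_def)
  have bc: "b * c = c powr q" "b powr (q / (q - 1)) = c powr q"
    using c q1 powr_add[of c "q - 1" 1] by (simp_all add: b_def powr_powr)
  have "a * b \<le> a powr q / q + b powr (q / (q - 1)) / (q / (q - 1))"
    using q1 by (intro Youngs_inequality a b) (auto simp: field_simps)
  then have "q * (a * b) \<le> q * (a powr q / q + c powr q / (q / (q - 1)))"
    using q1 by (intro mult_left_mono) (simp_all add: bc)
  also have "\<dots> = a powr q + (q - 1) * c powr q" using q1 by (simp add: field_simps)
  finally have "q * (a * b) \<le> a powr q + (q - 1) * c powr q" .
  moreover have "c powr q + q * c powr (q - 1) * (a - c) = q * (a * b) - (q - 1) * c powr q"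
    unfolding b_def[symmetric] bc(1)[symmetric] by (simp add: algebra_simps)
  ultimately show ?thesis by linarith
qed

text \<open>The tangent at the mean is integrated.\<close>

lemma (in prob_space) powr_jensen:
  fixes X :: "'a \<Rightarrow> real"
  assumes q: "1 \<le> q" and nn: "\<And>x. 0 \<le> X x" and X: "integrable M X"
  shows "ennreal ((\<integral>x. X x \<partial>M) powr q) \<le> (\<integral>\<^sup>+x. ennreal (X x powr q) \<partial>M)"
proof (cases "(\<integral>x. X x \<partial>M) = 0 \<or> (\<integral>\<^sup>+x. ennreal (X x powr q) \<partial>M) = \<infinity>")
  case False
  have [measurable]: "X \<in> borel_measurable M" using X by auto
  define c where "c = (\<integral>x. X x \<partial>M)"
  have "0 \<le> c" unfolding c_def by (rule Bochner_Integration.integral_nonneg) (rule nn)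
  then have c: "0 < c" using False by (simp add: c_def)
  have qi: "integrable M (\<lambda>x. X x powr q)"
    using False by (intro integrableI_nonneg) (auto simp: top.not_eq_extremum)
  have "c powr q = (\<integral>x. c powr q + q * c powr (q - 1) * (X x - c) \<partial>M)"
    using X prob_space by (simp add: c_def)
  also have "\<dots> \<le> (\<integral>x. X x powr q \<partial>M)"
    using X by (intro integral_mono qi powr_tangent q nn c) auto
  finally have "ennreal (c powr q) \<le> ennreal (\<integral>x. X x powr q \<partial>M)" by (rule ennreal_leI)
  also have "\<dots> = (\<integral>\<^sup>+x. ennreal (X x powr q) \<partial>M)"
    using qi by (subst nn_integral_eq_integral) auto
  finally show ?thesis by (simp add: c_def)
qed (use q in auto)

text \<open>A norm bound together with measurability.  In contrast to the norm itself it is meaningful without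
knowing membership in \<open>L\<^sub>p\<close>, and it passes directly to a.e. limits, uniformly in \<open>p\<close>.\<close>

definition Lp_bound :: "ennreal \<Rightarrow> 'x measure \<Rightarrow> ('x \<Rightarrow> complex) \<Rightarrow> real \<Rightarrow> bool" where
  "Lp_bound p M f C \<longleftrightarrow> f \<in> borel_measurable M \<and> 0 \<le> C \<and>
     (if p = \<infinity> then AE x in M. norm (f x) \<le> C
      else (\<integral>\<^sup>+x. ennreal (norm (f x) powr enn2real p) \<partial>M) \<le> ennreal (C powr enn2real p))"

lemma enn2real_ge_1: "1 \<le> p \<Longrightarrow> p \<noteq> \<infinity> \<Longrightarrow> 1 \<le> enn2real p"
  by (metis enn2real_1 enn2real_mono infinity_ennreal_def top.not_eq_extremum)

context prob_space
begin

lemma Lp_bound_norm: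
  assumes p: "1 \<le> p" and f: "f \<in> Lp p M"
  shows "Lp_bound p M f (Lp_norm p M f)"
proof (cases "p = \<infinity>")
  case True
  let ?s = "esssup M (\<lambda>x. ereal (norm (f x)))"
  have [measurable]: "f \<in> borel_measurable M" and fin: "?s < \<infinity>" using f True by (auto simp: Lp_def)
  have ae: "AE x in M. ereal (norm (f x)) \<le> ?s" by (rule esssup_AE)
  then have "AE x in M. 0 \<le> ?s" by eventually_elim (erule order_trans[rotated], simp)
  then have "0 \<le> ?s" by simp
  then obtain r where r: "?s = ereal r" "0 \<le> r" using fin by (cases ?s) auto
  then show ?thesis using ae True by (simp add: Lp_bound_def Lp_norm_def)
next
  case False
  define q where "q = enn2real p"
  have q: "1 \<le> q" unfolding q_def using p False by (rule enn2real_ge_1)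
  have [measurable]: "f \<in> borel_measurable M" and i: "integrable M (\<lambda>x. norm (f x) powr q)"
    using f False by (auto simp: Lp_def q_def)
  define I where "I = (\<integral>x. norm (f x) powr q \<partial>M)"
  have "0 \<le> I" unfolding I_def by (rule Bochner_Integration.integral_nonneg) simp
  moreover have "(\<integral>\<^sup>+x. ennreal (norm (f x) powr q) \<partial>M) = ennreal I"
    unfolding I_def using i by (intro nn_integral_eq_integral) auto
  ultimately show ?thesis using False q
    by (simp add: Lp_bound_def Lp_norm_def q_def[symmetric] I_def[symmetric] powr_powr)
qed

lemma Lp_bound_imp:
  assumes p: "1 \<le> p" and f: "Lp_bound p M f C"
  shows "f \<in> Lp p M" "Lp_norm p M f \<le> C"
proof -
  have [measurable]: "f \<in> borel_measurable M" and C: "0 \<le> C" using f by (auto simp: Lp_bound_def)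
  have "f \<in> Lp p M \<and> Lp_norm p M f \<le> C"
  proof (cases "p = \<infinity>")
    case True
    let ?s = "esssup M (\<lambda>x. ereal (norm (f x)))"
    have s: "?s \<le> ereal C"
      by (rule esssup_I) (use f True in \<open>auto simp: Lp_bound_def\<close>)
    then have "real_of_ereal ?s \<le> C" using C by (cases ?s) auto
    moreover have "?s < \<infinity>" using s by (rule order_le_less_trans) simp
    ultimately show ?thesis using True by (simp add: Lp_def Lp_norm_def)
  next
    case False
    define q where "q = enn2real p"
    have q: "1 \<le> q" unfolding q_def using p False by (rule enn2real_ge_1)
    have le: "(\<integral>\<^sup>+x. ennreal (norm (f x) powr q) \<partial>M) \<le> ennreal (C powr q)"
      using f False by (simp add: Lp_bound_def q_def)
    then have i: "integrable M (\<lambda>x. norm (f x) powr q)"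
      by (intro integrableI_nonneg) (auto intro: order_le_less_trans)
    define I where "I = (\<integral>x. norm (f x) powr q \<partial>M)"
    have I: "0 \<le> I" unfolding I_def by (rule Bochner_Integration.integral_nonneg) simp
    have "(\<integral>\<^sup>+x. ennreal (norm (f x) powr q) \<partial>M) = ennreal I"
      unfolding I_def using i by (intro nn_integral_eq_integral) auto
    then have "I \<le> C powr q" using le by simp
    then have "I powr (1 / q) \<le> (C powr q) powr (1 / q)" using I q by (intro powr_mono2) auto
    then have "I powr (1 / q) \<le> C" using q C by (simp add: powr_powr)
    then show ?thesis using False i by (simp add: Lp_def Lp_norm_def q_def[symmetric] I_def[symmetric])
  qed
  then show "f \<in> Lp p M" "Lp_norm p M f \<le> C" by auto
qed

lemma Lp_bound_measurable: "Lp_bound p M f C \<Longrightarrow> f \<in> borel_measurable M"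
  and Lp_bound_nonneg: "Lp_bound p M f C \<Longrightarrow> 0 \<le> C"
  by (auto simp: Lp_bound_def)

lemma Lp_bound_mono:
  assumes "Lp_bound p M f C" "C \<le> D"
  shows "Lp_bound p M f D"
proof -
  have "C powr enn2real p \<le> D powr enn2real p" using assms by (intro powr_mono2) (auto simp: Lp_bound_def)
  then show ?thesis using assms
    by (auto simp: Lp_bound_def elim: eventually_mono intro: order_trans ennreal_leI)
qed

lemma Lp_bound_of_bounded:
  assumes p: "1 \<le> p" and [measurable]: "f \<in> borel_measurable M" and C: "0 \<le> C" "\<And>x. norm (f x) \<le> C"
  shows "Lp_bound p M f C"
proof (cases "p = \<infinity>")
  case False
  have "(\<integral>\<^sup>+x. ennreal (norm (f x) powr enn2real p) \<partial>M) \<le> (\<integral>\<^sup>+x. ennreal (C powr enn2real p) \<partial>M)"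
    using C by (intro nn_integral_mono ennreal_leI powr_mono2) auto
  then show ?thesis using assms False by (simp add: Lp_bound_def emeasure_space_1)
qed (use assms in \<open>auto simp: Lp_bound_def\<close>)

text \<open>This is Fatou's lemma; the case of a constant sequence says that a bound depends only on the a.e.
class.\<close>

lemma Lp_bound_AE_limit:
  assumes p: "1 \<le> p" and f: "\<And>n. Lp_bound p M (f n) C" and [measurable]: "g \<in> borel_measurable M"
    and lim: "AE x in M. (\<lambda>n::nat. f n x) \<longlonglongrightarrow> g x"
  shows "Lp_bound p M g C"
proof -
  have [measurable]: "f n \<in> borel_measurable M" for n using f by (auto simp: Lp_bound_def)
  have C: "0 \<le> C" using f[of 0] by (simp add: Lp_bound_def)
  show ?thesis
  proof (cases "p = \<infinity>")
    case True
    then have "AE x in M. norm (f n x) \<le> C" for n using f[of n] by (simp add: Lp_bound_def)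
    then have "AE x in M. \<forall>n. norm (f n x) \<le> C" by (simp add: AE_all_countable)
    then have "AE x in M. norm (g x) \<le> C"
      using lim by eventually_elim (rule tendsto_upperbound[OF tendsto_norm], auto)
    then show ?thesis using True C by (simp add: Lp_bound_def)
  next
    case False
    define q where "q = enn2real p"
    have le: "(\<integral>\<^sup>+x. ennreal (norm (f n x) powr q) \<partial>M) \<le> ennreal (C powr q)" for n
      using f[of n] False by (simp add: Lp_bound_def q_def)
    have q0: "0 < q" unfolding q_def using enn2real_ge_1[OF p False] by simp
    have "(\<integral>\<^sup>+x. ennreal (norm (g x) powr q) \<partial>M) = (\<integral>\<^sup>+x. liminf (\<lambda>n. ennreal (norm (f n x) powr q)) \<partial>M)"
    proof (rule nn_integral_cong_AE, use lim in eventually_elim)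
      fix x assume "(\<lambda>n. f n x) \<longlonglongrightarrow> g x"
      then have "(\<lambda>n. norm (f n x) powr q) \<longlonglongrightarrow> norm (g x) powr q"
        using q0 by (intro tendsto_powr2 tendsto_norm tendsto_const) auto
      then have "(\<lambda>n. ennreal (norm (f n x) powr q)) \<longlonglongrightarrow> ennreal (norm (g x) powr q)"
        by (rule tendsto_ennrealI)
      then show "ennreal (norm (g x) powr q) = liminf (\<lambda>n. ennreal (norm (f n x) powr q))"
        by (rule lim_imp_Liminf[OF sequentially_bot, symmetric])
    qed
    also have "\<dots> \<le> liminf (\<lambda>n. \<integral>\<^sup>+x. ennreal (norm (f n x) powr q) \<partial>M)"
      by (rule nn_integral_liminf) measurable
    also have "\<dots> \<le> liminf (\<lambda>n. ennreal (C powr q))"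
      by (intro Liminf_mono always_eventually allI le)
    also have "\<dots> = ennreal (C powr q)" by (simp add: Liminf_const)
    finally show ?thesis using False C by (simp add: Lp_bound_def q_def)
  qed
qed

lemma Lp_bound_AE_cong:
  assumes "1 \<le> p" "Lp_bound p M f C" "g \<in> borel_measurable M" "AE x in M. f x = g x"
  shows "Lp_bound p M g C"
  by (rule Lp_bound_AE_limit[where f="\<lambda>_. f"]) (use assms in \<open>auto elim: eventually_mono\<close>)

lemma Lp_bound_integrable:
  assumes p: "1 \<le> p" and f: "Lp_bound p M f C"
  shows "integrable M f" "(\<integral>x. norm (f x) \<partial>M) \<le> C"
proof -
  have [measurable]: "f \<in> borel_measurable M" and C: "0 \<le> C" using f by (auto simp: Lp_bound_def)
  have "integrable M f \<and> (\<integral>x. norm (f x) \<partial>M) \<le> C"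
  proof (cases "p = \<infinity>")
    case True
    then have ae: "AE x in M. norm (f x) \<le> C" using f by (simp add: Lp_bound_def)
    then have i: "integrable M f" by (intro integrable_const_bound) auto
    have "(\<integral>x. norm (f x) \<partial>M) \<le> (\<integral>x. C \<partial>M)"
      by (rule integral_mono_AE) (use i ae in auto)
    then show ?thesis using i prob_space by simp
  next
    case False
    define q where "q = enn2real p"
    have q: "1 \<le> q" unfolding q_def using p False by (rule enn2real_ge_1)
    have le: "(\<integral>\<^sup>+x. ennreal (norm (f x) powr q) \<partial>M) \<le> ennreal (C powr q)"
      using f False by (simp add: Lp_bound_def q_def)
    then have qi: "integrable M (\<lambda>x. norm (f x) powr q)"
      by (intro integrableI_nonneg) (auto intro: order_le_less_trans)
    have bound: "norm (f x) \<le> 1 + norm (f x) powr q" for x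
    proof (cases "norm (f x) \<le> 1")
      case False
      then have "norm (f x) powr 1 \<le> norm (f x) powr q" using q by (intro powr_mono) auto
      then show ?thesis using False by simp
    qed (simp add: add_increasing2)
    have i: "integrable M f"
      by (rule Bochner_Integration.integrable_bound[of _ "\<lambda>x. 1 + norm (f x) powr q"]) (use qi bound in \<open>auto\<close>)
    have "ennreal ((\<integral>x. norm (f x) \<partial>M) powr q) \<le> ennreal (C powr q)"
      by (rule order_trans[OF powr_jensen[OF q _ integrable_norm[OF i]] le]) simp
    then have "(\<integral>x. norm (f x) \<partial>M) powr q \<le> C powr q" by (subst (asm) ennreal_le_iff) simp_all
    then have "(\<integral>x. norm (f x) \<partial>M) \<le> C"
      using q C by (metis less_le_trans not_le powr_less_mono2 zero_less_one)
    then show ?thesis using i by simp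
  qed
  then show "integrable M f" "(\<integral>x. norm (f x) \<partial>M) \<le> C" by auto
qed

text \<open>The crude pointwise bound \<open>\<bar>f + g\<bar>\<^sup>q \<le> 2\<^sup>q (\<bar>f\<bar>\<^sup>q + \<bar>g\<bar>\<^sup>q)\<close> replaces Minkowski's inequality; the factor
\<open>4\<close> is harmless where the bounds tend to \<open>0\<close>.\<close>

lemma Lp_bound_add:
  assumes p: "1 \<le> p" and f: "Lp_bound p M f C" and g: "Lp_bound p M g D"
  shows "Lp_bound p M (\<lambda>x. f x + g x) (4 * (C + D))"
proof -
  have [measurable]: "f \<in> borel_measurable M" "g \<in> borel_measurable M" and CD: "0 \<le> C" "0 \<le> D"
    using f g by (auto simp: Lp_bound_def)
  show ?thesis
  proof (cases "p = \<infinity>")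
    case True
    then have "AE x in M. norm (f x) \<le> C" "AE x in M. norm (g x) \<le> D" using f g by (auto simp: Lp_bound_def)
    then have "AE x in M. norm (f x + g x) \<le> 4 * (C + D)"
    proof eventually_elim
      case (elim x)
      then have "norm (f x + g x) \<le> C + D" by (intro order_trans[OF norm_triangle_ineq] add_mono)
      also have "\<dots> \<le> 4 * (C + D)" using CD by simp
      finally show ?case .
    qed
    then show ?thesis using True CD by (simp add: Lp_bound_def)
  next
    case False
    define q where "q = enn2real p"
    have q: "1 \<le> q" unfolding q_def using p False by (rule enn2real_ge_1)
    have le: "(\<integral>\<^sup>+x. ennreal (norm (f x) powr q) \<partial>M) \<le> ennreal (C powr q)"
       "(\<integral>\<^sup>+x. ennreal (norm (g x) powr q) \<partial>M) \<le> ennreal (D powr q)"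
      using f g False by (simp_all add: Lp_bound_def q_def)
    have pw: "norm (f x + g x) powr q \<le> 2 powr q * (norm (f x) powr q + norm (g x) powr q)" for x
    proof -
      define m where "m = max (norm (f x)) (norm (g x))"
      have "norm (f x + g x) powr q \<le> (2 * m) powr q"
        using norm_triangle_ineq[of "f x" "g x"] q by (intro powr_mono2) (auto simp: m_def)
      also have "\<dots> = 2 powr q * m powr q" by (simp add: m_def powr_mult le_max_iff_disj)
      also have "m powr q \<le> norm (f x) powr q + norm (g x) powr q"
        by (auto simp: m_def max_def add_increasing add_increasing2)
      finally show ?thesis by simp
    qed
    have "(\<integral>\<^sup>+x. ennreal (norm (f x + g x) powr q) \<partial>M)
        \<le> (\<integral>\<^sup>+x. ennreal (2 powr q) * (ennreal (norm (f x) powr q) + ennreal (norm (g x) powr q)) \<partial>M)"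
      by (intro nn_integral_mono) (simp add: pw ennreal_leI flip: ennreal_plus ennreal_mult)
    also have "\<dots> = ennreal (2 powr q) * ((\<integral>\<^sup>+x. ennreal (norm (f x) powr q) \<partial>M) + (\<integral>\<^sup>+x. ennreal (norm (g x) powr q) \<partial>M))"
      by (simp add: nn_integral_cmult nn_integral_add)
    also have "\<dots> \<le> ennreal (2 powr q) * (ennreal (C powr q) + ennreal (D powr q))"
      by (intro mult_left_mono add_mono le) simp
    also have "\<dots> = ennreal (2 powr q * (C powr q + D powr q))" by (simp flip: ennreal_plus ennreal_mult)
    also have "\<dots> \<le> ennreal ((4 * (C + D)) powr q)"
    proof (rule ennreal_leI)
      have "C powr q \<le> (C + D) powr q" "D powr q \<le> (C + D) powr q" using CD q by (auto intro!: powr_mono2)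
      moreover have "2 \<le> (2::real) powr q" using powr_mono[OF q, of 2] by simp
      ultimately have "C powr q + D powr q \<le> 2 powr q * (C + D) powr q"
        using mult_right_mono[of 2 "2 powr q" "(C + D) powr q"] by simp
      then have "2 powr q * (C powr q + D powr q) \<le> 2 powr q * (2 powr q * (C + D) powr q)"
        by (intro mult_left_mono) auto
      also have "\<dots> = (4 * (C + D)) powr q" using CD by (simp add: powr_mult[symmetric])
      finally show "2 powr q * (C powr q + D powr q) \<le> (4 * (C + D)) powr q" .
    qed
    finally show ?thesis using False CD by (simp add: Lp_bound_def q_def)
  qed
qed

lemma Lp_bound_uminus:
  assumes f: "Lp_bound p M f C"
  shows "Lp_bound p M (\<lambda>x. - f x) C"
  using f by (simp add: Lp_bound_def)

end

context flow_group
begin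

lemma borel_measurable_\<mu>_iff: "f \<in> borel_measurable \<mu> \<longleftrightarrow> f \<in> borel_measurable borel"
  by (simp add: measurable_cong_sets[OF sets_\<mu> refl])

text \<open>Minkowski's integral inequality for the flow: for finite \<open>p\<close>, Jensen's inequality with respect to
the probability density \<open>\<bar>k\<bar> / \<parallel>k\<parallel>\<^sub>1\<close> is applied on each orbit and then integrated over the group by
invariance of the Haar measure.\<close>

lemma Lp_bound_flow_conv:
  assumes p: "1 \<le> p" and f: "Lp_bound p \<mu> f C" and k: "integrable lborel k"
  shows "Lp_bound p \<mu> (flow_conv f k) ((\<integral>t. norm (k t) \<partial>lborel) * C)"
proof -
  note fi = Lp_bound_integrable(1)[OF p f]
  have fm [measurable]: "f \<in> borel_measurable borel" using f by (simp add: Lp_bound_def borel_measurable_\<mu>_iff)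
  have km [measurable]: "k \<in> borel_measurable borel" using borel_measurable_integrable[OF k] by simp
  have C: "0 \<le> C" using f by (simp add: Lp_bound_def)
  note ci = flow_conv_integrable[OF fi k]
  define m where "m = (\<integral>t. norm (k t) \<partial>lborel)"
  have m: "0 \<le> m" unfolding m_def by (rule Bochner_Integration.integral_nonneg) simp
  have aei: "AE y in \<mu>. integrable lborel (\<lambda>t. f (y + \<beta> t) * k t)" by (rule AE_flow_integrable[OF fi k])
  have nb: "norm (flow_conv f k y) \<le> (\<integral>t. norm (f (y + \<beta> t)) * norm (k t) \<partial>lborel)" for y
    unfolding flow_conv_def by (rule order_trans[OF integral_norm_bound]) (simp add: norm_mult)
  show ?thesis
  proof (cases "p = \<infinity>")
    case True
    then have ae: "AE y in \<mu>. norm (f y) \<le> C" using f by (simp add: Lp_bound_def)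
    have "AE t in lborel. AE y in \<mu>. norm (f (y + \<beta> t)) \<le> C"
      using AE_shift[OF ae] by simp
    also have "?this \<longleftrightarrow> (AE y in \<mu>. AE t in lborel. norm (f (y + \<beta> t)) \<le> C)"
    proof (rule TG.AE_commute)
      have "(\<lambda>z. norm (f (snd z + \<beta> (fst z)))) \<in> borel_measurable (lborel \<Otimes>\<^sub>M \<mu>)" by measurable
      then show "{z \<in> space (lborel \<Otimes>\<^sub>M \<mu>). norm (f (snd z + \<beta> (fst z))) \<le> C} \<in> sets (lborel \<Otimes>\<^sub>M \<mu>)"
        by measurable
    qed
    finally have "AE y in \<mu>. AE t in lborel. norm (f (y + \<beta> t)) \<le> C" .
    then have "AE y in \<mu>. norm (flow_conv f k y) \<le> m * C"
      using aei
    proof eventually_elim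
      case (elim y)
      have "(\<integral>t. norm (f (y + \<beta> t)) * norm (k t) \<partial>lborel) \<le> (\<integral>t. C * norm (k t) \<partial>lborel)"
      proof (rule integral_mono_AE)
        show "integrable lborel (\<lambda>t. norm (f (y + \<beta> t)) * norm (k t))"
          using integrable_norm[OF elim(2)] by (simp add: norm_mult)
        show "integrable lborel (\<lambda>t. C * norm (k t))" using k by simp
        show "AE t in lborel. norm (f (y + \<beta> t)) * norm (k t) \<le> C * norm (k t)"
          using elim(1) by eventually_elim (rule mult_right_mono, auto)
      qed
      then show ?case using nb[of y] by (simp add: m_def mult.commute)
    qed
    then show ?thesis using True ci C m by (auto simp: Lp_bound_def m_def)
  next
    case False
    define q where "q = enn2real p"
    have q: "1 \<le> q" unfolding q_def using p False by (rule enn2real_ge_1)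
    have le: "(\<integral>\<^sup>+y. ennreal (norm (f y) powr q) \<partial>\<mu>) \<le> ennreal (C powr q)"
      using f False by (simp add: Lp_bound_def q_def)
    have "(\<integral>\<^sup>+y. ennreal (norm (flow_conv f k y) powr q) \<partial>\<mu>) \<le> ennreal ((m * C) powr q)"
    proof (cases "m = 0")
      case True
      then have "AE t in lborel. norm (k t) = 0"
        unfolding m_def by (subst (asm) integral_nonneg_eq_0_iff_AE) (use k in auto)
      then have "flow_conv f k y = 0" for y
        unfolding flow_conv_def by (intro integral_eq_zero_AE) (auto elim: eventually_mono)
      then show ?thesis by simp
    next
      case m0: False
      then have mp: "0 < m" using m by simp
      define \<nu> where "\<nu> = density lborel (\<lambda>t. ennreal (norm (k t) / m))"
      have \<nu>: "prob_space \<nu>"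
      proof (rule prob_spaceI)
        have "emeasure \<nu> (space \<nu>) = (\<integral>\<^sup>+t. ennreal (norm (k t) / m) \<partial>lborel)"
          by (simp add: \<nu>_def emeasure_density)
        also have "\<dots> = ennreal (\<integral>t. norm (k t) / m \<partial>lborel)"
          by (rule nn_integral_eq_integral) (use k mp in auto)
        also have "(\<integral>t. norm (k t) / m \<partial>lborel) = 1" using mp by (simp add: m_def[symmetric])
        finally show "emeasure \<nu> (space \<nu>) = 1" by simp
      qed
      interpret N: prob_space \<nu> by (rule \<nu>)
      have point: "AE y in \<mu>. ennreal (norm (flow_conv f k y) powr q)
          \<le> ennreal (m powr q) * (\<integral>\<^sup>+t. ennreal (norm (k t) / m) * ennreal (norm (f (y + \<beta> t)) powr q) \<partial>lborel)"
        using aei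
      proof eventually_elim
        case (elim y)
        have i: "integrable lborel (\<lambda>t. norm (f (y + \<beta> t)) * norm (k t))"
          using integrable_norm[OF elim] by (simp add: norm_mult)
        have i\<nu>: "integrable \<nu> (\<lambda>t. norm (f (y + \<beta> t)))"
          unfolding \<nu>_def using integrable_mult_right[OF i, of "1 / m"] mp
          by (subst integrable_density) (auto simp: mult_ac)
        have e\<nu>: "(\<integral>t. norm (f (y + \<beta> t)) \<partial>\<nu>) = (\<integral>t. norm (f (y + \<beta> t)) * norm (k t) \<partial>lborel) / m"
        proof -
          have "(\<integral>t. norm (f (y + \<beta> t)) \<partial>\<nu>) = (\<integral>t. (norm (k t) / m) *\<^sub>R norm (f (y + \<beta> t)) \<partial>lborel)"
            unfolding \<nu>_def by (rule integral_density) (use mp in auto)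
          also have "\<dots> = (\<integral>t. (norm (f (y + \<beta> t)) * norm (k t)) / m \<partial>lborel)"
            by (simp add: mult.commute)
          also have "\<dots> = (\<integral>t. norm (f (y + \<beta> t)) * norm (k t) \<partial>lborel) / m" by (rule integral_divide_zero)
          finally show ?thesis .
        qed
        have "norm (flow_conv f k y) \<le> m * (\<integral>t. norm (f (y + \<beta> t)) \<partial>\<nu>)"
          using nb[of y] mp by (simp add: e\<nu>)
        then have "norm (flow_conv f k y) powr q \<le> (m * (\<integral>t. norm (f (y + \<beta> t)) \<partial>\<nu>)) powr q"
          using q by (intro powr_mono2) auto
        also have "\<dots> = m powr q * (\<integral>t. norm (f (y + \<beta> t)) \<partial>\<nu>) powr q"
          by (rule powr_mult)
        finally have "ennreal (norm (flow_conv f k y) powr q) \<le> ennreal (m powr q) * ennreal ((\<integral>t. norm (f (y + \<beta> t)) \<partial>\<nu>) powr q)"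
          by (simp add: ennreal_leI flip: ennreal_mult)
        also have "\<dots> \<le> ennreal (m powr q) * (\<integral>\<^sup>+t. ennreal (norm (f (y + \<beta> t)) powr q) \<partial>\<nu>)"
          by (intro mult_left_mono N.powr_jensen[OF q _ i\<nu>]) auto
        also have "(\<integral>\<^sup>+t. ennreal (norm (f (y + \<beta> t)) powr q) \<partial>\<nu>)
            = (\<integral>\<^sup>+t. ennreal (norm (k t) / m) * ennreal (norm (f (y + \<beta> t)) powr q) \<partial>lborel)"
          unfolding \<nu>_def by (rule nn_integral_density) auto
        finally show ?case .
      qed
      have mt: "(\<lambda>(t, y). ennreal (norm (k t) / m) * ennreal (norm (f (y + \<beta> t)) powr q)) \<in> borel_measurable (lborel \<Otimes>\<^sub>M \<mu>)"
        by (simp add: case_prod_beta')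
      have "(\<integral>\<^sup>+y. ennreal (norm (flow_conv f k y) powr q) \<partial>\<mu>)
          \<le> (\<integral>\<^sup>+y. ennreal (m powr q) * (\<integral>\<^sup>+t. ennreal (norm (k t) / m) * ennreal (norm (f (y + \<beta> t)) powr q) \<partial>lborel) \<partial>\<mu>)"
        by (rule nn_integral_mono_AE[OF point])
      also have "\<dots> = ennreal (m powr q) * (\<integral>\<^sup>+y. (\<integral>\<^sup>+t. ennreal (norm (k t) / m) * ennreal (norm (f (y + \<beta> t)) powr q) \<partial>lborel) \<partial>\<mu>)"
        by (rule nn_integral_cmult) (use mt in measurable)
      also have "(\<integral>\<^sup>+y. (\<integral>\<^sup>+t. ennreal (norm (k t) / m) * ennreal (norm (f (y + \<beta> t)) powr q) \<partial>lborel) \<partial>\<mu>)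
          = (\<integral>\<^sup>+t. (\<integral>\<^sup>+y. ennreal (norm (k t) / m) * ennreal (norm (f (y + \<beta> t)) powr q) \<partial>\<mu>) \<partial>lborel)"
        by (rule TG.Fubini'[OF mt])
      also have "\<dots> = (\<integral>\<^sup>+t. ennreal (norm (k t) / m) * (\<integral>\<^sup>+y. ennreal (norm (f y) powr q) \<partial>\<mu>) \<partial>lborel)"
      proof (rule nn_integral_cong)
        fix t
        have "(\<integral>\<^sup>+y. ennreal (norm (k t) / m) * ennreal (norm (f (y + \<beta> t)) powr q) \<partial>\<mu>)
            = ennreal (norm (k t) / m) * (\<integral>\<^sup>+y. ennreal (norm (f (y + \<beta> t)) powr q) \<partial>\<mu>)"
          by (rule nn_integral_cmult) measurable
        also have "(\<integral>\<^sup>+y. ennreal (norm (f (y + \<beta> t)) powr q) \<partial>\<mu>) = (\<integral>\<^sup>+y. ennreal (norm (f y) powr q) \<partial>\<mu>)"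
          by (rule nn_integral_shift[of "\<lambda>y. ennreal (norm (f y) powr q)"]) measurable
        finally show "(\<integral>\<^sup>+y. ennreal (norm (k t) / m) * ennreal (norm (f (y + \<beta> t)) powr q) \<partial>\<mu>)
            = ennreal (norm (k t) / m) * (\<integral>\<^sup>+y. ennreal (norm (f y) powr q) \<partial>\<mu>)" .
      qed
      also have "\<dots> = (\<integral>\<^sup>+t. ennreal (norm (k t) / m) \<partial>lborel) * (\<integral>\<^sup>+y. ennreal (norm (f y) powr q) \<partial>\<mu>)"
        by (rule nn_integral_multc) measurable
      also have "(\<integral>\<^sup>+t. ennreal (norm (k t) / m) \<partial>lborel) = 1"
        using N.emeasure_space_1 by (simp add: \<nu>_def emeasure_density)
      finally have "(\<integral>\<^sup>+y. ennreal (norm (flow_conv f k y) powr q) \<partial>\<mu>) \<le> ennreal (m powr q) * (\<integral>\<^sup>+y. ennreal (norm (f y) powr q) \<partial>\<mu>)"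
        by simp
      also have "\<dots> \<le> ennreal (m powr q) * ennreal (C powr q)" by (intro mult_left_mono le) simp
      also have "\<dots> = ennreal ((m * C) powr q)" using m C by (simp add: powr_mult flip: ennreal_mult)
      finally show ?thesis .
    qed
    then show ?thesis using False ci C m by (auto simp: Lp_bound_def m_def q_def)
  qed
qed

lemma fourier_coeff_flow_conv:
  assumes f: "integrable \<mu> f" and k: "integrable lborel k" and h: "h \<in> characters"
  shows "fourier_coeff \<mu> (flow_conv f k) h = fourier_coeff \<mu> f h * (\<integral>t. k t * h (\<beta> t) \<partial>lborel)"
proof -
  have "fourier_coeff \<mu> (flow_conv f k) h = (\<integral>t. k t * (\<integral>y. f (y + \<beta> t) * cnj (h y) \<partial>\<mu>) \<partial>lborel)"
    unfolding fourier_coeff_def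
    by (rule flow_conv_pairing[OF f k, of "\<lambda>y. cnj (h y)" 1]) (use h character_measurable[OF h] in \<open>auto simp: characters_def\<close>)
  also have "\<dots> = (\<integral>t. fourier_coeff \<mu> f h * (k t * h (\<beta> t)) \<partial>lborel)"
    using fourier_coeff_shift[OF f h] unfolding fourier_coeff_def by (simp only: mult_ac)
  also have "\<dots> = fourier_coeff \<mu> f h * (\<integral>t. k t * h (\<beta> t) \<partial>lborel)" by (rule integral_mult_right_zero)
  finally show ?thesis .
qed

end

section \<open>Representing functions and multipliers of Dirichlet series\<close>

lemma tent_zero: "1 \<le> \<bar>x\<bar> \<Longrightarrow> tent x = 0"
  by (simp add: tent_def)

lemma tent_bounds: "0 \<le> tent x" "tent x \<le> 1"
  by (simp_all add: tent_def)

definition fejer_scaled :: "real \<Rightarrow> real \<Rightarrow> complex" where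
  "fejer_scaled R t = of_real (R * fejer (R * t))"

lemma
  assumes R: "0 < R"
  shows integrable_fejer_scaled: "integrable lborel (fejer_scaled R)"
    and fourier_fejer_scaled: "fourier (fejer_scaled R) x = of_real (tent (x / R))"
    and norm_fejer_scaled: "(\<integral>t. norm (fejer_scaled R t) \<partial>lborel) = 1"
    and integral_fejer_scaled: "(\<integral>t. f t * fejer_scaled R t \<partial>lborel) = (\<integral>v. f (v / R) * of_real (fejer v) \<partial>lborel)"
proof -
  have "integrable lborel (\<lambda>t. R * fejer (0 + R * t))"
    using R by (intro integrable_mult_right lborel_integrable_real_affine integrable_fejer) simp
  then show "integrable lborel (fejer_scaled R)"
    unfolding fejer_scaled_def by (intro integrable_of_real) simp
  have sub: "(\<integral>t. F t \<partial>lborel) = \<bar>1 / R\<bar> *\<^sub>R (\<integral>v. F (0 + 1 / R * v) \<partial>lborel)" for F :: "real \<Rightarrow> complex"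
    by (rule lborel_integral_real_affine) (use R in simp)
  show gen: "(\<integral>t. f t * fejer_scaled R t \<partial>lborel) = (\<integral>v. f (v / R) * of_real (fejer v) \<partial>lborel)" for f
  proof -
    have "(\<integral>t. f t * fejer_scaled R t \<partial>lborel) = of_real (1 / R) * (\<integral>v. of_real R * (f (v / R) * of_real (fejer v)) \<partial>lborel)"
      using R by (subst sub) (simp add: fejer_scaled_def scaleR_conv_of_real mult_ac)
    also have "\<dots> = (\<integral>v. f (v / R) * of_real (fejer v) \<partial>lborel)"
      using R by (simp only: integral_mult_right_zero) simp
    finally show ?thesis .
  qed
  have "fourier (fejer_scaled R) x = (\<integral>t. exp (- \<i> * of_real (x * t)) * fejer_scaled R t \<partial>lborel)"
    by (simp only: fourier_def mult.commute)
  also have "\<dots> = (\<integral>v. exp (- \<i> * of_real (x * (v / R))) * of_real (fejer v) \<partial>lborel)" by (rule gen)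
  also have "\<dots> = fourier (\<lambda>v. of_real (fejer v)) (x / R)"
    by (simp add: fourier_def mult.commute)
  finally show "fourier (fejer_scaled R) x = of_real (tent (x / R))" by (simp only: fourier_fejer)
  have n: "norm (fejer_scaled R t) = R * fejer (R * t)" for t
    unfolding fejer_scaled_def norm_of_real using R fejer_nonneg by (intro abs_of_nonneg) simp
  have "complex_of_real (\<integral>t. norm (fejer_scaled R t) \<partial>lborel) = (\<integral>t. complex_of_real (norm (fejer_scaled R t)) \<partial>lborel)"
    by (rule integral_complex_of_real[symmetric])
  also have "\<dots> = (\<integral>t. 1 * fejer_scaled R t \<partial>lborel)"
    unfolding n by (simp only: fejer_scaled_def mult_1)
  also have "\<dots> = (\<integral>v. 1 * of_real (fejer v) \<partial>lborel)" by (rule gen)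
  also have "\<dots> = of_real 1" using integral_fejer by (simp add: integral_complex_of_real)
  finally show "(\<integral>t. norm (fejer_scaled R t) \<partial>lborel) = 1" unfolding of_real_eq_iff .
qed

locale frequency_flow = flow_group \<beta> \<mu>
  for \<beta> :: "real \<Rightarrow> 'g::{t2_space,topological_ab_group_add}" and \<mu> :: "'g measure" +
  fixes lam :: "nat \<Rightarrow> real"
  assumes freq: "frequency lam" and dirichlet: "dirichlet_group lam \<beta>"
begin

abbreviation hchar :: "nat \<Rightarrow> 'g \<Rightarrow> complex" where "hchar n \<equiv> char_of \<beta> (lam n)"

lemma hchar_char: "hchar n \<in> characters"
  by (rule char_of_in_characters[OF dirichlet])

lemma hchar_flow: "hchar n (\<beta> t) = exp (- \<i> * of_real (lam n * t))"
  by (rule char_of_apply[OF dirichlet])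

lemma hchar_add_flow: "hchar n (y + \<beta> t) = hchar n y * exp (- \<i> * of_real (lam n * t))"
  using hchar_char[of n] unfolding characters_def hchar_flow[symmetric] by blast

lemma norm_hchar [simp]: "norm (hchar n y) = 1"
  using hchar_char[of n] unfolding characters_def by blast

lemma lam_nonneg: "0 \<le> lam n"
  using freq by (simp add: frequency_def)

text \<open>At time \<open>\<pi> / (\<lambda>\<^sub>n - \<lambda>\<^sub>m)\<close> the two characters have opposite signs.\<close>

lemma hchar_inj: "hchar n = hchar m \<longleftrightarrow> n = m"
proof
  assume eq: "hchar n = hchar m"
  show "n = m"
  proof (rule ccontr)
    assume "n \<noteq> m"
    then have ne: "lam n \<noteq> lam m" using freq by (metis frequency_def strict_mono_eq)
    define t where "t = pi / (lam n - lam m)"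
    have "exp (- \<i> * of_real (lam n * t)) = exp (- \<i> * of_real (lam m * t))"
      unfolding hchar_flow[symmetric] eq ..
    moreover have "lam n * t = lam m * t + pi"
      using ne by (simp add: t_def field_simps)
    then have "exp (- \<i> * of_real (lam n * t)) = exp (- \<i> * of_real (lam m * t)) * exp (- \<i> * of_real pi)"
      by (simp add: distrib_left flip: exp_add)
    moreover have "exp (- \<i> * of_real pi) = (-1 :: complex)" by (simp add: exp_minus exp_pi_i')
    ultimately show False by (simp add: exp_not_eq_zero)
  qed
qed simp

lemma finite_below: "finite {n. lam n < R}"
proof -
  obtain N where "R < lam N" using freq by (auto simp: frequency_def bdd_above_def not_le)
  then have "{n. lam n < R} \<subseteq> {..N}"
    using freq by (force simp: frequency_def dest: strict_monoD[of lam N] intro: leI)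
  then show ?thesis by (rule finite_subset) simp
qed

definition trig_poly :: "nat set \<Rightarrow> (nat \<Rightarrow> complex) \<Rightarrow> 'g \<Rightarrow> complex" where
  "trig_poly I c y = (\<Sum>n\<in>I. c n * hchar n y)"

lemma trig_poly_continuous: "continuous_on UNIV (trig_poly I c)"
  unfolding trig_poly_def using hchar_char by (intro continuous_intros) (auto simp: characters_def)

lemma trig_poly_measurable [measurable]: "trig_poly I c \<in> borel_measurable borel"
  by (rule borel_measurable_continuous_onI[OF trig_poly_continuous])

lemma trig_poly_norm_le: "norm (trig_poly I c y) \<le> (\<Sum>n\<in>I. norm (c n))"
  unfolding trig_poly_def by (rule order_trans[OF norm_sum]) (simp add: norm_mult)

lemma trig_poly_integrable: "integrable \<mu> (trig_poly I c)"
  by (rule integrable_bounded[OF trig_poly_measurable trig_poly_norm_le])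

lemma trig_poly_diff: "trig_poly I c y - trig_poly I d y = trig_poly I (\<lambda>n. c n - d n) y"
  by (simp add: trig_poly_def left_diff_distrib sum_subtractf)

lemma trig_poly_flow: "trig_poly I c (y + \<beta> t) = (\<Sum>n\<in>I. (c n * hchar n y) * exp (- \<i> * of_real (lam n * t)))"
  by (simp add: trig_poly_def hchar_add_flow mult_ac)

lemma flow_conv_trig_poly:
  assumes k: "integrable lborel k"
  shows "flow_conv (trig_poly I c) k y = trig_poly I (\<lambda>n. c n * fourier k (lam n)) y"
proof -
  have "flow_conv (trig_poly I c) k y = (\<integral>t. (\<Sum>n\<in>I. (c n * hchar n y) * (k t * exp (- \<i> * of_real (lam n * t)))) \<partial>lborel)"
    unfolding flow_conv_def trig_poly_flow sum_distrib_right by (simp only: mult_ac)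
  also have "\<dots> = (\<Sum>n\<in>I. \<integral>t. (c n * hchar n y) * (k t * exp (- \<i> * of_real (lam n * t))) \<partial>lborel)"
    by (rule Bochner_Integration.integral_sum) (intro integrable_mult_right fourier_integrable k)
  also have "\<dots> = trig_poly I (\<lambda>n. c n * fourier k (lam n)) y"
    unfolding trig_poly_def fourier_def integral_mult_right_zero by (intro sum.cong refl) (simp only: mult_ac)
  finally show ?thesis .
qed

lemma fourier_coeff_trig_poly:
  assumes I: "finite I" and h: "h \<in> characters"
  shows "fourier_coeff \<mu> (trig_poly I c) h = (\<Sum>n\<in>I. if hchar n = h then c n else 0)"
proof -
  have i: "integrable \<mu> (\<lambda>y. hchar n y * cnj (h y))" for n
  proof (rule integrable_bounded)
    show "norm (hchar n y * cnj (h y)) \<le> 1" for y using h by (simp add: norm_mult characters_def)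
    show "(\<lambda>y. hchar n y * cnj (h y)) \<in> borel_measurable borel"
      using character_measurable[OF hchar_char[of n]] character_measurable[OF h] by measurable
  qed
  have "fourier_coeff \<mu> (trig_poly I c) h = (\<integral>y. (\<Sum>n\<in>I. c n * (hchar n y * cnj (h y))) \<partial>\<mu>)"
    unfolding fourier_coeff_def trig_poly_def sum_distrib_right by (simp only: mult_ac)
  also have "\<dots> = (\<Sum>n\<in>I. c n * fourier_coeff \<mu> (hchar n) h)"
    unfolding fourier_coeff_def using i
    by (subst Bochner_Integration.integral_sum) (simp_all only: integrable_mult_right integral_mult_right_zero)
  also have "\<dots> = (\<Sum>n\<in>I. if hchar n = h then c n else 0)"
    by (intro sum.cong refl) (simp add: character_orthogonality[OF hchar_char h])
  finally show ?thesis .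
qed

lemma fourier_coeff_trig_poly_hchar:
  assumes "finite I"
  shows "fourier_coeff \<mu> (trig_poly I c) (hchar m) = (if m \<in> I then c m else 0)"
  using assms by (simp add: fourier_coeff_trig_poly[OF assms hchar_char] hchar_inj)

lemma trig_poly_Lp_bound:
  assumes "1 \<le> p"
  shows "Lp_bound p \<mu> (trig_poly I c) (\<Sum>n\<in>I. norm (c n))"
  by (rule Lp_bound_of_bounded[OF assms]) (auto simp: borel_measurable_\<mu>_iff trig_poly_norm_le sum_nonneg)

lemma representsI:
  assumes p: "1 \<le> p" and f: "Lp_bound p \<mu> f C"
    and out: "\<And>h. h \<in> characters \<Longrightarrow> h \<notin> range hchar \<Longrightarrow> fourier_coeff \<mu> f h = 0"
    and co: "\<And>n. fourier_coeff \<mu> f (hchar n) = a n"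
  shows "represents p lam \<beta> \<mu> f a"
  using Lp_bound_imp(1)[OF p f] out co by (auto simp: represents_def Hp_group_def)

lemma represents_coeff:
  assumes "represents p lam \<beta> \<mu> f a"
  shows "fourier_coeff \<mu> f (hchar n) = a n" "h \<in> characters \<Longrightarrow> h \<notin> range hchar \<Longrightarrow> fourier_coeff \<mu> f h = 0"
  using assms by (auto simp: represents_def Hp_group_def)

lemma represents_Lp_bound:
  assumes "1 \<le> p" "represents p lam \<beta> \<mu> f a"
  shows "Lp_bound p \<mu> f (Lp_norm p \<mu> f)"
  using assms by (intro Lp_bound_norm) (auto simp: represents_def Hp_group_def)

lemma represents_integrable:
  assumes "1 \<le> p" "represents p lam \<beta> \<mu> f a"
  shows "integrable \<mu> f"
  by (rule Lp_bound_integrable(1)[OF assms(1) represents_Lp_bound[OF assms]])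

lemma represents_unique:
  assumes p: "1 \<le> p" and f: "represents p lam \<beta> \<mu> f a" and g: "represents p lam \<beta> \<mu> g a"
  shows "AE y in \<mu>. f y = g y"
proof -
  note fi = represents_integrable[OF p f] and gi = represents_integrable[OF p g]
  have "AE y in \<mu>. f y - g y = 0"
  proof (rule fourier_uniqueness)
    show "integrable \<mu> (\<lambda>y. f y - g y)" using fi gi by (rule Bochner_Integration.integrable_diff)
    fix h :: "'g \<Rightarrow> complex" assume h: "h \<in> characters"
    have "fourier_coeff \<mu> f h = fourier_coeff \<mu> g h"
    proof (cases "h \<in> range hchar")
      case True
      then show ?thesis using represents_coeff(1)[OF f] represents_coeff(1)[OF g] by auto
    next
      case False
      then show ?thesis using represents_coeff(2)[OF f h] represents_coeff(2)[OF g h] by auto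
    qed
    then show "fourier_coeff \<mu> (\<lambda>y. f y - g y) h = 0" by (simp add: fourier_coeff_diff[OF fi gi h])
  qed
  then show ?thesis by simp
qed

text \<open>The norm refers to some chosen representing function; by uniqueness every bound on one of them
transfers to the chosen one.\<close>

lemma Hp_norm_le:
  assumes p: "1 \<le> p" and f: "represents p lam \<beta> \<mu> f a" and C: "Lp_bound p \<mu> f C"
  shows "Hp_norm p lam \<beta> \<mu> a \<le> C" "0 \<le> Hp_norm p lam \<beta> \<mu> a"
proof -
  define g where "g = (SOME f. represents p lam \<beta> \<mu> f a)"
  have g: "represents p lam \<beta> \<mu> g a" unfolding g_def by (rule someI[of "\<lambda>f. represents p lam \<beta> \<mu> f a", OF f])
  have b: "Lp_bound p \<mu> g C"
    by (rule Lp_bound_AE_cong[OF p C Lp_bound_measurable[OF represents_Lp_bound[OF p g]] represents_unique[OF p f g]])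
  show "Hp_norm p lam \<beta> \<mu> a \<le> C" using Lp_bound_imp(2)[OF p b] by (simp add: Hp_norm_def g_def)
  show "0 \<le> Hp_norm p lam \<beta> \<mu> a" using Lp_bound_nonneg[OF represents_Lp_bound[OF p g]] by (simp add: Hp_norm_def g_def)
qed

lemma Hp_obtain:
  assumes p: "1 \<le> p" and a: "a \<in> Hp p lam \<beta> \<mu>" and C: "Hp_norm p lam \<beta> \<mu> a \<le> C"
  obtains f where "represents p lam \<beta> \<mu> f a" "Lp_bound p \<mu> f C"
proof -
  define g where "g = (SOME f. represents p lam \<beta> \<mu> f a)"
  have g: "represents p lam \<beta> \<mu> g a"
    unfolding g_def by (rule someI_ex[of "\<lambda>f. represents p lam \<beta> \<mu> f a"]) (use a in \<open>simp add: Hp_def\<close>)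
  have "Lp_norm p \<mu> g \<le> C" using C by (simp add: Hp_norm_def g_def)
  then show ?thesis using that[OF g] Lp_bound_mono[OF represents_Lp_bound[OF p g]] by blast
qed

lemma represents_flow_conv:
  assumes p: "1 \<le> p" and f: "represents p lam \<beta> \<mu> f a" and k: "integrable lborel k"
  shows "represents p lam \<beta> \<mu> (flow_conv f k) (\<lambda>n. a n * fourier k (lam n))"
proof (rule representsI[OF p Lp_bound_flow_conv[OF p represents_Lp_bound[OF p f] k]])
  note co = fourier_coeff_flow_conv[OF represents_integrable[OF p f] k]
  show "fourier_coeff \<mu> (flow_conv f k) h = 0" if "h \<in> characters" "h \<notin> range hchar" for h
    using co[OF that(1)] represents_coeff(2)[OF f that] by simp
  show "fourier_coeff \<mu> (flow_conv f k) (hchar n) = a n * fourier k (lam n)" for n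
    using co[OF hchar_char[of n]] represents_coeff(1)[OF f] by (simp add: fourier_def hchar_flow)
qed

lemma represents_trig_poly:
  assumes p: "1 \<le> p" and I: "finite I" and c: "\<And>n. n \<notin> I \<Longrightarrow> c n = 0"
  shows "represents p lam \<beta> \<mu> (trig_poly I c) c"
proof (rule representsI[OF p trig_poly_Lp_bound[OF p]])
  show "fourier_coeff \<mu> (trig_poly I c) h = 0" if "h \<in> characters" "h \<notin> range hchar" for h
    unfolding fourier_coeff_trig_poly[OF I that(1)] using that(2) by (intro sum.neutral) auto
  show "fourier_coeff \<mu> (trig_poly I c) (hchar n) = c n" for n
    using c by (simp add: fourier_coeff_trig_poly_hchar[OF I])
qed

lemma fourier_coeff_uminus: "fourier_coeff \<mu> (\<lambda>y. - f y) h = - fourier_coeff \<mu> f h"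
  by (simp add: fourier_coeff_def)

lemma represents_uminus:
  assumes p: "1 \<le> p" and f: "represents p lam \<beta> \<mu> f a"
  shows "represents p lam \<beta> \<mu> (\<lambda>y. - f y) (\<lambda>n. - a n)"
  using represents_coeff[OF f]
  by (intro representsI[OF p Lp_bound_uminus[OF represents_Lp_bound[OF p f]]]) (simp_all add: fourier_coeff_uminus)

lemma represents_add:
  assumes p: "1 \<le> p" and f: "represents p lam \<beta> \<mu> f a" and g: "represents p lam \<beta> \<mu> g b"
  shows "represents p lam \<beta> \<mu> (\<lambda>y. f y + g y) (\<lambda>n. a n + b n)"
proof -
  note fi = represents_integrable[OF p f] and gi = represents_integrable[OF p g]
  have gi': "integrable \<mu> (\<lambda>y. - g y)" using gi by simp
  have co: "fourier_coeff \<mu> (\<lambda>y. f y + g y) h = fourier_coeff \<mu> f h + fourier_coeff \<mu> g h" if "h \<in> characters" for h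
    using fourier_coeff_diff[OF fi gi' that] by (simp add: fourier_coeff_uminus)
  show ?thesis
    by (rule representsI[OF p Lp_bound_add[OF p represents_Lp_bound[OF p f] represents_Lp_bound[OF p g]]])
       (use represents_coeff[OF f] represents_coeff[OF g] co hchar_char in simp_all)
qed

lemma represents_translate:
  assumes p: "1 \<le> p" and f: "represents p lam \<beta> \<mu> f a" and \<sigma>: "0 < \<sigma>"
  shows "represents p lam \<beta> \<mu> (flow_conv f (\<lambda>t. of_real (poisson \<sigma> t))) (translate lam \<sigma> a)"
proof -
  have "integrable lborel (\<lambda>t. complex_of_real (poisson \<sigma> t))" using \<sigma> by (intro integrable_of_real) auto
  from represents_flow_conv[OF p f this] show ?thesis
    by (simp add: translate_def fourier_poisson[OF \<sigma> lam_nonneg])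
qed

text \<open>The multiplier \<open>e\<^sup>-\<^sup>\<lambda>\<^sup>\<sigma>\<close> is split by the tent of radius \<open>R\<close>.  The part \<open>e\<^sup>-\<^sup>\<lambda>\<^sup>\<sigma> (1 - tent)\<close> comes from the
kernel \<open>smoothing_error\<close> of small \<open>L\<^sub>1\<close> norm, and the remaining part is a polynomial whose coefficients
are at most those of \<open>a\<close>.\<close>

lemma translate_norm_le:
  assumes p: "1 \<le> p" and f: "represents p lam \<beta> \<mu> f a" and C: "Lp_bound p \<mu> f C"
    and \<sigma>: "0 < \<sigma>" and R: "0 < R"
  shows "Hp_norm p lam \<beta> \<mu> (translate lam \<sigma> a)
     \<le> 4 * ((\<integral>t. \<bar>smoothing_error \<sigma> R t\<bar> \<partial>lborel) * C + (\<Sum>n | lam n < R. norm (a n)))"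
proof -
  define I where "I = {n. lam n < R}"
  have I: "finite I" unfolding I_def by (rule finite_below)
  define k where "k = (\<lambda>t. complex_of_real (smoothing_error \<sigma> R t))"
  have k: "integrable lborel k" unfolding k_def by (intro integrable_of_real smoothing_error(1)[OF \<sigma> R])
  define c where "c = (\<lambda>n. a n * of_real (exp (- lam n * \<sigma>) * tent (lam n / R)))"
  have c0: "c n = 0" if "n \<notin> I" for n
  proof -
    have "1 \<le> lam n / R" using that R by (simp add: I_def)
    then have "tent (lam n / R) = 0" by (intro tent_zero order_trans[OF _ abs_ge_self])
    then show ?thesis by (simp add: c_def)
  qed
  have co: "a n * fourier k (lam n) + c n = translate lam \<sigma> a n" for n
    unfolding k_def smoothing_error(3)[OF \<sigma> R lam_nonneg] c_def translate_def
    by (simp add: algebra_simps)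
  have cn: "norm (c n) \<le> norm (a n)" for n
  proof -
    have "exp (- lam n * \<sigma>) * tent (lam n / R) \<le> 1 * 1"
      using lam_nonneg[of n] \<sigma> by (intro mult_mono tent_bounds) auto
    moreover have "0 \<le> exp (- lam n * \<sigma>) * tent (lam n / R)" by (intro mult_nonneg_nonneg tent_bounds) simp
    ultimately have "\<bar>exp (- lam n * \<sigma>) * tent (lam n / R)\<bar> \<le> 1" by simp
    then show ?thesis unfolding c_def norm_mult norm_of_real by (intro mult_right_le_one_le) auto
  qed
  have rep: "represents p lam \<beta> \<mu> (\<lambda>y. flow_conv f k y + trig_poly I c y) (translate lam \<sigma> a)"
    using represents_add[OF p represents_flow_conv[OF p f k] represents_trig_poly[where c=c, OF p I c0]] by (simp add: co)
  have "Lp_bound p \<mu> (\<lambda>y. flow_conv f k y + trig_poly I c y) (4 * ((\<integral>t. norm (k t) \<partial>lborel) * C + (\<Sum>n\<in>I. norm (c n))))"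
    by (rule Lp_bound_add[OF p Lp_bound_flow_conv[OF p C k] trig_poly_Lp_bound[OF p]])
  from Hp_norm_le(1)[OF p rep this]
  have "Hp_norm p lam \<beta> \<mu> (translate lam \<sigma> a) \<le> 4 * ((\<integral>t. norm (k t) \<partial>lborel) * C + (\<Sum>n\<in>I. norm (c n)))" .
  also have "\<dots> \<le> 4 * ((\<integral>t. \<bar>smoothing_error \<sigma> R t\<bar> \<partial>lborel) * C + (\<Sum>n\<in>I. norm (a n)))"
    using sum_mono[of I "\<lambda>n. norm (c n)" "\<lambda>n. norm (a n)"] cn by (simp add: k_def)
  finally show ?thesis by (simp add: I_def)
qed

lemma translate_norm_tendsto:
  assumes p: "1 \<le> p" and f: "\<And>k. represents p lam \<beta> \<mu> (f k) (a k)" and C: "\<And>k. Lp_bound p \<mu> (f k) C"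
    and lim: "\<And>n. (\<lambda>k. a k n) \<longlonglongrightarrow> 0" and \<sigma>: "0 < \<sigma>"
  shows "(\<lambda>k::nat. Hp_norm p lam \<beta> \<mu> (translate lam \<sigma> (a k))) \<longlonglongrightarrow> 0"
proof (rule LIMSEQ_I)
  fix e :: real assume e: "0 < e"
  have "(\<lambda>n. (\<integral>t. \<bar>smoothing_error \<sigma> (real (Suc n)) t\<bar> \<partial>lborel) * C) \<longlonglongrightarrow> 0 * C"
    by (rule tendsto_mult[OF smoothing_error_tendsto[OF \<sigma>] tendsto_const])
  then have "\<forall>\<^sub>F n in sequentially. (\<integral>t. \<bar>smoothing_error \<sigma> (real (Suc n)) t\<bar> \<partial>lborel) * C < e / 8"
    by (rule order_tendstoD(2)) (use e in simp)
  then obtain m where m: "(\<integral>t. \<bar>smoothing_error \<sigma> (real (Suc m)) t\<bar> \<partial>lborel) * C < e / 8"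
    by (auto simp: eventually_sequentially)
  define R where "R = real (Suc m)"
  have R: "0 < R" by (simp add: R_def)
  have "(\<lambda>k. \<Sum>n | lam n < R. norm (a k n)) \<longlonglongrightarrow> (\<Sum>n | lam n < R. norm (0::complex))"
    by (intro tendsto_sum tendsto_norm lim)
  then have "\<forall>\<^sub>F k in sequentially. (\<Sum>n | lam n < R. norm (a k n)) < e / 8"
    by (rule order_tendstoD(2)) (use e in simp)
  then obtain K where K: "\<And>k. k \<ge> K \<Longrightarrow> (\<Sum>n | lam n < R. norm (a k n)) < e / 8"
    by (auto simp: eventually_sequentially)
  show "\<exists>K. \<forall>k\<ge>K. norm (Hp_norm p lam \<beta> \<mu> (translate lam \<sigma> (a k)) - 0) < e"
  proof (intro exI allI impI)
    fix k assume k: "K \<le> k"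
    have "Hp_norm p lam \<beta> \<mu> (translate lam \<sigma> (a k))
      \<le> 4 * ((\<integral>t. \<bar>smoothing_error \<sigma> R t\<bar> \<partial>lborel) * C + (\<Sum>n | lam n < R. norm (a k n)))"
      by (rule translate_norm_le[OF p f C \<sigma> R])
    also have "\<dots> < 4 * (e / 8 + e / 8)"
      by (intro mult_strict_left_mono add_strict_mono m[folded R_def] K[OF k]) simp
    also have "\<dots> = e" by simp
    finally have "Hp_norm p lam \<beta> \<mu> (translate lam \<sigma> (a k)) < e" .
    moreover have "0 \<le> Hp_norm p lam \<beta> \<mu> (translate lam \<sigma> (a k))"
    proof -
      have r: "represents p lam \<beta> \<mu> (flow_conv (f k) (\<lambda>t. of_real (poisson \<sigma> t))) (translate lam \<sigma> (a k))"
        by (rule represents_translate[OF p f \<sigma>])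
      show ?thesis by (rule Hp_norm_le(2)[OF p r represents_Lp_bound[OF p r]])
    qed
    ultimately show "norm (Hp_norm p lam \<beta> \<mu> (translate lam \<sigma> (a k)) - 0) < e" by simp
  qed
qed

text \<open>The flow convolution with the Fejer kernel does not increase the bound.  Its coefficients are those
of the polynomial, so by uniqueness the two agree a.e.\<close>

lemma fejer_mean_Lp_bound:
  assumes p: "1 \<le> p" and f: "represents p lam \<beta> \<mu> f a" and C: "Lp_bound p \<mu> f C" and R: "0 < R"
  shows "Lp_bound p \<mu> (trig_poly {n. lam n < R} (\<lambda>n. a n * of_real (tent (lam n / R)))) C"
proof -
  let ?I = "{n. lam n < R}" and ?c = "\<lambda>n. a n * complex_of_real (tent (lam n / R))"
  have c0: "?c n = 0" if "n \<notin> ?I" for n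
  proof -
    have "1 \<le> lam n / R" using that R by simp
    then have "tent (lam n / R) = 0" by (intro tent_zero order_trans[OF _ abs_ge_self])
    then show ?thesis by simp
  qed
  note k = integrable_fejer_scaled[OF R]
  have r: "represents p lam \<beta> \<mu> (flow_conv f (fejer_scaled R)) ?c"
    using represents_flow_conv[OF p f k] by (simp add: fourier_fejer_scaled[OF R])
  have ae: "AE y in \<mu>. flow_conv f (fejer_scaled R) y = trig_poly ?I ?c y"
    by (rule represents_unique[OF p r represents_trig_poly[where c="?c", OF p finite_below c0]])
  have b: "Lp_bound p \<mu> (flow_conv f (fejer_scaled R)) C"
    using Lp_bound_flow_conv[OF p C k] by (simp add: norm_fejer_scaled[OF R])
  have "trig_poly ?I ?c \<in> borel_measurable \<mu>" by (simp add: borel_measurable_\<mu>_iff)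
  from Lp_bound_AE_cong[OF p b this ae] show ?thesis .
qed

end

section \<open>Stability of Poisson means in \<open>L\<^sub>1\<close>\<close>

text \<open>The distance is controlled by the difference of the moduli, through \<open>(\<bar>w\<bar>\<^sup>1\<^sup>/\<^sup>2 - \<bar>v\<bar>\<^sup>1\<^sup>/\<^sup>2)\<^sup>2\<close>, and by the
misalignment \<open>\<bar>w\<bar> - Re (cnj (sgn v) w)\<close> of the arguments.  Both enter under a square root, which the
parameter \<open>s\<close> of the arithmetic-geometric mean inequality resolves into terms that can be integrated
separately.\<close>

lemma stability_pointwise:
  fixes w v :: complex
  assumes s: "0 < s"
  shows "norm (w - v) \<le> s / 2 * (norm w + norm v - 2 * (sqrt (norm v) * sqrt (norm w))) + (norm w + norm v) / s
     + s * (norm w - Re (cnj (sgn v) * w)) + norm v / s"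
proof -
  define a where "a = sqrt (norm w)"
  define b where "b = sqrt (norm v)"
  have ab: "0 \<le> a" "0 \<le> b" "norm w = a * a" "norm v = b * b" by (simp_all add: a_def b_def)
  define Z where "Z = norm w - Re (cnj (sgn v) * w)"
  have "Re (cnj (sgn v) * w) \<le> norm (cnj (sgn v) * w)" by (rule complex_Re_le_cmod)
  also have "\<dots> \<le> 1 * norm w" unfolding norm_mult by (intro mult_right_mono) (auto simp: norm_sgn)
  finally have Z: "0 \<le> Z" by (simp add: Z_def)
  have vs: "norm v * Re (cnj (sgn v) * w) = Re (cnj v * w)"
    by (cases "v = 0") (simp_all add: sgn_div_norm scaleR_conv_of_real field_simps)
  have "(norm (w - v))\<^sup>2 = (norm w - norm v)\<^sup>2 + 2 * norm v * Z"
  proof -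
    have "(norm (w - v))\<^sup>2 = (norm w)\<^sup>2 + (norm v)\<^sup>2 - 2 * Re (cnj v * w)"
      unfolding cmod_power2 by (simp add: power2_eq_square algebra_simps)
    also have "\<dots> = (norm w - norm v)\<^sup>2 + 2 * norm v * Z"
      unfolding Z_def vs[symmetric] by (simp add: power2_eq_square algebra_simps)
    finally show ?thesis .
  qed
  then have "norm (w - v) = sqrt ((norm w - norm v)\<^sup>2 + 2 * norm v * Z)"
    by (metis norm_ge_zero real_sqrt_unique)
  also have "\<dots> \<le> sqrt ((norm w - norm v)\<^sup>2) + sqrt (2 * norm v * Z)"
    by (rule sqrt_add_le_add_sqrt) (use Z in auto)
  also have "sqrt ((norm w - norm v)\<^sup>2) = \<bar>a - b\<bar> * (a + b)"
  proof -
    have "norm w - norm v = (a - b) * (a + b)" by (simp add: ab algebra_simps)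
    then show ?thesis using ab(1,2) by (simp add: abs_mult)
  qed
  also have "\<dots> \<le> s / 2 * (norm w + norm v - 2 * (b * a)) + (norm w + norm v) / s"
  proof -
    have sq: "s / 2 * ((a - b) * (a - b)) + (a + b) * (a + b) / (2 * s) - \<bar>a - b\<bar> * (a + b)
       = (s * \<bar>a - b\<bar> - (a + b))\<^sup>2 / (2 * s)"
    proof -
      have abs2: "(a - b) * (a - b) = \<bar>a - b\<bar> * \<bar>a - b\<bar>" by (simp add: abs_mult[symmetric])
      have "s / 2 * (d * d) + p * p / (2 * s) - d * p = (s * d - p)\<^sup>2 / (2 * s)" for d p
        using s by (simp add: power2_eq_square field_simps)
      then show ?thesis unfolding abs2 .
    qed
    moreover have "0 \<le> (s * \<bar>a - b\<bar> - (a + b))\<^sup>2 / (2 * s)" using s by simp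
    ultimately have 1: "\<bar>a - b\<bar> * (a + b) \<le> s / 2 * ((a - b) * (a - b)) + (a + b) * (a + b) / (2 * s)" by linarith
    have 2: "(a + b) * (a + b) / (2 * s) \<le> (2 * (a * a + b * b)) / (2 * s)"
    proof (rule divide_right_mono)
      have "0 \<le> (a - b)\<^sup>2" by simp
      then show "(a + b) * (a + b) \<le> 2 * (a * a + b * b)" by (simp add: power2_eq_square algebra_simps)
    qed (use s in simp)
    have 3: "2 * (a * a + b * b) / (2 * s) = (norm w + norm v) / s"
      unfolding ab by (rule mult_divide_mult_cancel_left) simp
    have 4: "(a - b) * (a - b) = norm w + norm v - 2 * (b * a)" by (simp add: ab algebra_simps)
    show ?thesis using 1 2 unfolding 3 4 by linarith
  qed
  also have "sqrt (2 * norm v * Z) \<le> s * Z + norm v / s"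
  proof -
    have "2 * norm v * Z = (2 * s * Z) * (norm v / s)" using s by simp
    then have "sqrt (2 * norm v * Z) = sqrt ((2 * s * Z) * (norm v / s))" by (simp only:)
    also have "\<dots> \<le> (2 * s * Z + norm v / s) / 2"
      by (rule arith_geo_mean_sqrt) (use s Z in auto)
    also have "\<dots> = s * Z + norm v / s / 2" by simp
    also have "\<dots> \<le> s * Z + norm v / s"
    proof -
      have half: "x / 2 \<le> x" if "0 \<le> x" for x :: real using that by simp
      show ?thesis by (intro add_left_mono half) (use s in simp)
    qed
    finally show ?thesis .
  qed
  finally show ?thesis by (simp add: a_def b_def Z_def)
qed

lemma prob_space_density:
  assumes [measurable]: "k \<in> borel_measurable borel" and "\<And>t. 0 \<le> k t" "integrable lborel k" "(\<integral>t. k t \<partial>lborel) = (1::real)"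
  shows "prob_space (density lborel (\<lambda>t. ennreal (k t)))"
proof (rule prob_spaceI)
  have "emeasure (density lborel (\<lambda>t. ennreal (k t))) UNIV = (\<integral>\<^sup>+t. ennreal (k t) \<partial>lborel)"
    by (simp add: emeasure_density)
  also have "\<dots> = ennreal (\<integral>t. k t \<partial>lborel)" by (rule nn_integral_eq_integral) (use assms in auto)
  finally show "emeasure (density lborel (\<lambda>t. ennreal (k t))) (space (density lborel (\<lambda>t. ennreal (k t)))) = 1"
    using assms by simp
qed

lemma integral_density_real:
  fixes F :: "real \<Rightarrow> 'b::{banach,second_countable_topology}"
  assumes "k \<in> borel_measurable borel" "\<And>t. 0 \<le> k t" "F \<in> borel_measurable borel"
  shows "(\<integral>t. F t \<partial>density lborel (\<lambda>t. ennreal (k t))) = (\<integral>t. k t *\<^sub>R F t \<partial>lborel)"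
  by (rule integral_density) (use assms in auto)

context flow_group
begin

lemma prob_Fubini_bounded:
  fixes F :: "real \<times> 'g \<Rightarrow> 'b::{banach,second_countable_topology}"
  assumes N: "prob_space N" and sN: "sets N = sets borel"
    and F: "F \<in> borel_measurable (borel \<Otimes>\<^sub>M borel)" "\<And>z. norm (F z) \<le> B"
  shows "integrable (N \<Otimes>\<^sub>M \<mu>) F"
    and "(\<integral>y. (\<integral>t. F (t, y) \<partial>N) \<partial>\<mu>) = (\<integral>z. F z \<partial>(N \<Otimes>\<^sub>M \<mu>))"
    and "(\<integral>t. (\<integral>y. F (t, y) \<partial>\<mu>) \<partial>N) = (\<integral>z. F z \<partial>(N \<Otimes>\<^sub>M \<mu>))"
proof -
  interpret N: prob_space N by (rule N)
  interpret P: pair_prob_space N \<mu> ..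
  have m: "F \<in> borel_measurable (N \<Otimes>\<^sub>M \<mu>)"
    using F(1) by (simp add: measurable_cong_sets[OF sets_pair_measure_cong[OF sN sets_\<mu>] refl])
  show i: "integrable (N \<Otimes>\<^sub>M \<mu>) F"
    by (rule P.integrable_const_bound[OF AE_I2 m]) (rule F(2))
  have i': "integrable (N \<Otimes>\<^sub>M \<mu>) (\<lambda>(t, y). F (t, y))" using i by simp
  show "(\<integral>y. (\<integral>t. F (t, y) \<partial>N) \<partial>\<mu>) = (\<integral>z. F z \<partial>(N \<Otimes>\<^sub>M \<mu>))"
    using P.integral_snd[OF i'] by simp
  show "(\<integral>t. (\<integral>y. F (t, y) \<partial>\<mu>) \<partial>N) = (\<integral>z. F z \<partial>(N \<Otimes>\<^sub>M \<mu>))"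
    using P.integral_fst'[OF i] by simp
qed

lemma measurable_flow_pair [measurable]:
  assumes [measurable]: "f \<in> borel_measurable borel"
  shows "(\<lambda>z. f (snd z + \<beta> (fst z))) \<in> borel_measurable (borel \<Otimes>\<^sub>M borel)"
  using measurable_flow by measurable

definition L1_norm :: "('g \<Rightarrow> complex) \<Rightarrow> real" where "L1_norm f = (\<integral>y. norm (f y) \<partial>\<mu>)"

lemma L1_norm_nonneg: "0 \<le> L1_norm f"
  unfolding L1_norm_def by (rule Bochner_Integration.integral_nonneg) simp

lemma L1_norm_triangle:
  assumes "integrable \<mu> f" "integrable \<mu> g" "integrable \<mu> h"
  shows "L1_norm (\<lambda>y. f y - h y) \<le> L1_norm (\<lambda>y. f y - g y) + L1_norm (\<lambda>y. g y - h y)"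
proof -
  have i: "integrable \<mu> (\<lambda>y. norm (f y - g y))" "integrable \<mu> (\<lambda>y. norm (g y - h y))" "integrable \<mu> (\<lambda>y. norm (f y - h y))"
    using assms by (auto intro!: integrable_norm Bochner_Integration.integrable_diff)
  have "L1_norm (\<lambda>y. f y - h y) \<le> (\<integral>y. norm (f y - g y) + norm (g y - h y) \<partial>\<mu>)"
    unfolding L1_norm_def
  proof (rule integral_mono[OF i(3) Bochner_Integration.integrable_add[OF i(1,2)]])
    show "norm (f y - h y) \<le> norm (f y - g y) + norm (g y - h y)" for y
      using norm_triangle_ineq[of "f y - g y" "g y - h y"] by simp
  qed
  then show ?thesis using i by (simp add: L1_norm_def)
qed

lemma L1_norm_minus_commute: "L1_norm (\<lambda>y. f y - g y) = L1_norm (\<lambda>y. g y - f y)"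
  by (simp add: L1_norm_def norm_minus_commute)

lemma L1_norm_shift:
  assumes "f \<in> borel_measurable borel"
  shows "L1_norm (\<lambda>y. f (y + x)) = L1_norm f"
  unfolding L1_norm_def by (rule integral_shift[of "\<lambda>y. norm (f y)"]) (use assms in measurable)

lemma Lp_bound_1:
  assumes "integrable \<mu> f"
  shows "Lp_bound 1 \<mu> f (L1_norm f)"
proof -
  have "(\<integral>\<^sup>+y. ennreal (norm (f y)) \<partial>\<mu>) = ennreal (L1_norm f)"
    unfolding L1_norm_def by (rule nn_integral_eq_integral) (use assms in auto)
  then show ?thesis using assms L1_norm_nonneg[of f] by (simp add: Lp_bound_def borel_measurable_integrable)
qed

lemma L1_norm_flow_conv:
  assumes f: "integrable \<mu> f" and k: "integrable lborel k"
  shows "L1_norm (flow_conv f k) \<le> (\<integral>t. norm (k t) \<partial>lborel) * L1_norm f"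
  unfolding L1_norm_def[of "flow_conv f k"]
  by (rule Lp_bound_integrable(2)[OF order_refl Lp_bound_flow_conv[OF order_refl Lp_bound_1[OF f] k]])

lemma fourier_coeff_L1_norm:
  assumes "integrable \<mu> f" "h \<in> characters"
  shows "norm (fourier_coeff \<mu> f h) \<le> L1_norm f"
  unfolding fourier_coeff_def L1_norm_def
  by (rule order_trans[OF integral_norm_bound]) (use assms in \<open>simp add: norm_mult characters_def\<close>)

end

context frequency_flow
begin

lemma trig_poly_bounded:
  obtains B where "0 < B" "\<And>y. norm (trig_poly I c y) \<le> B"
  by (rule continuous_bounded[OF trig_poly_continuous[of I c]]) (rule that)

text \<open>Take \<open>w = q (y + \<beta> t)\<close> and \<open>v = q' y\<close> in the pointwise inequality and average over \<open>P\<^sub>\<tau>(t) dt\<close> and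
over the group.  The average of \<open>\<bar>w\<bar>\<close> is \<open>\<parallel>q\<parallel>\<^sub>1\<close>; that of the aligned part \<open>Re (cnj (sgn v) w)\<close> is \<open>\<parallel>q'\<parallel>\<^sub>1\<close>,
since \<open>q'\<close> is the Poisson mean of \<open>q\<close>; and that of \<open>\<bar>v\<bar>\<^sup>1\<^sup>/\<^sup>2 \<bar>w\<bar>\<^sup>1\<^sup>/\<^sup>2\<close> is at least \<open>\<parallel>q'\<parallel>\<^sub>1\<close> by the sub-mean
value property of \<open>\<bar>w\<bar>\<^sup>1\<^sup>/\<^sup>2\<close>.  So every term multiplied by \<open>s\<close> is at most a multiple of \<open>\<parallel>q\<parallel>\<^sub>1 - \<parallel>q'\<parallel>\<^sub>1\<close>.\<close>

lemma poisson_stability: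
  assumes I: "finite I" and \<tau>: "0 < \<tau>" and s: "0 < s"
    and q: "q = trig_poly I c" and q': "q' = trig_poly I (\<lambda>n. c n * of_real (exp (- lam n * \<tau>)))"
  shows "(\<integral>t. poisson \<tau> t * L1_norm (\<lambda>y. q (y + \<beta> t) - q' y) \<partial>lborel) \<le> 2 * s * (L1_norm q - L1_norm q') + 3 * L1_norm q / s"
proof -
  define N where "N = density lborel (\<lambda>t. ennreal (poisson \<tau> t))"
  have Pnn: "0 \<le> poisson \<tau> t" for t using poisson_pos[OF \<tau>, of t] by simp
  have N: "prob_space N" unfolding N_def using \<tau> Pnn by (intro prob_space_density) auto
  have sN: "sets N = sets borel" by (simp add: N_def)
  interpret N: prob_space N by (rule N)
  have Nint: "(\<integral>t. F t \<partial>N) = (\<integral>t. F t * of_real (poisson \<tau> t) \<partial>lborel)" if "F \<in> borel_measurable borel" for F :: "real \<Rightarrow> complex"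
    unfolding N_def by (subst integral_density_real) (use that Pnn in \<open>auto simp: scaleR_conv_of_real mult.commute\<close>)
  have NintR: "(\<integral>t. F t \<partial>N) = (\<integral>t. F t * poisson \<tau> t \<partial>lborel)" if "F \<in> borel_measurable borel" for F :: "real \<Rightarrow> real"
    unfolding N_def by (subst integral_density_real) (use that Pnn in \<open>auto simp: mult.commute\<close>)
  obtain B1 where B1: "0 < B1" "\<And>y. norm (q y) \<le> B1" using trig_poly_bounded[of I c] unfolding q by blast
  obtain B2 where B2: "0 < B2" "\<And>y. norm (q' y) \<le> B2"
    using trig_poly_bounded[of I "\<lambda>n. c n * of_real (exp (- lam n * \<tau>))"] unfolding q' by blast
  define B where "B = max B1 B2"
  have B: "0 < B" "\<And>y. norm (q y) \<le> B" "\<And>y. norm (q' y) \<le> B"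
    using B1 B2 unfolding B_def by (auto simp: le_max_iff_disj)
  have [measurable]: "q \<in> borel_measurable borel" "q' \<in> borel_measurable borel" unfolding q q' by measurable
  define W where "W = (\<lambda>z. q (snd z + \<beta> (fst z)))"
  define V where "V = (\<lambda>z :: real \<times> 'g. q' (snd z))"
  have [measurable]: "W \<in> borel_measurable (borel \<Otimes>\<^sub>M borel)" "V \<in> borel_measurable (borel \<Otimes>\<^sub>M borel)"
    unfolding W_def V_def by measurable
  have bd: "norm (W z) \<le> B" "norm (V z) \<le> B" for z using B by (auto simp: W_def V_def)
  have sgnm [measurable]: "sgn \<in> borel_measurable (borel :: complex measure)" unfolding sgn_div_norm[abs_def] by measurable
  define F1 where "F1 = (\<lambda>z. norm (W z))"
  define F2 where "F2 = (\<lambda>z. norm (V z))"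
  define F3 where "F3 = (\<lambda>z. sqrt (norm (V z)) * sqrt (norm (W z)))"
  define F4 where "F4 = (\<lambda>z. Re (cnj (sgn (V z)) * W z))"
  define F5 where "F5 = (\<lambda>z. norm (W z - V z))"
  have m: "F1 \<in> borel_measurable (borel \<Otimes>\<^sub>M borel)" "F2 \<in> borel_measurable (borel \<Otimes>\<^sub>M borel)"
    "F3 \<in> borel_measurable (borel \<Otimes>\<^sub>M borel)" "F4 \<in> borel_measurable (borel \<Otimes>\<^sub>M borel)"
    "F5 \<in> borel_measurable (borel \<Otimes>\<^sub>M borel)"
    unfolding F1_def F2_def F3_def F4_def F5_def by measurable
  have b1: "norm (F1 z) \<le> B" and b2: "norm (F2 z) \<le> B" for z using bd by (simp_all add: F1_def F2_def)
  have b3: "norm (F3 z) \<le> B" for z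
  proof -
    have "F3 z \<le> sqrt B * sqrt B" unfolding F3_def using bd B(1) by (intro mult_mono real_sqrt_le_mono) auto
    moreover have "0 \<le> F3 z" by (simp add: F3_def)
    ultimately show ?thesis using B(1) by simp
  qed
  have b4: "norm (F4 z) \<le> B" for z
  proof -
    have "norm (F4 z) \<le> norm (cnj (sgn (V z)) * W z)" unfolding F4_def real_norm_def by (rule abs_Re_le_cmod)
    also have "\<dots> \<le> 1 * B" unfolding norm_mult by (intro mult_mono bd) (auto simp: norm_sgn)
    finally show ?thesis by simp
  qed
  have b5: "norm (F5 z) \<le> 2 * B" for z
    unfolding F5_def using norm_triangle_ineq4[of "W z" "V z"] bd[of z] by simp
  note sw1 = prob_Fubini_bounded[OF N sN m(1) b1] and sw2 = prob_Fubini_bounded[OF N sN m(2) b2] and sw3 = prob_Fubini_bounded[OF N sN m(3) b3]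
    and sw4 = prob_Fubini_bounded[OF N sN m(4) b4] and sw5 = prob_Fubini_bounded[OF N sN m(5) b5]
  let ?E = "\<lambda>F. \<integral>z. F z \<partial>(N \<Otimes>\<^sub>M \<mu>)"
  have e1: "?E F1 = L1_norm q"
  proof -
    have "(\<integral>y. F1 (t, y) \<partial>\<mu>) = L1_norm q" for t
      using L1_norm_shift[of q "\<beta> t"] by (simp add: F1_def W_def L1_norm_def)
    then show ?thesis unfolding sw1(3)[symmetric] using N.prob_space by simp
  qed
  have e2: "?E F2 = L1_norm q'"
    unfolding sw2(3)[symmetric] using N.prob_space by (simp add: F2_def V_def L1_norm_def)
  have wt: "(\<lambda>t. q (y + \<beta> t)) \<in> borel_measurable borel" for y by measurable
  have flow: "q (y + \<beta> t) = (\<Sum>n\<in>I. (c n * hchar n y) * exp (- \<i> * of_real (lam n * t)))" for y t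
    unfolding q by (rule trig_poly_flow)
  have q'e: "q' y = (\<Sum>n\<in>I. (c n * hchar n y) * of_real (exp (- lam n * \<tau>)))" for y
    unfolding q' trig_poly_def by (intro sum.cong refl) (simp only: mult_ac)
  have mean: "(\<integral>t. q (y + \<beta> t) \<partial>N) = q' y" for y
    unfolding Nint[OF wt[of y]] unfolding flow q'e by (rule exp_sum_poisson(1)[OF I lam_nonneg \<tau>])
  have smean: "sqrt (norm (q' y)) \<le> (\<integral>t. sqrt (norm (q (y + \<beta> t))) \<partial>N)" for y
  proof -
    have "(\<lambda>t. sqrt (norm (q (y + \<beta> t)))) \<in> borel_measurable borel" using wt[of y] by measurable
    then show ?thesis
      using exp_sum_poisson(2)[OF I lam_nonneg \<tau>, of "\<lambda>n. c n * hchar n y"] unfolding flow q'e by (simp only: NintR)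
  qed
  have e3: "L1_norm q' \<le> ?E F3"
    unfolding sw3(2)[symmetric] L1_norm_def
  proof (rule integral_mono)
    show "integrable \<mu> (\<lambda>y. norm (q' y))"
      unfolding q' by (intro integrable_norm trig_poly_integrable)
    have inner: "(\<integral>t. F3 (t, y) \<partial>N) = sqrt (norm (q' y)) * (\<integral>t. sqrt (norm (q (y + \<beta> t))) \<partial>N)" for y
      unfolding F3_def V_def W_def fst_conv snd_conv by (rule integral_mult_right_zero)
    show "norm (q' y) \<le> (\<integral>t. F3 (t, y) \<partial>N)" for y
    proof -
      have "norm (q' y) = sqrt (norm (q' y)) * sqrt (norm (q' y))" by simp
      also have "\<dots> \<le> sqrt (norm (q' y)) * (\<integral>t. sqrt (norm (q (y + \<beta> t))) \<partial>N)"
        by (intro mult_left_mono smean) simp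
      finally show ?thesis unfolding inner .
    qed
    interpret P: pair_prob_space N \<mu> ..
    have i': "integrable (N \<Otimes>\<^sub>M \<mu>) (\<lambda>(t, y). F3 (t, y))" using sw3(1) by simp
    show "integrable \<mu> (\<lambda>y. \<integral>t. F3 (t, y) \<partial>N)" by (rule P.integrable_snd[OF i'])
  qed
  have e4: "?E F4 = L1_norm q'"
  proof -
    have "(\<integral>t. F4 (t, y) \<partial>N) = norm (q' y)" for y
    proof -
      have i: "integrable N (\<lambda>t. cnj (sgn (q' y)) * q (y + \<beta> t))"
      proof (intro integrable_mult_right N.integrable_const_bound[where B=B])
        show "(\<lambda>t. q (y + \<beta> t)) \<in> borel_measurable N" using wt[of y] by (simp add: measurable_cong_sets[OF sN refl])
      qed (use B in simp)
      have "(\<integral>t. F4 (t, y) \<partial>N) = Re (\<integral>t. cnj (sgn (q' y)) * q (y + \<beta> t) \<partial>N)"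
        unfolding F4_def V_def W_def fst_conv snd_conv by (rule integral_Re[OF i])
      also have "\<dots> = Re (cnj (sgn (q' y)) * q' y)" by (simp only: integral_mult_right_zero mean)
      also have "\<dots> = norm (q' y)"
      proof -
        have "cnj (q' y) * q' y = of_real ((norm (q' y))\<^sup>2)" using complex_norm_square[of "q' y"] by (simp add: mult.commute)
        then have "cnj (sgn (q' y)) * q' y = of_real (inverse (norm (q' y)) * (norm (q' y))\<^sup>2)"
          by (simp add: sgn_div_norm scaleR_conv_of_real mult.assoc)
        then have "Re (cnj (sgn (q' y)) * q' y) = inverse (norm (q' y)) * (norm (q' y))\<^sup>2" by (simp only: Re_complex_of_real)
        then show ?thesis by (cases "q' y = 0") (simp_all add: power2_eq_square)
      qed
      finally show ?thesis .
    qed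
    then show ?thesis unfolding sw4(2)[symmetric] by (simp add: L1_norm_def)
  qed
  have "?E F5 \<le> ?E (\<lambda>z. s / 2 * (F1 z + F2 z - 2 * F3 z) + (F1 z + F2 z) / s + s * (F1 z - F4 z) + F2 z / s)"
  proof (rule integral_mono[OF sw5(1)])
    show "integrable (N \<Otimes>\<^sub>M \<mu>) (\<lambda>z. s / 2 * (F1 z + F2 z - 2 * F3 z) + (F1 z + F2 z) / s + s * (F1 z - F4 z) + F2 z / s)"
      by (intro Bochner_Integration.integrable_add Bochner_Integration.integrable_diff integrable_mult_right integrable_divide
            sw1(1) sw2(1) sw3(1) sw4(1))
    show "F5 z \<le> s / 2 * (F1 z + F2 z - 2 * F3 z) + (F1 z + F2 z) / s + s * (F1 z - F4 z) + F2 z / s" for z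
      unfolding F1_def F2_def F3_def F4_def F5_def by (rule stability_pointwise[OF s])
  qed
  also have "\<dots> = s / 2 * (?E F1 + ?E F2 - 2 * ?E F3) + (?E F1 + ?E F2) / s + s * (?E F1 - ?E F4) + ?E F2 / s"
    using sw1(1) sw2(1) sw3(1) sw4(1) by simp
  also have "\<dots> \<le> s / 2 * (L1_norm q - L1_norm q') + (L1_norm q + L1_norm q') / s + s * (L1_norm q - L1_norm q') + L1_norm q' / s"
    unfolding e1 e2 e4 using e3 s by (intro add_mono mult_left_mono order_refl) auto
  also have "\<dots> \<le> 2 * s * (L1_norm q - L1_norm q') + 3 * L1_norm q / s"
  proof -
    have "L1_norm q' \<le> L1_norm q"
    proof -
      have "0 \<le> ?E (\<lambda>z. F1 z + F2 z - 2 * F3 z)"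
      proof (rule Bochner_Integration.integral_nonneg)
        fix z
        have "F1 z + F2 z - 2 * F3 z = (sqrt (norm (W z)) - sqrt (norm (V z)))\<^sup>2"
          by (simp add: F1_def F2_def F3_def power2_eq_square algebra_simps)
        then show "0 \<le> F1 z + F2 z - 2 * F3 z" by simp
      qed
      also have "\<dots> = ?E F1 + ?E F2 - 2 * ?E F3" using sw1(1) sw2(1) sw3(1) by simp
      finally show ?thesis using e3 unfolding e1 e2 by linarith
    qed
    then have "(L1_norm q + L1_norm q') / s + L1_norm q' / s \<le> 3 * L1_norm q / s"
      using s by (simp add: add_divide_distrib[symmetric] divide_right_mono)
    moreover have "s / 2 * (L1_norm q - L1_norm q') + s * (L1_norm q - L1_norm q') \<le> 2 * s * (L1_norm q - L1_norm q')"
    proof -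
      have "s * L1_norm q' \<le> s * L1_norm q" using \<open>L1_norm q' \<le> L1_norm q\<close> s by (intro mult_left_mono) auto
      then show ?thesis by (simp add: algebra_simps)
    qed
    ultimately show ?thesis by linarith
  qed
  also have "?E F5 = (\<integral>t. L1_norm (\<lambda>y. q (y + \<beta> t) - q' y) \<partial>N)"
    unfolding sw5(3)[symmetric] by (simp add: F5_def W_def V_def L1_norm_def)
  also have "\<dots> = (\<integral>t. poisson \<tau> t * L1_norm (\<lambda>y. q (y + \<beta> t) - q' y) \<partial>lborel)"
  proof -
    have "F5 \<in> borel_measurable (borel \<Otimes>\<^sub>M \<mu>)"
      using m(5) by (simp add: measurable_cong_sets[OF sets_pair_measure_cong[OF refl sets_\<mu>] refl])
    then have "(\<lambda>t. \<integral>y. F5 (t, y) \<partial>\<mu>) \<in> borel_measurable borel" by measurable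
    then have "(\<lambda>t. L1_norm (\<lambda>y. q (y + \<beta> t) - q' y)) \<in> borel_measurable borel"
      by (simp add: F5_def W_def V_def L1_norm_def)
    from NintR[OF this] show ?thesis by (simp only: mult.commute)
  qed
  finally show ?thesis .
qed

lemma L1_norm_flow_diff_measurable:
  assumes [measurable]: "q \<in> borel_measurable borel" "q' \<in> borel_measurable borel"
  shows "(\<lambda>t. L1_norm (\<lambda>y. q (y + \<beta> t) - q' y)) \<in> borel_measurable borel"
proof -
  have "(\<lambda>z. norm (q (snd z + \<beta> (fst z)) - q' (snd z))) \<in> borel_measurable (borel \<Otimes>\<^sub>M borel)" by measurable
  then have "(\<lambda>z. norm (q (snd z + \<beta> (fst z)) - q' (snd z))) \<in> borel_measurable (borel \<Otimes>\<^sub>M \<mu>)"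
    by (simp add: measurable_cong_sets[OF sets_pair_measure_cong[OF refl sets_\<mu>] refl])
  from borel_measurable_lebesgue_integral[of "\<lambda>t y. norm (q (y + \<beta> t) - q' y)" borel] this
  show ?thesis by (simp add: L1_norm_def case_prod_beta')
qed

text \<open>Both \<open>q\<close> shifted by \<open>t\<close> and \<open>q\<close> shifted by \<open>t + u\<close> are on average close to \<open>q'\<close>; the shift of
the average by \<open>u\<close> costs the Harnack factor in \<open>P\<^sub>\<tau>(t - u) \<le> 3 P\<^sub>\<tau>(t)\<close>, valid for \<open>\<bar>u\<bar> \<le> \<tau>\<close>.\<close>

lemma poisson_modulus:
  assumes I: "finite I" and \<tau>: "0 < \<tau>" and s: "0 < s" and u: "\<bar>u\<bar> \<le> \<tau>"
    and q: "q = trig_poly I c" and q': "q' = trig_poly I (\<lambda>n. c n * of_real (exp (- lam n * \<tau>)))"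
  shows "L1_norm (\<lambda>y. q (y + \<beta> u) - q y) \<le> 4 * (2 * s * (L1_norm q - L1_norm q') + 3 * L1_norm q / s)"
proof -
  have qm [measurable]: "q \<in> borel_measurable borel" "q' \<in> borel_measurable borel" unfolding q q' by measurable
  have qi: "integrable \<mu> q" "integrable \<mu> q'" unfolding q q' by (rule trig_poly_integrable)+
  define w where "w = (\<lambda>t. L1_norm (\<lambda>y. q (y + \<beta> t) - q' y))"
  have wm [measurable]: "w \<in> borel_measurable borel" unfolding w_def by (rule L1_norm_flow_diff_measurable) measurable
  have wnn: "0 \<le> w t" for t unfolding w_def by (rule L1_norm_nonneg)
  have wB: "w t \<le> L1_norm q + L1_norm q'" for t
    using L1_norm_triangle[OF integrable_shift[OF qi(1), of "\<beta> t"] _ qi(2), of "\<lambda>_. 0"] L1_norm_shift[OF qm(1), of "\<beta> t"]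
    by (simp add: w_def L1_norm_def)
  have Pnn: "0 \<le> poisson \<tau> t" for t using poisson_pos[OF \<tau>, of t] by simp
  have Pi: "integrable lborel (poisson \<tau>)" using \<tau> by simp
  have bi: "integrable lborel (\<lambda>t. P t * w (t + a))" if "integrable lborel P" "\<And>t. 0 \<le> P t" for P :: "real \<Rightarrow> real" and a
  proof (rule Bochner_Integration.integrable_bound[OF integrable_mult_left[OF that(1), of "L1_norm q + L1_norm q'"]])
    show "(\<lambda>t. P t * w (t + a)) \<in> borel_measurable lborel" using borel_measurable_integrable[OF that(1)] by measurable
    show "AE t in lborel. norm (P t * w (t + a)) \<le> norm (P t * (L1_norm q + L1_norm q'))"
      using that(2) wB wnn L1_norm_nonneg[of q] L1_norm_nonneg[of q'] by (intro AE_I2) (simp add: abs_mult mult_left_mono)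
  qed
  have shift_le: "(\<integral>t. poisson \<tau> t * w (t + u) \<partial>lborel) \<le> 3 * (\<integral>t. poisson \<tau> t * w t \<partial>lborel)"
  proof -
    have Psi: "integrable lborel (\<lambda>t. poisson \<tau> (t - u))"
      using lborel_integrable_real_affine[OF Pi, of 1 "- u"] by simp
    have "(\<integral>t. poisson \<tau> t * w (t + u) \<partial>lborel) = \<bar>1\<bar> *\<^sub>R (\<integral>t. poisson \<tau> (- u + 1 * t) * w (- u + 1 * t + u) \<partial>lborel)"
      by (rule lborel_integral_real_affine) simp
    also have "\<dots> = (\<integral>t. poisson \<tau> (t - u) * w t \<partial>lborel)" by simp
    also have "\<dots> \<le> (\<integral>t. 3 * (poisson \<tau> t * w t) \<partial>lborel)"
    proof (rule integral_mono)
      show "integrable lborel (\<lambda>t. poisson \<tau> (t - u) * w t)" using bi[OF Psi Pnn, of 0] by simp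
      show "integrable lborel (\<lambda>t. 3 * (poisson \<tau> t * w t))" using bi[OF Pi Pnn, of 0] by simp
      fix t
      have "poisson \<tau> (t - u) \<le> 3 * poisson \<tau> t"
      proof -
        have uu: "u\<^sup>2 \<le> \<tau>\<^sup>2" using u by (metis abs_le_square_iff abs_of_pos \<tau>)
        have "0 \<le> (t - 2 * u)\<^sup>2" "0 \<le> (t - u)\<^sup>2" by simp_all
        then have le: "\<tau>\<^sup>2 + t\<^sup>2 \<le> 3 * (\<tau>\<^sup>2 + (t - u)\<^sup>2)" using uu by (simp add: power2_eq_square algebra_simps)
        have p: "0 < \<tau>\<^sup>2 + t\<^sup>2" "0 < \<tau>\<^sup>2 + (t - u)\<^sup>2" using \<tau> by (auto simp: add_pos_nonneg)
        have "1 / (\<tau>\<^sup>2 + (t - u)\<^sup>2) \<le> 3 / (\<tau>\<^sup>2 + t\<^sup>2)" using le p by (simp add: divide_le_eq le_divide_eq)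
        then have "\<tau> / pi * (1 / (\<tau>\<^sup>2 + (t - u)\<^sup>2)) \<le> \<tau> / pi * (3 / (\<tau>\<^sup>2 + t\<^sup>2))" using \<tau> by (intro mult_left_mono) auto
        then show ?thesis by (simp add: poisson_def mult.commute)
      qed
      then show "poisson \<tau> (t - u) * w t \<le> 3 * (poisson \<tau> t * w t)" using mult_right_mono[OF _ wnn] by (simp only: mult.assoc[symmetric])
    qed
    finally show ?thesis by simp
  qed
  have point: "L1_norm (\<lambda>y. q (y + \<beta> u) - q y) \<le> w (t + u) + w t" for t
  proof -
    have e: "y + \<beta> t + \<beta> u = y + \<beta> (t + u)" for y by (simp add: \<beta>_add add.assoc)
    have "L1_norm (\<lambda>y. q (y + \<beta> u) - q y) = L1_norm (\<lambda>y. q (y + \<beta> t + \<beta> u) - q (y + \<beta> t))"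
      by (rule L1_norm_shift[of "\<lambda>y. q (y + \<beta> u) - q y" "\<beta> t", symmetric]) measurable
    also have "\<dots> \<le> L1_norm (\<lambda>y. q (y + \<beta> (t + u)) - q' y) + L1_norm (\<lambda>y. q' y - q (y + \<beta> t))"
      unfolding e by (rule L1_norm_triangle[OF integrable_shift[OF qi(1)] qi(2) integrable_shift[OF qi(1)]])
    finally show ?thesis unfolding w_def L1_norm_minus_commute[of q'] .
  qed
  have "L1_norm (\<lambda>y. q (y + \<beta> u) - q y) = (\<integral>t. poisson \<tau> t * L1_norm (\<lambda>y. q (y + \<beta> u) - q y) \<partial>lborel)" using \<tau> by simp
  also have "\<dots> \<le> (\<integral>t. poisson \<tau> t * w (t + u) + poisson \<tau> t * w (t + 0) \<partial>lborel)"
  proof (rule integral_mono[OF integrable_mult_left[OF Pi] Bochner_Integration.integrable_add[OF bi[OF Pi Pnn] bi[OF Pi Pnn]]])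
    show "poisson \<tau> t * L1_norm (\<lambda>y. q (y + \<beta> u) - q y) \<le> poisson \<tau> t * w (t + u) + poisson \<tau> t * w (t + 0)" for t
      unfolding distrib_left[symmetric] using point[of t] by (intro mult_left_mono Pnn) simp
  qed
  also have "\<dots> = (\<integral>t. poisson \<tau> t * w (t + u) \<partial>lborel) + (\<integral>t. poisson \<tau> t * w (t + 0) \<partial>lborel)"
    by (rule Bochner_Integration.integral_add[OF bi[OF Pi Pnn] bi[OF Pi Pnn]])
  also have "\<dots> \<le> 4 * (\<integral>t. poisson \<tau> t * w t \<partial>lborel)" using shift_le by simp
  also have "\<dots> \<le> 4 * (2 * s * (L1_norm q - L1_norm q') + 3 * L1_norm q / s)"
    using poisson_stability[OF I \<tau> s q q'] unfolding w_def by (intro mult_left_mono) auto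
  finally show ?thesis .
qed

end

context frequency_flow
begin

section \<open>Coefficientwise limits of bounded sequences\<close>

lemma trig_poly_subset:
  assumes "finite J" "I \<subseteq> J" "\<And>n. n \<in> J \<Longrightarrow> n \<notin> I \<Longrightarrow> c n = 0"
  shows "trig_poly J c = trig_poly I c"
  unfolding trig_poly_def using assms by (intro ext sum.mono_neutral_right) auto

lemma L1_norm_trig_poly_diff: "L1_norm (\<lambda>y. trig_poly I c y - trig_poly I d y) \<le> (\<Sum>n\<in>I. norm (c n - d n))"
proof -
  have "L1_norm (\<lambda>y. trig_poly I c y - trig_poly I d y) \<le> (\<integral>y. (\<Sum>n\<in>I. norm (c n - d n)) \<partial>\<mu>)"
    unfolding L1_norm_def trig_poly_diff
    by (intro integral_mono integrable_norm trig_poly_integrable trig_poly_norm_le) simp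
  then show ?thesis using prob_space by simp
qed

lemma L1_norm_diff_le:
  assumes f: "integrable \<mu> f" and g: "integrable \<mu> g"
  shows "\<bar>L1_norm f - L1_norm g\<bar> \<le> L1_norm (\<lambda>y. f y - g y)"
  using L1_norm_triangle[OF f g, of "\<lambda>_. 0"] L1_norm_triangle[OF g f, of "\<lambda>_. 0"] L1_norm_minus_commute[of f g] by simp

lemma L1_norm_trig_poly_tendsto:
  assumes "\<And>n. n \<in> I \<Longrightarrow> (\<lambda>k::nat. c k n) \<longlonglongrightarrow> d n"
  shows "(\<lambda>k. L1_norm (\<lambda>y. trig_poly I (c k) y - trig_poly I d y)) \<longlonglongrightarrow> 0"
    and "(\<lambda>k. L1_norm (trig_poly I (c k))) \<longlonglongrightarrow> L1_norm (trig_poly I d)"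
proof -
  have "(\<lambda>k. \<Sum>n\<in>I. norm (c k n - d n)) \<longlonglongrightarrow> (\<Sum>n\<in>I. 0)"
    by (intro tendsto_sum tendsto_norm_zero) (use assms in \<open>simp add: LIM_zero_iff\<close>)
  then have s: "(\<lambda>k. \<Sum>n\<in>I. norm (c k n - d n)) \<longlonglongrightarrow> 0" by simp
  show d: "(\<lambda>k. L1_norm (\<lambda>y. trig_poly I (c k) y - trig_poly I d y)) \<longlonglongrightarrow> 0"
    by (rule tendsto_sandwich[OF _ _ tendsto_const s])
       (intro always_eventually allI L1_norm_nonneg L1_norm_trig_poly_diff)+
  have "(\<lambda>k. L1_norm (trig_poly I (c k)) - L1_norm (trig_poly I d)) \<longlonglongrightarrow> 0"
    by (rule Lim_null_comparison[OF _ d])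
       (simp only: real_norm_def L1_norm_diff_le[OF trig_poly_integrable trig_poly_integrable] eventually_True)
  then show "(\<lambda>k. L1_norm (trig_poly I (c k))) \<longlonglongrightarrow> L1_norm (trig_poly I d)" by (simp add: LIM_zero_iff)
qed

definition cutoff :: "nat \<Rightarrow> real" where "cutoff j = real (Suc j)"

definition below :: "nat \<Rightarrow> nat set" where "below j = {n. lam n < cutoff j}"

definition fejer_weight :: "nat \<Rightarrow> nat \<Rightarrow> complex" where "fejer_weight j n = of_real (tent (lam n / cutoff j))"

lemma cutoff_pos: "0 < cutoff j" by (simp add: cutoff_def)

lemma finite_below_cutoff: "finite (below j)" unfolding below_def by (rule finite_below)

lemma below_mono: "i \<le> j \<Longrightarrow> below i \<subseteq> below j" by (auto simp: below_def cutoff_def)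

lemma fejer_weight_outside: "n \<notin> below j \<Longrightarrow> fejer_weight j n = 0"
proof -
  assume "n \<notin> below j"
  then have "1 \<le> lam n / cutoff j" using cutoff_pos[of j] by (simp add: below_def)
  then have "tent (lam n / cutoff j) = 0" by (intro tent_zero order_trans[OF _ abs_ge_self])
  then show ?thesis by (simp add: fejer_weight_def)
qed

lemma fejer_weight_tendsto: "(\<lambda>j. fejer_weight j n) \<longlonglongrightarrow> 1"
proof -
  have "(\<lambda>j. lam n / cutoff j) \<longlonglongrightarrow> 0" unfolding cutoff_def by real_asymp
  then have "(\<lambda>j. tent (lam n / cutoff j)) \<longlonglongrightarrow> tent 0"
    by (rule continuous_on_tendsto_compose[OF continuous_tent[of UNIV]]) auto
  then have "(\<lambda>j. fejer_weight j n) \<longlonglongrightarrow> of_real (tent 0)" unfolding fejer_weight_def by (rule tendsto_of_real)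
  then show ?thesis by (simp add: tent_def)
qed

text \<open>The Fejer polynomials of the formal series \<open>a\<close>, which make sense before a representing function
is known.\<close>

definition smoothed :: "(nat \<Rightarrow> complex) \<Rightarrow> nat \<Rightarrow> 'g \<Rightarrow> complex" where
  "smoothed a j = trig_poly (below j) (\<lambda>n. a n * fejer_weight j n)"

lemma flow_conv_fejer_smoothed:
  assumes "i \<le> j"
  shows "flow_conv (trig_poly (below j) c) (fejer_scaled (cutoff i)) = trig_poly (below i) (\<lambda>n. c n * fejer_weight i n)"
proof -
  have "flow_conv (trig_poly (below j) c) (fejer_scaled (cutoff i)) = trig_poly (below j) (\<lambda>n. c n * fejer_weight i n)"
    by (rule ext, subst flow_conv_trig_poly[OF integrable_fejer_scaled[OF cutoff_pos]])
       (simp only: fourier_fejer_scaled[OF cutoff_pos] fejer_weight_def)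
  also have "\<dots> = trig_poly (below i) (\<lambda>n. c n * fejer_weight i n)"
    by (rule trig_poly_subset[OF finite_below_cutoff below_mono[OF assms]]) (simp add: fejer_weight_outside)
  finally show ?thesis .
qed

text \<open>Let \<open>M\<close> be the supremum of the norms, and choose \<open>i\<close>, then \<open>\<tau>\<close>, such that the Poisson mean of the
\<open>i\<close>-th polynomial still has norm above \<open>M - \<eta>\<close>.  The Fejer mean of order \<open>i\<close> of the Poisson mean
\<open>q'\<close> of the \<open>j\<close>-th polynomial converges to it as \<open>j\<close> grows, because only finitely many coefficients
are involved.  Hence \<open>\<parallel>q'\<parallel>\<^sub>1 > M - \<eta>\<close> for all large \<open>j\<close>, and the loss of norm is at most \<open>\<eta>\<close>.\<close>

lemma smoothed_equicontinuous:
  assumes C: "\<And>j. L1_norm (smoothed a j) \<le> C" and e: "0 < e"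
  obtains \<tau> J where "0 < \<tau>" "\<And>j u. j \<ge> J \<Longrightarrow> \<bar>u\<bar> \<le> \<tau> \<Longrightarrow> L1_norm (\<lambda>y. smoothed a j (y + \<beta> u) - smoothed a j y) \<le> e"
proof -
  have C0: "0 \<le> C" using L1_norm_nonneg C order_trans by blast
  (* These constants make 8 s \<eta> at most e / 6 and 12 C / s at most e / 2. *)
  define s where "s = 24 * (C + 1) / e"
  have s: "0 < s" using C0 e by (simp add: s_def)
  define \<eta> where "\<eta> = e / (48 * s)"
  have \<eta>: "0 < \<eta>" using s e by (simp add: \<eta>_def)
  define M where "M = (SUP j. L1_norm (smoothed a j))"
  have bdd: "bdd_above (range (\<lambda>j. L1_norm (smoothed a j)))" using C by (auto simp: bdd_above_def)
  have M: "L1_norm (smoothed a j) \<le> M" for j unfolding M_def by (rule cSUP_upper[OF UNIV_I bdd])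
  have "M - \<eta> < M" using \<eta> by simp
  then obtain i where i: "M - \<eta> < L1_norm (smoothed a i)"
    unfolding M_def by (subst (asm) less_cSUP_iff[OF UNIV_not_empty bdd]) blast
  define E where "E = (\<lambda>\<tau> n. complex_of_real (exp (- lam n * \<tau>)))"
  have "(\<lambda>m. L1_norm (trig_poly (below i) (\<lambda>n. a n * fejer_weight i n * E (1 / real (Suc m)) n))) \<longlonglongrightarrow> L1_norm (trig_poly (below i) (\<lambda>n. a n * fejer_weight i n))"
  proof (rule L1_norm_trig_poly_tendsto(2))
    fix n
    have "(\<lambda>m. - lam n * (1 / real (Suc m))) \<longlonglongrightarrow> 0" by real_asymp
    from tendsto_of_real[OF tendsto_exp[OF this], where 'a=complex]
    have "(\<lambda>m. E (1 / real (Suc m)) n) \<longlonglongrightarrow> 1" unfolding E_def by simp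
    from tendsto_mult[OF tendsto_const this, of "a n * fejer_weight i n"]
    show "(\<lambda>m. a n * fejer_weight i n * E (1 / real (Suc m)) n) \<longlonglongrightarrow> a n * fejer_weight i n" by simp
  qed
  then have "\<forall>\<^sub>F m in sequentially. M - \<eta> < L1_norm (trig_poly (below i) (\<lambda>n. a n * fejer_weight i n * E (1 / real (Suc m)) n))"
    by (rule order_tendstoD(1)) (use i in \<open>simp add: smoothed_def\<close>)
  then obtain m where m: "M - \<eta> < L1_norm (trig_poly (below i) (\<lambda>n. a n * fejer_weight i n * E (1 / real (Suc m)) n))"
    by (auto simp: eventually_sequentially)
  define \<tau> where "\<tau> = 1 / real (Suc m)"
  have \<tau>: "0 < \<tau>" by (simp add: \<tau>_def)
  have "(\<lambda>j. L1_norm (trig_poly (below i) (\<lambda>n. a n * fejer_weight j n * E \<tau> n * fejer_weight i n))) \<longlonglongrightarrow> L1_norm (trig_poly (below i) (\<lambda>n. a n * fejer_weight i n * E \<tau> n))"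
  proof (rule L1_norm_trig_poly_tendsto(2))
    fix n
    have "(\<lambda>j. a n * fejer_weight j n * E \<tau> n * fejer_weight i n) \<longlonglongrightarrow> a n * 1 * E \<tau> n * fejer_weight i n"
      by (intro tendsto_mult tendsto_const fejer_weight_tendsto)
    then show "(\<lambda>j. a n * fejer_weight j n * E \<tau> n * fejer_weight i n) \<longlonglongrightarrow> a n * fejer_weight i n * E \<tau> n" by (simp add: mult_ac)
  qed
  then have "\<forall>\<^sub>F j in sequentially. M - \<eta> < L1_norm (trig_poly (below i) (\<lambda>n. a n * fejer_weight j n * E \<tau> n * fejer_weight i n))"
    by (rule order_tendstoD(1)) (use m in \<open>simp only: \<tau>_def\<close>)
  then obtain J0 where J0: "\<And>j. j \<ge> J0 \<Longrightarrow> M - \<eta> < L1_norm (trig_poly (below i) (\<lambda>n. a n * fejer_weight j n * E \<tau> n * fejer_weight i n))"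
    by (auto simp: eventually_sequentially)
  show ?thesis
  proof (rule that[OF \<tau>])
    fix j u assume j: "max i J0 \<le> j" and u: "\<bar>u\<bar> \<le> \<tau>"
    have ij: "i \<le> j" using j by simp
    define q' where "q' = trig_poly (below j) (\<lambda>n. a n * fejer_weight j n * E \<tau> n)"
    have q'e: "q' = trig_poly (below j) (\<lambda>n. a n * fejer_weight j n * of_real (exp (- lam n * \<tau>)))"
      unfolding q'_def E_def ..
    have "M - \<eta> < L1_norm (flow_conv q' (fejer_scaled (cutoff i)))"
      unfolding q'_def flow_conv_fejer_smoothed[OF ij] by (rule J0) (use j in simp)
    also have "\<dots> \<le> (\<integral>t. norm (fejer_scaled (cutoff i) t) \<partial>lborel) * L1_norm q'"
      unfolding q'_def by (rule L1_norm_flow_conv[OF trig_poly_integrable integrable_fejer_scaled[OF cutoff_pos]])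
    also have "\<dots> = L1_norm q'" by (simp add: norm_fejer_scaled[OF cutoff_pos])
    finally have D: "L1_norm (smoothed a j) - L1_norm q' \<le> \<eta>" using M[of j] by linarith
    have "L1_norm (\<lambda>y. smoothed a j (y + \<beta> u) - smoothed a j y) \<le> 4 * (2 * s * (L1_norm (smoothed a j) - L1_norm q') + 3 * L1_norm (smoothed a j) / s)"
      by (rule poisson_modulus[OF finite_below_cutoff \<tau> s u smoothed_def q'e])
    also have "\<dots> \<le> 4 * (2 * s * \<eta> + 3 * C / s)"
      using D C[of j] s by (intro mult_left_mono add_mono divide_right_mono) auto
    also have "\<dots> \<le> e"
    proof -
      have "8 * s * \<eta> = e / 6" using s by (simp add: \<eta>_def)
      moreover have "12 * C / s \<le> e / 2"
      proof -
        have "12 * C * e \<le> 12 * (C + 1) * e" using e by (intro mult_right_mono) auto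
        moreover have "12 * C / s = 12 * C * e / (24 * (C + 1))" by (simp add: s_def)
        ultimately show ?thesis using C0 by (simp add: divide_le_eq algebra_simps)
      qed
      ultimately show ?thesis using e by simp
    qed
    finally show "L1_norm (\<lambda>y. smoothed a j (y + \<beta> u) - smoothed a j y) \<le> e" .
  qed
qed

lemma fejer_tail_tendsto: "0 < \<tau> \<Longrightarrow> (\<lambda>m. \<integral>v. fejer v * indicator {v. \<tau> < \<bar>v / cutoff m\<bar>} v \<partial>lborel) \<longlonglongrightarrow> 0"
proof -
  assume \<tau>: "0 < \<tau>"
  have "(\<lambda>m. \<integral>v. fejer v * indicator {v. \<tau> < \<bar>v / cutoff m\<bar>} v \<partial>lborel) \<longlonglongrightarrow> integral\<^sup>L lborel (\<lambda>v::real. 0::real)"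
  proof (rule integral_dominated_convergence[where w=fejer])
    show "AE v in lborel. (\<lambda>m. fejer v * indicator {v. \<tau> < \<bar>v / cutoff m\<bar>} v) \<longlonglongrightarrow> 0"
    proof (rule AE_I2)
      fix v
      have "(\<lambda>m. \<bar>v / cutoff m\<bar>) \<longlonglongrightarrow> \<bar>0\<bar>" unfolding cutoff_def by (intro tendsto_rabs) real_asymp
      then have "\<forall>\<^sub>F m in sequentially. \<bar>v / cutoff m\<bar> < \<tau>" by (rule order_tendstoD(2)) (use \<tau> in simp)
      then have "\<forall>\<^sub>F m in sequentially. fejer v * indicator {v. \<tau> < \<bar>v / cutoff m\<bar>} v = 0"
        by eventually_elim simp
      then show "(\<lambda>m. fejer v * indicator {v. \<tau> < \<bar>v / cutoff m\<bar>} v) \<longlonglongrightarrow> 0" by (rule tendsto_eventually)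
    qed
    show "AE v in lborel. norm (fejer v * indicator {v. \<tau> < \<bar>v / cutoff m\<bar>} v) \<le> fejer v" for m
      using fejer_nonneg by (intro AE_I2) (simp add: indicator_def)
  qed (use integrable_fejer in \<open>auto simp: cutoff_def\<close>)
  then show ?thesis by simp
qed

lemma L1_norm_fejer_approx:
  assumes q: "q = trig_poly I c"
  shows "L1_norm (\<lambda>y. q y - flow_conv q (fejer_scaled (cutoff m)) y) \<le> (\<integral>v. fejer v * L1_norm (\<lambda>y. q (y + \<beta> (v / cutoff m)) - q y) \<partial>lborel)"
proof -
  define N where "N = density lborel (\<lambda>t. ennreal (fejer t))"
  have N: "prob_space N" unfolding N_def using fejer_nonneg integrable_fejer integral_fejer by (intro prob_space_density) auto
  have sN: "sets N = sets borel" by (simp add: N_def)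
  interpret N: prob_space N by (rule N)
  obtain B where B: "0 < B" "\<And>y. norm (q y) \<le> B" using trig_poly_bounded[of I c] unfolding q by blast
  have qm [measurable]: "q \<in> borel_measurable borel" unfolding q by measurable
  define F where "F = (\<lambda>z. norm (q (snd z + \<beta> (fst z / cutoff m)) - q (snd z)))"
  have Fm: "F \<in> borel_measurable (borel \<Otimes>\<^sub>M borel)"
  proof -
    have "(\<lambda>z. (\<lambda>z. q (snd z + \<beta> (fst z))) (fst z / cutoff m, snd z)) \<in> borel_measurable (borel \<Otimes>\<^sub>M borel)"
      by (rule measurable_compose[OF _ measurable_flow_pair[OF qm]]) measurable
    then have [measurable]: "(\<lambda>z. q (snd z + \<beta> (fst z / cutoff m))) \<in> borel_measurable (borel \<Otimes>\<^sub>M borel)" by simp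
    show ?thesis unfolding F_def by measurable
  qed
  have Fb: "norm (F z) \<le> 2 * B" for z
    unfolding F_def using norm_triangle_ineq4[of "q (snd z + \<beta> (fst z / cutoff m))" "q (snd z)"]
      B(2)[of "snd z + \<beta> (fst z / cutoff m)"] B(2)[of "snd z"] by simp
  note sw = prob_Fubini_bounded[OF N sN Fm Fb]
  have qflow: "(\<lambda>v. q (y + \<beta> (v / cutoff m))) \<in> borel_measurable borel" for y
    by (rule measurable_compose[OF _ measurable_flow_t[OF qm]]) measurable
  have wN: "(\<lambda>v. q (y + \<beta> (v / cutoff m))) \<in> borel_measurable N" for y using qflow[of y] by (simp add: measurable_cong_sets[OF sN refl])
  have iN: "integrable N (\<lambda>v. q (y + \<beta> (v / cutoff m)))" for y
    by (rule N.integrable_const_bound[OF AE_I2 wN]) (rule B(2))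
  have conv: "flow_conv q (fejer_scaled (cutoff m)) y = (\<integral>v. q (y + \<beta> (v / cutoff m)) \<partial>N)" for y
    unfolding flow_conv_def integral_fejer_scaled[OF cutoff_pos] N_def
    by (subst integral_density_real[OF _ fejer_nonneg qflow]) (auto simp: scaleR_conv_of_real mult.commute)
  have "norm (q y - flow_conv q (fejer_scaled (cutoff m)) y) \<le> (\<integral>v. F (v, y) \<partial>N)" for y
  proof -
    have "flow_conv q (fejer_scaled (cutoff m)) y - q y = (\<integral>v. q (y + \<beta> (v / cutoff m)) - q y \<partial>N)"
      unfolding conv using iN[of y] N.prob_space by simp
    then have "norm (flow_conv q (fejer_scaled (cutoff m)) y - q y) \<le> (\<integral>v. norm (q (y + \<beta> (v / cutoff m)) - q y) \<partial>N)"
      by (simp only: integral_norm_bound)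
    then show ?thesis by (simp add: F_def norm_minus_commute)
  qed
  moreover have "integrable \<mu> (\<lambda>y. \<integral>v. F (v, y) \<partial>N)"
  proof -
    interpret P: pair_prob_space N \<mu> ..
    have "integrable (N \<Otimes>\<^sub>M \<mu>) (\<lambda>(t, y). F (t, y))" using sw(1) by simp
    then show ?thesis by (rule P.integrable_snd)
  qed
  moreover have "integrable \<mu> (\<lambda>y. norm (q y - flow_conv q (fejer_scaled (cutoff m)) y))"
    unfolding q by (intro integrable_norm Bochner_Integration.integrable_diff trig_poly_integrable
       flow_conv_integrable integrable_fejer_scaled cutoff_pos)
  ultimately have "L1_norm (\<lambda>y. q y - flow_conv q (fejer_scaled (cutoff m)) y) \<le> (\<integral>y. (\<integral>v. F (v, y) \<partial>N) \<partial>\<mu>)"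
    unfolding L1_norm_def by (intro integral_mono)
  also have "\<dots> = (\<integral>v. (\<integral>y. F (v, y) \<partial>\<mu>) \<partial>N)" unfolding sw(2,3) ..
  also have "\<dots> = (\<integral>v. fejer v * (\<integral>y. F (v, y) \<partial>\<mu>) \<partial>lborel)"
  proof -
    have "F \<in> borel_measurable (borel \<Otimes>\<^sub>M \<mu>)"
      using Fm by (simp add: measurable_cong_sets[OF sets_pair_measure_cong[OF refl sets_\<mu>] refl])
    then have "(\<lambda>v. \<integral>y. F (v, y) \<partial>\<mu>) \<in> borel_measurable borel" by measurable
    then show ?thesis unfolding N_def by (subst integral_density_real[OF _ fejer_nonneg]) auto
  qed
  finally show ?thesis by (simp add: F_def L1_norm_def)
qed

text \<open>By equicontinuity along the flow the polynomials are uniformly close to their Fejer means of a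
fixed order \<open>m\<close>, and these converge to the polynomial \<open>G\<close> because they only involve the finitely
many frequencies below the cutoff.\<close>

lemma smoothed_Cauchy:
  assumes C: "\<And>j. L1_norm (smoothed a j) \<le> C" and e: "0 < e"
  shows "\<exists>J. \<forall>i\<ge>J. \<forall>j\<ge>J. L1_norm (\<lambda>y. smoothed a i y - smoothed a j y) < e"
proof -
  have C0: "0 \<le> C" using L1_norm_nonneg C order_trans by blast
  define d where "d = e / 8"
  have d: "0 < d" using e by (simp add: d_def)
  obtain \<tau> J where \<tau>: "0 < \<tau>" and J: "\<And>j u. j \<ge> J \<Longrightarrow> \<bar>u\<bar> \<le> \<tau> \<Longrightarrow> L1_norm (\<lambda>y. smoothed a j (y + \<beta> u) - smoothed a j y) \<le> d"
    using smoothed_equicontinuous[OF C d] by blast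
  have "(\<lambda>m. 2 * C * (\<integral>v. fejer v * indicator {v. \<tau> < \<bar>v / cutoff m\<bar>} v \<partial>lborel)) \<longlonglongrightarrow> 2 * C * 0"
    by (rule tendsto_mult[OF tendsto_const fejer_tail_tendsto[OF \<tau>]])
  then have "\<forall>\<^sub>F m in sequentially. 2 * C * (\<integral>v. fejer v * indicator {v. \<tau> < \<bar>v / cutoff m\<bar>} v \<partial>lborel) < d"
    by (rule order_tendstoD(2)) (use d in simp)
  then obtain m where m: "2 * C * (\<integral>v. fejer v * indicator {v. \<tau> < \<bar>v / cutoff m\<bar>} v \<partial>lborel) < d"
    by (auto simp: eventually_sequentially)
  have qi: "integrable \<mu> (smoothed a j)" for j unfolding smoothed_def by (rule trig_poly_integrable)
  have qm: "smoothed a j \<in> borel_measurable borel" for j unfolding smoothed_def by measurable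
  have approx: "L1_norm (\<lambda>y. smoothed a j y - flow_conv (smoothed a j) (fejer_scaled (cutoff m)) y) \<le> 2 * d" if j: "J \<le> j" for j
  proof -
    define w where "w = (\<lambda>u. L1_norm (\<lambda>y. smoothed a j (y + \<beta> u) - smoothed a j y))"
    have wm [measurable]: "w \<in> borel_measurable borel" unfolding w_def by (rule L1_norm_flow_diff_measurable[OF qm qm])
    have wnn: "0 \<le> w u" for u unfolding w_def by (rule L1_norm_nonneg)
    have w2: "w u \<le> 2 * C" for u
      using L1_norm_triangle[OF integrable_shift[OF qi, of j "\<beta> u"] _ qi[of j], of "\<lambda>_. 0"] L1_norm_shift[OF qm[of j], of "\<beta> u"] C[of j]
      by (simp add: w_def L1_norm_def)
    have wle: "w (v / cutoff m) \<le> d + 2 * C * indicator {v. \<tau> < \<bar>v / cutoff m\<bar>} v" for v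
    proof (cases "\<tau> < \<bar>v / cutoff m\<bar>")
      case True
      then show ?thesis using w2[of "v / cutoff m"] d by (simp add: add_increasing)
    next
      case False
      then have "w (v / cutoff m) \<le> d" unfolding w_def by (intro J j) simp
      then show ?thesis using False by simp
    qed
    have ind [measurable]: "{v. \<tau> < \<bar>v / cutoff m\<bar>} \<in> sets borel" by measurable
    have fi: "integrable lborel (\<lambda>v. fejer v * indicator {v. \<tau> < \<bar>v / cutoff m\<bar>} v)"
      by (rule Bochner_Integration.integrable_bound[OF integrable_fejer]) (measurable, auto simp: indicator_def)
    have fw: "integrable lborel (\<lambda>v. fejer v * w (v / cutoff m))"
    proof (rule Bochner_Integration.integrable_bound[OF integrable_mult_left[OF integrable_fejer, of "2 * C"]])
      show "AE v in lborel. norm (fejer v * w (v / cutoff m)) \<le> norm (fejer v * (2 * C))"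
        using w2 wnn fejer_nonneg C0 by (intro AE_I2) (simp add: abs_mult mult_left_mono)
    qed measurable
    have "L1_norm (\<lambda>y. smoothed a j y - flow_conv (smoothed a j) (fejer_scaled (cutoff m)) y) \<le> (\<integral>v. fejer v * w (v / cutoff m) \<partial>lborel)"
      unfolding w_def by (rule L1_norm_fejer_approx[OF smoothed_def])
    also have "\<dots> \<le> (\<integral>v. d * fejer v + 2 * C * (fejer v * indicator {v. \<tau> < \<bar>v / cutoff m\<bar>} v) \<partial>lborel)"
    proof (rule integral_mono[OF fw])
      show "integrable lborel (\<lambda>v. d * fejer v + 2 * C * (fejer v * indicator {v. \<tau> < \<bar>v / cutoff m\<bar>} v))"
        by (intro Bochner_Integration.integrable_add integrable_mult_right integrable_fejer fi)
      show "fejer v * w (v / cutoff m) \<le> d * fejer v + 2 * C * (fejer v * indicator {v. \<tau> < \<bar>v / cutoff m\<bar>} v)" for v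
        using mult_left_mono[OF wle fejer_nonneg, of v v] by (simp add: algebra_simps)
    qed
    also have "\<dots> = d + 2 * C * (\<integral>v. fejer v * indicator {v. \<tau> < \<bar>v / cutoff m\<bar>} v \<partial>lborel)"
      using integrable_fejer fi by (simp add: integral_fejer)
    finally show ?thesis using m by simp
  qed
  define G where "G = trig_poly (below m) (\<lambda>n. a n * 1 * fejer_weight m n)"
  have "(\<lambda>j. L1_norm (\<lambda>y. trig_poly (below m) (\<lambda>n. a n * fejer_weight j n * fejer_weight m n) y - G y)) \<longlonglongrightarrow> 0"
    unfolding G_def by (rule L1_norm_trig_poly_tendsto(1)) (intro tendsto_mult tendsto_const fejer_weight_tendsto)
  then have "\<forall>\<^sub>F j in sequentially. L1_norm (\<lambda>y. trig_poly (below m) (\<lambda>n. a n * fejer_weight j n * fejer_weight m n) y - G y) < d"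
    by (rule order_tendstoD(2)) (rule d)
  then obtain J' where J': "\<And>j. j \<ge> J' \<Longrightarrow> L1_norm (\<lambda>y. trig_poly (below m) (\<lambda>n. a n * fejer_weight j n * fejer_weight m n) y - G y) < d"
    by (auto simp: eventually_sequentially)
  have Gi: "integrable \<mu> G" unfolding G_def by (rule trig_poly_integrable)
  have near: "L1_norm (\<lambda>y. smoothed a j y - G y) < 3 * d" if j: "max J (max J' m) \<le> j" for j
  proof -
    have conv: "flow_conv (smoothed a j) (fejer_scaled (cutoff m)) = trig_poly (below m) (\<lambda>n. a n * fejer_weight j n * fejer_weight m n)"
      unfolding smoothed_def by (rule flow_conv_fejer_smoothed) (use j in simp)
    have "L1_norm (\<lambda>y. smoothed a j y - G y) \<le> L1_norm (\<lambda>y. smoothed a j y - trig_poly (below m) (\<lambda>n. a n * fejer_weight j n * fejer_weight m n) y)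
        + L1_norm (\<lambda>y. trig_poly (below m) (\<lambda>n. a n * fejer_weight j n * fejer_weight m n) y - G y)"
      by (rule L1_norm_triangle[OF qi trig_poly_integrable Gi])
    also have "\<dots> < 2 * d + d"
      using approx[of j] J'[of j] j unfolding conv by (intro add_le_less_mono) auto
    finally show ?thesis by simp
  qed
  show ?thesis
  proof (intro exI allI impI)
    fix i j assume ij: "max J (max J' m) \<le> i" "max J (max J' m) \<le> j"
    have "L1_norm (\<lambda>y. smoothed a i y - smoothed a j y) \<le> L1_norm (\<lambda>y. smoothed a i y - G y) + L1_norm (\<lambda>y. G y - smoothed a j y)"
      by (rule L1_norm_triangle[OF qi Gi qi])
    also have "\<dots> < 3 * d + 3 * d"
      unfolding L1_norm_minus_commute[of G] by (intro add_strict_mono near ij)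
    also have "\<dots> \<le> e" using e by (simp add: d_def)
    finally show "L1_norm (\<lambda>y. smoothed a i y - smoothed a j y) < e" .
  qed
qed

text \<open>A subsequence converges a.e., and Fatou's lemma bounds the limit in \<open>L\<^sub>p\<close>, and its distance to the
polynomials in \<open>L\<^sub>1\<close>.  The latter identifies the coefficients.\<close>

lemma Lp_bounded_smoothed_represents:
  assumes p: "1 \<le> p" and C: "\<And>j. Lp_bound p \<mu> (smoothed a j) C"
  obtains f where "represents p lam \<beta> \<mu> f a" "Lp_bound p \<mu> f C"
proof -
  have C1: "L1_norm (smoothed a j) \<le> C" for j
    unfolding L1_norm_def by (rule Lp_bound_integrable(2)[OF p C])
  have qi: "integrable \<mu> (smoothed a j)" for j unfolding smoothed_def by (rule trig_poly_integrable)
  have qm [measurable]: "smoothed a j \<in> borel_measurable \<mu>" for j using qi by (rule borel_measurable_integrable)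
  obtain r where r: "strict_mono r" "AE y in \<mu>. Cauchy (\<lambda>i. smoothed a (r i) y)"
    using cauchy_L1_AE_cauchy_subseq[of \<mu> "smoothed a", OF qi] smoothed_Cauchy[of a C, OF C1] unfolding L1_norm_def by blast
  define f where "f = (\<lambda>y. lim (\<lambda>i. smoothed a (r i) y))"
  have fm [measurable]: "f \<in> borel_measurable \<mu>" unfolding f_def by measurable
  have flim: "AE y in \<mu>. (\<lambda>i. smoothed a (r i) y) \<longlonglongrightarrow> f y"
    using r(2) by eventually_elim (simp add: f_def Cauchy_convergent_iff convergent_LIMSEQ_iff)
  have fC: "Lp_bound p \<mu> f C" by (rule Lp_bound_AE_limit[OF p C fm flim])
  have fi: "integrable \<mu> f" by (rule Lp_bound_integrable(1)[OF p fC])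
  have L1: "(\<lambda>j. L1_norm (\<lambda>y. smoothed a j y - f y)) \<longlonglongrightarrow> 0"
  proof (rule LIMSEQ_I)
    fix e :: real assume e: "0 < e"
    obtain J where J: "\<And>i j. i \<ge> J \<Longrightarrow> j \<ge> J \<Longrightarrow> L1_norm (\<lambda>y. smoothed a i y - smoothed a j y) < e / 2"
      using smoothed_Cauchy[of a C "e / 2", OF C1] e by auto
    have "L1_norm (\<lambda>y. smoothed a j y - f y) \<le> e / 2" if j: "J \<le> j" for j
    proof -
      have b: "Lp_bound 1 \<mu> (\<lambda>y. smoothed a j y - smoothed a (r (i + J)) y) (e / 2)" for i
      proof -
        have "J \<le> r (i + J)" using seq_suble[OF r(1), of "i + J"] by simp
        then have "L1_norm (\<lambda>y. smoothed a j y - smoothed a (r (i + J)) y) \<le> e / 2" using J[OF j] by (simp add: less_imp_le)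
        then show ?thesis by (rule Lp_bound_mono[OF Lp_bound_1[OF Bochner_Integration.integrable_diff[OF qi qi]]])
      qed
      have "Lp_bound 1 \<mu> (\<lambda>y. smoothed a j y - f y) (e / 2)"
      proof (rule Lp_bound_AE_limit[OF order_refl b])
        show "AE y in \<mu>. (\<lambda>i. smoothed a j y - smoothed a (r (i + J)) y) \<longlonglongrightarrow> smoothed a j y - f y"
          using flim by eventually_elim (intro tendsto_diff tendsto_const, rule LIMSEQ_ignore_initial_segment)
      qed measurable
      from Lp_bound_integrable(2)[OF order_refl this] show ?thesis by (simp add: L1_norm_def)
    qed
    moreover have "e / 2 < e" using e by simp
    ultimately have "L1_norm (\<lambda>y. smoothed a j y - f y) < e" if "J \<le> j" for j
      using that by (rule_tac le_less_trans[of _ "e / 2"])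
    then show "\<exists>J. \<forall>j\<ge>J. norm (L1_norm (\<lambda>y. smoothed a j y - f y) - 0) < e"
      using L1_norm_nonneg by (intro exI[of _ J]) auto
  qed
  have coeff: "(\<lambda>j. fourier_coeff \<mu> (smoothed a j) h) \<longlonglongrightarrow> fourier_coeff \<mu> f h" if h: "h \<in> characters" for h
  proof -
    have "norm (fourier_coeff \<mu> (smoothed a j) h - fourier_coeff \<mu> f h) \<le> L1_norm (\<lambda>y. smoothed a j y - f y)" for j
      unfolding fourier_coeff_diff[OF qi fi h, symmetric]
      by (rule fourier_coeff_L1_norm[OF Bochner_Integration.integrable_diff[OF qi fi] h])
    then have "(\<lambda>j. fourier_coeff \<mu> (smoothed a j) h - fourier_coeff \<mu> f h) \<longlonglongrightarrow> 0"
      by (intro Lim_null_comparison[OF _ L1] always_eventually allI)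
    then show ?thesis by (simp add: LIM_zero_iff)
  qed
  have "represents p lam \<beta> \<mu> f a"
  proof (rule representsI[OF p fC])
    fix h :: "'g \<Rightarrow> complex" assume h: "h \<in> characters" "h \<notin> range hchar"
    have "fourier_coeff \<mu> (smoothed a j) h = 0" for j
      unfolding smoothed_def fourier_coeff_trig_poly[OF finite_below_cutoff h(1)] using h(2) by (intro sum.neutral) auto
    then show "fourier_coeff \<mu> f h = 0" using coeff[OF h(1)] by (simp add: LIMSEQ_const_iff)
  next
    fix n
    have "fourier_coeff \<mu> (smoothed a j) (hchar n) = a n * fejer_weight j n" for j
      unfolding smoothed_def fourier_coeff_trig_poly_hchar[OF finite_below_cutoff] by (simp add: fejer_weight_outside)
    then have "(\<lambda>j. a n * fejer_weight j n) \<longlonglongrightarrow> fourier_coeff \<mu> f (hchar n)" using coeff[OF hchar_char[of n]] by simp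
    moreover have "(\<lambda>j. a n * fejer_weight j n) \<longlonglongrightarrow> a n * 1" by (intro tendsto_mult tendsto_const fejer_weight_tendsto)
    ultimately show "fourier_coeff \<mu> f (hchar n) = a n" using LIMSEQ_unique by fastforce
  qed
  then show ?thesis using that fC by blast
qed

text \<open>For fixed \<open>j\<close> the \<open>j\<close>-th Fejer polynomials of the series converge pointwise, so those of the limit
obey the same bound.\<close>

lemma coefficientwise_limit_represents:
  assumes p: "1 \<le> p" and f: "\<And>k::nat. represents p lam \<beta> \<mu> (f k) (A k)" and C: "\<And>k. Lp_bound p \<mu> (f k) C"
    and lim: "\<And>n. (\<lambda>k. A k n) \<longlonglongrightarrow> a n"
  obtains g where "represents p lam \<beta> \<mu> g a" "Lp_bound p \<mu> g C"
proof -
  have "Lp_bound p \<mu> (smoothed a j) C" for j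
  proof (rule Lp_bound_AE_limit[OF p])
    show "Lp_bound p \<mu> (smoothed (A k) j) C" for k
      unfolding smoothed_def below_def fejer_weight_def by (rule fejer_mean_Lp_bound[OF p f C cutoff_pos])
    show "smoothed a j \<in> borel_measurable \<mu>" unfolding smoothed_def using trig_poly_integrable by (rule borel_measurable_integrable)
    show "AE y in \<mu>. (\<lambda>k. smoothed (A k) j y) \<longlonglongrightarrow> smoothed a j y"
      unfolding smoothed_def trig_poly_def by (intro AE_I2 tendsto_sum tendsto_mult tendsto_const lim)
  qed
  from Lp_bounded_smoothed_represents[OF p this] show ?thesis using that by blast
qed

end

text \<open>A bound on the norms bounds every coefficient, so a diagonal subsequence converges
coefficientwise.  The limit has a representing function, and the differences form a bounded
sequence whose coefficients tend to \<open>0\<close>.\<close>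

theorem theorem3p2:
  fixes lam :: "nat \<Rightarrow> real"
    and \<beta> :: "real \<Rightarrow> 'g::{t2_space,topological_ab_group_add}"
    and \<mu> :: "'g measure"
    and p :: ennreal
    and A :: "nat \<Rightarrow> dirichlet_series"
  assumes "frequency lam"
    and "dirichlet_group lam \<beta>"
    and "haar_measure \<mu>"
    and "1 \<le> p"
    and "\<forall>N. A N \<in> Hp p lam \<beta> \<mu>"
    and "\<exists>C. \<forall>N. Hp_norm p lam \<beta> \<mu> (A N) \<le> C"
  shows "\<exists>(r :: nat \<Rightarrow> nat) (a :: dirichlet_series).
           strict_mono r \<and> a \<in> Hp p lam \<beta> \<mu> \<and>
           (\<forall>\<sigma>>0. Hp_tendsto p lam \<beta> \<mu> (\<lambda>k. translate lam \<sigma> (A (r k))) (translate lam \<sigma> a))"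
proof -
  interpret frequency_flow \<beta> \<mu> lam
    using assms(1-3) by unfold_locales (auto simp: dirichlet_group_def)
  note p = assms(4)
  obtain C where C: "\<And>N. Hp_norm p lam \<beta> \<mu> (A N) \<le> C" using assms(6) by blast
  have "\<forall>N. \<exists>f. represents p lam \<beta> \<mu> f (A N) \<and> Lp_bound p \<mu> f C"
    using Hp_obtain[OF p _ C] assms(5) by metis
  from choice[OF this] obtain f where f: "\<And>N. represents p lam \<beta> \<mu> (f N) (A N)" "\<And>N. Lp_bound p \<mu> (f N) C"
    by blast
  have coeff: "norm (A N n) \<le> C" for N n
  proof -
    have "norm (A N n) = norm (fourier_coeff \<mu> (f N) (hchar n))" using represents_coeff(1)[OF f(1)] by simp
    also have "\<dots> \<le> L1_norm (f N)" by (rule fourier_coeff_L1_norm[OF represents_integrable[OF p f(1)] hchar_char])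
    also have "\<dots> \<le> C" unfolding L1_norm_def by (rule Lp_bound_integrable(2)[OF p f(2)])
    finally show ?thesis .
  qed
  obtain r :: "nat \<Rightarrow> nat" where r: "strict_mono r" "\<And>n. n \<in> UNIV \<Longrightarrow> \<exists>l. (\<lambda>k. A (r k) n) \<longlonglongrightarrow> l"
    by (rule function_convergent_subsequence[of "UNIV :: nat set" A C, OF countableI_type coeff]) (rule that)
  define a where "a = (\<lambda>n. lim (\<lambda>k. A (r k) n))"
  have a: "(\<lambda>k. A (r k) n) \<longlonglongrightarrow> a n" for n
    using r(2)[of n] unfolding a_def by (auto simp: limI)
  obtain g where g: "represents p lam \<beta> \<mu> g a" "Lp_bound p \<mu> g C"
    by (rule coefficientwise_limit_represents[of p "\<lambda>k. f (r k)" "\<lambda>k. A (r k)" C a, OF p f(1) f(2) a]) (rule that)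
  have "Hp_tendsto p lam \<beta> \<mu> (\<lambda>k. translate lam \<sigma> (A (r k))) (translate lam \<sigma> a)" if \<sigma>: "0 < \<sigma>" for \<sigma>
  proof -
    have mem: "translate lam \<sigma> b \<in> Hp p lam \<beta> \<mu>" if "represents p lam \<beta> \<mu> h b" for h b
      using represents_translate[OF p that \<sigma>] by (auto simp: Hp_def)
    have d: "represents p lam \<beta> \<mu> (\<lambda>y. f (r k) y + - g y) (\<lambda>n. A (r k) n + - a n)" for k
      by (rule represents_add[OF p f(1) represents_uminus[OF p g(1)]])
    have db: "Lp_bound p \<mu> (\<lambda>y. f (r k) y + - g y) (4 * (C + C))" for k
      by (rule Lp_bound_add[OF p f(2) Lp_bound_uminus[OF g(2)]])
    have "(\<lambda>k. A (r k) n + - a n) \<longlonglongrightarrow> 0" for n using a[of n] by (simp add: LIM_zero_iff)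
    from translate_norm_tendsto[OF p d db this \<sigma>]
    have "(\<lambda>k. Hp_norm p lam \<beta> \<mu> (translate lam \<sigma> (\<lambda>n. A (r k) n + - a n))) \<longlonglongrightarrow> 0" .
    moreover have "translate lam \<sigma> (\<lambda>n. A (r k) n + - a n) = (\<lambda>n. translate lam \<sigma> (A (r k)) n - translate lam \<sigma> a n)" for k
      by (simp add: translate_def left_diff_distrib)
    ultimately show ?thesis using mem[OF f(1)] mem[OF g(1)] by (simp add: Hp_tendsto_def)
  qed
  then show ?thesis using r(1) g(1) by (auto simp: Hp_def)
qed

end
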